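(* Let $\mathbb{E} = \langle B,t;\,t^{-1}Ht = K,\,\varphi\rangle$ be an HNN-extension such that $H$ and $K$ are normal in $B$ and $L\varphi = L$, where $L = H\cap K$. Let $\mathcal{C}$ be a root class of groups consisting only of periodic groups and closed under taking quotient groups. If $H$ and $K$ are locally cyclic groups, then the following statements hold. 1. Let $B/H$ and $B/K$ be residually $\mathcal{C}$-groups. Then the group $H/L$ is finite if and only if $H/L\in\mathcal{C}$. 2. Let $B$ be residually a $\mathcal{C}$-group. Then the group $L$ is finite if and only if there exists a homomorphism of $B$ onto a group from $\mathcal{C}$ acting injectively on $L$. 3. Suppose that $H/L$ is finite, $\mathfrak{F}\in\mathcal{C}$, and $B$ is $\mathcal{C}$-quasi-regular with respect to $L$. Then $\mathbb{E}$ is residually a $\mathcal{C}$-group if and only if the groups $B$, $B/H$, and $B/K$ are residually $\mathcal{C}$-groups. 4. Suppose that $L$ is finite and $B$ is $\mathcal{C}$-quasi-regular with respect to $HK$. Then $\mathbb{E}$ is residually a $\mathcal{C}$-group if and only if $B$, $B/H$, and $B/K$ are residually $\mathcal{C}$-groups and $\mathfrak{F}\in\mathcal{C}$.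
   Context: Classes of groups are closed under isomorphism. Maps are written on the right. $\mathbb{E} = \langle B,t;\,t^{-1}Ht = K,\,\varphi\rangle$ denotes the HNN-extension of a group $B$ with stable letter $t$ and subgroups $H,K\leqslant B$ associated according to an isomorphism $\varphi\colon H\to K$ (so $t^{-1}ht = h\varphi$ for $h\in H$); $B$ is identified with its image in $\mathbb{E}$. $\mathfrak{F}$ denotes the cyclic subgroup of $\operatorname{Aut}L$ generated by $\varphi|_L$. A group is locally cyclic if each of its finitely generated subgroups is cyclic. A group $X$ is residually a $\mathcal{C}$-group if every non-trivial element of $X$ has non-trivial image under some homomorphism of $X$ onto a group from $\mathcal{C}$. $\mathcal{C}^{*}(X)$ denotes the family of normal subgroups $N$ of $X$ with $X/N\in\mathcal{C}$. A group $X$ is $\mathcal{C}$-quasi-regular with respect to its subgroup $Y$ if for each $M\in\mathcal{C}^{*}(Y)$ there exists $N\in\mathcal{C}^{*}(X)$ with $N\cap Y\leqslant M$. A class $\mathcal{C}$ is a root class if it contains non-trivial groups, is closed under taking subgroups, and satisfies any of the following (equivalent) conditions: (1) for every group $X$ and every subnormal series $1\leqslant Z\leqslant Y\leqslant X$ with $X/Y,Y/Z\in\mathcal{C}$ there is a normal subgroup $T$ of $X$ with $X/T\in\mathcal{C}$ and $T\leqslant Z$; (2) $\mathcal{C}$ is closed under unrestricted wreath products; (3) $\mathcal{C}$ is closed under extensions and, for any $X,Y\in\mathcal{C}$, contains the unrestricted direct product $\prod_{y\in Y}X_y$ with each $X_y\cong X$. *)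

theory Defs
  imports "HOL-Algebra.Elementary_Groups" "HOL-Algebra.Bij" "HOL-Library.Equipollence"
begin

section \<open>Classes of groups\<close>

text \<open>
  A class of groups is modelled by the set of its members over a type \<open>'u\<close>, which plays the role
  of the universe.  The set is required to be closed under isomorphism, and a group over any other
  type belongs to the class if it is isomorphic to a member of the set.
\<close>

definition group_class :: "'u monoid set \<Rightarrow> bool" where
  "group_class C \<longleftrightarrow>
     (\<forall>G\<in>C. group G) \<and> (\<forall>G\<in>C. \<forall>H :: 'u monoid. group H \<and> G \<cong> H \<longrightarrow> H \<in> C)"

definition in_class :: "'u monoid set \<Rightarrow> ('a, 'b) monoid_scheme \<Rightarrow> bool" where
  "in_class C X \<longleftrightarrow> group X \<and> (\<exists>G\<in>C. X \<cong> G)"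

definition subgroup_closed :: "'u monoid set \<Rightarrow> bool" where
  "subgroup_closed C \<longleftrightarrow> (\<forall>G\<in>C. \<forall>S. subgroup S G \<longrightarrow> G\<lparr>carrier := S\<rparr> \<in> C)"

definition quotient_closed :: "'u monoid set \<Rightarrow> bool" where
  "quotient_closed C \<longleftrightarrow> (\<forall>G\<in>C. \<forall>N. N \<lhd> G \<longrightarrow> in_class C (G Mod N))"

definition periodic_group :: "('a, 'b) monoid_scheme \<Rightarrow> bool" where
  "periodic_group X \<longleftrightarrow> group X \<and> (\<forall>x\<in>carrier X. \<exists>n::nat. n > 0 \<and> x [^]\<^bsub>X\<^esub> n = \<one>\<^bsub>X\<^esub>)"

text \<open>
  Of the equivalent definitions of a root class, we take the one by subnormal series (the Gruenberg
  condition): unlike closure under unrestricted wreath products or unrestricted direct powers, it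
  never leaves the universe \<open>'u\<close>.
\<close>

definition root_class :: "'u monoid set \<Rightarrow> bool" where
  "root_class C \<longleftrightarrow>
     group_class C \<and>
     (\<exists>G\<in>C. carrier G \<noteq> {\<one>\<^bsub>G\<^esub>}) \<and>
     subgroup_closed C \<and>
     (\<forall>(X :: 'u monoid) Y Z.
        group X \<and> Y \<lhd> X \<and> Z \<lhd> X\<lparr>carrier := Y\<rparr> \<and>
        in_class C (X Mod Y) \<and> in_class C (X\<lparr>carrier := Y\<rparr> Mod Z) \<longrightarrow>
        (\<exists>T. T \<lhd> X \<and> in_class C (X Mod T) \<and> T \<subseteq> Z))"

definition residually :: "'u monoid set \<Rightarrow> ('a, 'b) monoid_scheme \<Rightarrow> bool" where
  "residually C X \<longleftrightarrow>
     group X \<and>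
     (\<forall>x\<in>carrier X. x \<noteq> \<one>\<^bsub>X\<^esub> \<longrightarrow> (\<exists>G\<in>C. \<exists>f\<in>epi X G. f x \<noteq> \<one>\<^bsub>G\<^esub>))"

definition class_quotient_kernels ::
  "'u monoid set \<Rightarrow> ('a, 'b) monoid_scheme \<Rightarrow> 'a set set" where
  "class_quotient_kernels C X = {N. N \<lhd> X \<and> in_class C (X Mod N)}"

definition quasi_regular ::
  "'u monoid set \<Rightarrow> ('a, 'b) monoid_scheme \<Rightarrow> 'a set \<Rightarrow> bool" where
  "quasi_regular C X Y \<longleftrightarrow>
     (\<forall>M\<in>class_quotient_kernels C (X\<lparr>carrier := Y\<rparr>).
        \<exists>N\<in>class_quotient_kernels C X. N \<inter> Y \<subseteq> M)"

definition locally_cyclic_group :: "('a, 'b) monoid_scheme \<Rightarrow> bool" where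
  "locally_cyclic_group X \<longleftrightarrow>
     group X \<and>
     (\<forall>S. finite S \<and> S \<subseteq> carrier X \<longrightarrow> cyclic_group (subgroup_generated X S))"

section \<open>HNN-extensions\<close>

text \<open>
  The group with presentation \<open>\<langle>B, t; t\<^sup>-\<^sup>1 h t = h \<phi> for h \<in> H\<rangle>\<close> consists of the words over
  \<open>carrier B\<close>, \<open>t\<close> and \<open>t\<^sup>-\<^sup>1\<close>, modulo the least congruence containing the multiplication table of
  \<open>B\<close>, the cancellation of \<open>t\<close> against \<open>t\<^sup>-\<^sup>1\<close> and the HNN relations.  The second associated
  subgroup is \<open>\<phi> ` H\<close>.
\<close>

datatype 'a hnn_letter = Base 'a | Stable | Stable_Inv

definition hnn_words :: "('a, 'b) monoid_scheme \<Rightarrow> 'a hnn_letter list set" where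
  "hnn_words B = lists (Base ` carrier B \<union> {Stable, Stable_Inv})"

inductive hnn_cong ::
  "('a, 'b) monoid_scheme \<Rightarrow> 'a set \<Rightarrow> ('a \<Rightarrow> 'a) \<Rightarrow> 'a hnn_letter list \<Rightarrow> 'a hnn_letter list \<Rightarrow> bool"
  for B H \<phi> where
  refl: "w \<in> hnn_words B \<Longrightarrow> hnn_cong B H \<phi> w w"
| sym: "hnn_cong B H \<phi> v w \<Longrightarrow> hnn_cong B H \<phi> w v"
| trans: "hnn_cong B H \<phi> u v \<Longrightarrow> hnn_cong B H \<phi> v w \<Longrightarrow> hnn_cong B H \<phi> u w"
| app: "hnn_cong B H \<phi> u u' \<Longrightarrow> hnn_cong B H \<phi> v v' \<Longrightarrow> hnn_cong B H \<phi> (u @ v) (u' @ v')"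
| base_one: "hnn_cong B H \<phi> [Base \<one>\<^bsub>B\<^esub>] []"
| base_mult: "a \<in> carrier B \<Longrightarrow> b \<in> carrier B \<Longrightarrow>
    hnn_cong B H \<phi> [Base a, Base b] [Base (a \<otimes>\<^bsub>B\<^esub> b)]"
| stable_right_inv: "hnn_cong B H \<phi> [Stable, Stable_Inv] []"
| stable_left_inv: "hnn_cong B H \<phi> [Stable_Inv, Stable] []"
| stable_conj: "h \<in> H \<Longrightarrow> hnn_cong B H \<phi> [Stable_Inv, Base h, Stable] [Base (\<phi> h)]"

definition hnn_rel ::
  "('a, 'b) monoid_scheme \<Rightarrow> 'a set \<Rightarrow> ('a \<Rightarrow> 'a) \<Rightarrow> ('a hnn_letter list \<times> 'a hnn_letter list) set" where
  "hnn_rel B H \<phi> = {(v, w). hnn_cong B H \<phi> v w}"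

definition hnn_extension ::
  "('a, 'b) monoid_scheme \<Rightarrow> 'a set \<Rightarrow> ('a \<Rightarrow> 'a) \<Rightarrow> 'a hnn_letter list set monoid" where
  "hnn_extension B H \<phi> =
     \<lparr>carrier = hnn_words B // hnn_rel B H \<phi>,
      mult = (\<lambda>X Y. \<Union>x\<in>X. \<Union>y\<in>Y. hnn_rel B H \<phi> `` {x @ y}),
      one = hnn_rel B H \<phi> `` {[]}\<rparr>"

lemma hnn_cong_words:
  assumes "group B" "H \<subseteq> carrier B" "\<phi> ` H \<subseteq> carrier B" "hnn_cong B H \<phi> v w"
  shows "v \<in> hnn_words B \<and> w \<in> hnn_words B"
proof -
  interpret group B by fact
  show ?thesis
    using assms(4)
    by (induction rule: hnn_cong.induct) (use assms(2,3) in \<open>auto simp: hnn_words_def\<close>)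
qed

lemma equiv_hnn_rel:
  assumes "group B" "H \<subseteq> carrier B" "\<phi> ` H \<subseteq> carrier B"
  shows "equiv (hnn_words B) (hnn_rel B H \<phi>)"
proof (rule equivI)
  show "hnn_rel B H \<phi> \<subseteq> hnn_words B \<times> hnn_words B"
    using hnn_cong_words[OF assms] by (auto simp: hnn_rel_def)
  show "refl_on (hnn_words B) (hnn_rel B H \<phi>)"
    by (auto simp: refl_on_def hnn_rel_def intro: hnn_cong.refl)
  show "sym (hnn_rel B H \<phi>)"
    by (auto simp: sym_def hnn_rel_def intro: hnn_cong.sym)
  show "trans (hnn_rel B H \<phi>)"
    by (auto simp: trans_def hnn_rel_def intro: hnn_cong.trans)
qed

lemma hnn_mult_class:
  assumes "group B" "H \<subseteq> carrier B" "\<phi> ` H \<subseteq> carrier B" "v \<in> hnn_words B" "w \<in> hnn_words B"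
  shows "(hnn_rel B H \<phi> `` {v}) \<otimes>\<^bsub>hnn_extension B H \<phi>\<^esub> (hnn_rel B H \<phi> `` {w})
         = hnn_rel B H \<phi> `` {v @ w}"
proof -
  let ?R = "hnn_rel B H \<phi>"
  note eq = equiv_hnn_rel[OF assms(1-3)]
  have "?R `` {x @ y} = ?R `` {v @ w}" if "x \<in> ?R `` {v}" "y \<in> ?R `` {w}" for x y
  proof -
    have "(v @ w, x @ y) \<in> ?R"
      using that by (auto simp: hnn_rel_def intro: hnn_cong.app)
    then show ?thesis
      using equiv_class_eq[OF eq] by metis
  qed
  moreover have "v \<in> ?R `` {v}" "w \<in> ?R `` {w}"
    using assms(4,5) equiv_class_self[OF eq] by auto
  ultimately show ?thesis
    unfolding hnn_extension_def monoid.simps by blast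
qed

lemma hnn_word_left_inverse:
  assumes "group B" "w \<in> hnn_words B"
  shows "\<exists>v\<in>hnn_words B. hnn_cong B H \<phi> (v @ w) []"
  using assms(2)
proof (induction w)
  case Nil
  then show ?case by (auto intro!: bexI[of _ "[]"] hnn_cong.refl)
next
  case (Cons l w)
  interpret group B by fact
  from Cons have w: "w \<in> hnn_words B" and l: "[l] \<in> hnn_words B"
    by (auto simp: hnn_words_def)
  from Cons.IH[OF w] obtain v where v: "v \<in> hnn_words B" "hnn_cong B H \<phi> (v @ w) []"
    by blast
  have "\<exists>l'. [l'] \<in> hnn_words B \<and> hnn_cong B H \<phi> [l', l] []"
  proof (cases l)
    case (Base b)
    with l have b: "b \<in> carrier B" by (auto simp: hnn_words_def)
    have "hnn_cong B H \<phi> [Base (inv\<^bsub>B\<^esub> b), Base b] [Base \<one>\<^bsub>B\<^esub>]"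
      using hnn_cong.base_mult[of "inv\<^bsub>B\<^esub> b" B b H \<phi>] b by simp
    then show ?thesis
      using b Base
      by (intro exI[of _ "Base (inv\<^bsub>B\<^esub> b)"])
        (auto simp: hnn_words_def intro: hnn_cong.trans hnn_cong.base_one)
  next
    case Stable
    then show ?thesis
      by (intro exI[of _ Stable_Inv]) (auto simp: hnn_words_def intro: hnn_cong.stable_left_inv)
  next
    case Stable_Inv
    then show ?thesis
      by (intro exI[of _ Stable]) (auto simp: hnn_words_def intro: hnn_cong.stable_right_inv)
  qed
  then obtain l' where l': "[l'] \<in> hnn_words B" "hnn_cong B H \<phi> [l', l] []" by blast
  have "hnn_cong B H \<phi> (v @ ([l', l] @ w)) (v @ ([] @ w))"
    using v(1) w l'(2) by (intro hnn_cong.app hnn_cong.refl)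
  with v(2) have "hnn_cong B H \<phi> ((v @ [l']) @ (l # w)) []"
    using hnn_cong.trans by fastforce
  moreover have "v @ [l'] \<in> hnn_words B"
    using v(1) l'(1) by (auto simp: hnn_words_def)
  ultimately show ?case by blast
qed

lemma group_hnn_extension:
  assumes "group B" "H \<subseteq> carrier B" "\<phi> ` H \<subseteq> carrier B"
  shows "group (hnn_extension B H \<phi>)"
proof -
  let ?R = "hnn_rel B H \<phi>" and ?E = "hnn_extension B H \<phi>"
  note eq = equiv_hnn_rel[OF assms] and mult = hnn_mult_class[OF assms]
  have car: "X \<in> carrier ?E \<longleftrightarrow> (\<exists>w\<in>hnn_words B. X = ?R `` {w})" for X
    by (auto simp: hnn_extension_def quotient_def)
  have one: "\<one>\<^bsub>?E\<^esub> = ?R `` {[]}"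
    by (simp add: hnn_extension_def)
  have words: "[] \<in> hnn_words B"
    "v \<in> hnn_words B \<Longrightarrow> w \<in> hnn_words B \<Longrightarrow> v @ w \<in> hnn_words B" for v w
    by (auto simp: hnn_words_def)
  show ?thesis
  proof (rule groupI)
    show "X \<otimes>\<^bsub>?E\<^esub> Y \<in> carrier ?E" if "X \<in> carrier ?E" "Y \<in> carrier ?E" for X Y
      using that mult words(2) by (metis car)
    show "\<one>\<^bsub>?E\<^esub> \<in> carrier ?E"
      using car one words(1) by blast
    show "X \<otimes>\<^bsub>?E\<^esub> Y \<otimes>\<^bsub>?E\<^esub> Z = X \<otimes>\<^bsub>?E\<^esub> (Y \<otimes>\<^bsub>?E\<^esub> Z)"
      if "X \<in> carrier ?E" "Y \<in> carrier ?E" "Z \<in> carrier ?E" for X Y Z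
      using that by (auto simp: car mult words(2))
    show "\<one>\<^bsub>?E\<^esub> \<otimes>\<^bsub>?E\<^esub> X = X" if "X \<in> carrier ?E" for X
      using that by (auto simp: car one mult words(1))
    show "\<exists>Y\<in>carrier ?E. Y \<otimes>\<^bsub>?E\<^esub> X = \<one>\<^bsub>?E\<^esub>" if "X \<in> carrier ?E" for X
    proof -
      from that obtain w where w: "w \<in> hnn_words B" "X = ?R `` {w}"
        by (auto simp: car)
      obtain v where v: "v \<in> hnn_words B" "hnn_cong B H \<phi> (v @ w) []"
        using hnn_word_left_inverse[OF assms(1) w(1)] by blast
      have "(v @ w, []) \<in> ?R"
        using v(2) by (simp add: hnn_rel_def)
      then have "?R `` {v} \<otimes>\<^bsub>?E\<^esub> X = \<one>\<^bsub>?E\<^esub>"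
        using equiv_class_eq[OF eq] mult[OF v(1) w(1)] w(2) one by simp
      then show ?thesis
        using v(1) car by blast
    qed
  qed
qed

text \<open>
  The cyclic subgroup of the automorphism group of \<open>L\<close> generated by \<open>\<phi>|\<^sub>L\<close>.  Elements of
  \<^const>\<open>AutoGroup\<close> are extensional functions, hence \<^const>\<open>restrict\<close>.
\<close>

definition restricted_aut_group ::
  "('a, 'b) monoid_scheme \<Rightarrow> 'a set \<Rightarrow> ('a \<Rightarrow> 'a) \<Rightarrow> ('a \<Rightarrow> 'a) monoid" where
  "restricted_aut_group B L \<phi> = subgroup_generated (AutoGroup (B\<lparr>carrier := L\<rparr>)) {restrict \<phi> L}"

end

theory Submission
  imports Defs "HOL-Algebra.SndIsomorphismGrp"
begin

text \<open>
  Let \<open>E\<close> be the HNN-extension, \<open>t\<close> its stable letter and \<open>\<C>\<^sup>*(X)\<close> the family of normal subgroups of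
  \<open>X\<close> with quotient in the class, that is, of kernels of homomorphisms of \<open>X\<close> to groups of the
  class.  Everything is expressed by members of such families.  New members come from a single
  source, the Gruenberg condition (\<open>gruenberg\<close>): if \<open>N \<in> \<C>\<^sup>*(X)\<close> and \<open>\<chi>\<close> is a homomorphism from \<open>N\<close> to
  a group of the class, then some \<open>T \<in> \<C>\<^sup>*(X)\<close> lies in the kernel of \<open>\<chi>\<close>.  Wreath products of groups of
  the class, which may be too large for the universe, are thereby avoided as targets.

  An abelian group of the class has finite exponent (\<open>finite_exponent\<close>), so a locally cyclic
  group with a homomorphism to a group of the class has finite image.  This gives the first two
  statements.  It also shows that the members of \<open>\<C>\<^sup>*(H)\<close> are the sets of \<open>n\<close>-th powers for some \<open>n\<close>
  (\<open>kernel_of_locally_cyclic_is_power\<close>); hence they are characteristic, and those of \<open>\<C>\<^sup>*(L)\<close> are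
  \<open>\<phi>\<close>-invariant.

  Sufficiency in the last two statements.  An element of \<open>E\<close> outside the base group is given by a
  reduced word.  If it stays reduced modulo some \<open>T \<in> \<C>\<^sup>*(E)\<close>, then some smaller
  member of \<open>\<C>\<^sup>*(E)\<close> avoids it (\<open>separate_reduced_word\<close>); this replaces the argument
  that the kernel of a homomorphism which is injective on the base group is free and that free groups are
  residually in the class.  It remains to find members of \<open>\<C>\<^sup>*(E)\<close> with small enough trace on \<open>B\<close>.
  Suppose that the cyclic group generated by \<open>\<phi>\<close> on \<open>L\<close> is in the class.
  If \<open>N \<in> \<C>\<^sup>*(B)\<close> satisfies \<open>(N \<inter> H)\<phi> = N \<inter> K\<close> and \<open>N \<inter> HK = (N \<inter> H)(N \<inter> K)\<close>, then \<open>N\<close> itself is the trace on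
  \<open>B\<close> of a member of \<open>\<C>\<^sup>*(E)\<close> (\<open>kernel_over_compatible\<close>): passing to \<open>B/N\<close>, one may assume that \<open>B\<close> is in
  the class and \<open>N = 1\<close>, so that \<open>H\<close> and \<open>K\<close> are finite cyclic, and then one separates successively the elements
  of \<open>B\<close> outside \<open>HK\<close>, those of \<open>HK\<close> outside \<open>L\<close>, and those of \<open>L\<close>.  In the last two steps a homomorphism on a
  member \<open>Y\<close> of \<open>\<C>\<^sup>*(E)\<close> is built from its restrictions to the conjugates of \<open>Y \<inter> B\<close>
  (\<open>extend_vertex_homs\<close>); it matters that automorphisms of a finite cyclic group commute.  Finally, the
  hypotheses of either statement make the admissible \<open>N\<close> cofinal in \<open>\<C>\<^sup>*(B)\<close> (\<open>cofinal_if_finite_index\<close>,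
  \<open>cofinal_if_quasi_regular\<close>).

  Necessity.  If \<open>b \<notin> H\<close> and \<open>c \<notin> K\<close>, then \<open>x = t\<^sup>-\<^sup>1 b t\<close> does not commute with its conjugate by \<open>c\<close>, by
  Britton's lemma; but in a quotient of \<open>E\<close> in which the image of \<open>b\<close> lies in that of \<open>H\<close>, both fall
  into the image of the abelian normal subgroup \<open>K\<close> of \<open>B\<close>
  (\<open>residual_separates_associated_subgroup\<close>).
\<close>

section \<open>Preliminaries on groups and cardinalities\<close>

lemma (in group) mult_inv_mult:
  assumes "x \<in> carrier G" "y \<in> carrier G"
  shows "x \<otimes> (inv x \<otimes> y) = y" "inv x \<otimes> (x \<otimes> y) = y"
  using assms by (simp_all add: m_assoc[symmetric])

lemma (in normal) coset_eq_iff_mem: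
  assumes "x \<in> carrier G" shows "H #> x = H \<longleftrightarrow> x \<in> H"
  using assms coset_join1 coset_join2 is_subgroup by blast

lemma (in group) coset_eq_iff:
  assumes "N \<lhd> G" "x \<in> carrier G" "y \<in> carrier G"
  shows "N #> x = N #> y \<longleftrightarrow> x \<otimes> inv y \<in> N"
proof -
  interpret N: normal N G by fact
  interpret Q: group_hom G "G Mod N" "(#>) N"
    using N.r_coset_hom_Mod N.factorgroup_is_group
    by (simp add: group_hom_def group_hom_axioms_def group_axioms)
  have c: "N #> x \<in> carrier (G Mod N)" "N #> y \<in> carrier (G Mod N)" using assms by simp_all
  have "N #> (x \<otimes> inv y) = (N #> x) \<otimes>\<^bsub>G Mod N\<^esub> inv\<^bsub>G Mod N\<^esub> (N #> y)"
    using assms Q.hom_mult[of x "inv y"] Q.hom_inv[of y] by simp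
  then have "N #> x = N #> y \<longleftrightarrow> N #> (x \<otimes> inv y) = \<one>\<^bsub>G Mod N\<^esub>"
    using Q.H.inv_equality[of "N #> x" "inv\<^bsub>G Mod N\<^esub> (N #> y)"] c Q.H.inv_inv Q.H.r_inv by (metis Q.H.inv_closed)
  also have "\<dots> \<longleftrightarrow> x \<otimes> inv y \<in> N" using N.coset_eq_iff_mem[of "x \<otimes> inv y"] assms by simp
  finally show ?thesis .
qed

lemma set_multI: "h \<in> H \<Longrightarrow> k \<in> K \<Longrightarrow> h \<otimes>\<^bsub>G\<^esub> k \<in> H <#>\<^bsub>G\<^esub> K"
  by (auto simp: set_mult_def)

lemma (in group) subset_set_mult:
  assumes "subgroup H G" "subgroup K G"
  shows "H \<subseteq> H <#> K" "K \<subseteq> H <#> K"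
proof -
  show "H \<subseteq> H <#> K"
  proof
    fix h assume "h \<in> H"
    then show "h \<in> H <#> K"
      using set_multI[OF _ subgroup.one_closed[OF assms(2)], of h H G] subgroup.mem_carrier[OF assms(1)] by simp
  qed
  show "K \<subseteq> H <#> K"
  proof
    fix k assume "k \<in> K"
    then show "k \<in> H <#> K"
      using set_multI[OF subgroup.one_closed[OF assms(1)], of k K G] subgroup.mem_carrier[OF assms(2)] by simp
  qed
qed

lemma hom_subset_carrier:
  "f \<in> hom (G\<lparr>carrier := W\<rparr>) Y \<Longrightarrow> A \<subseteq> W \<Longrightarrow> f \<in> hom (G\<lparr>carrier := A\<rparr>) Y"
  by (auto simp: hom_def Pi_iff subset_iff)

lemma hom_restrict_carrier:
  "f \<in> hom G Y \<Longrightarrow> A \<subseteq> carrier G \<Longrightarrow> f \<in> hom (G\<lparr>carrier := A\<rparr>) Y"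
  by (auto simp: hom_def Pi_iff subset_iff)

lemma iso_image_of_inj_hom:
  assumes "group X" "group Y" "f \<in> hom X Y" "inj_on f (carrier X)"
  shows "X \<cong> Y\<lparr>carrier := f ` carrier X\<rparr>"
proof -
  have "f \<in> iso X (Y\<lparr>carrier := f ` carrier X\<rparr>)"
    using assms by (auto simp: iso_def hom_def bij_betw_def)
  then show ?thesis by (rule is_isoI)
qed

definition coset_rep :: "('a, 'b) monoid_scheme \<Rightarrow> 'a set \<Rightarrow> 'a \<Rightarrow> 'a" where
  "coset_rep G S x = (SOME y. y \<in> S #>\<^bsub>G\<^esub> x)"

lemma (in group) coset_rep_decomp:
  assumes "subgroup S G" "x \<in> carrier G"
  obtains s where "s \<in> S" "x = s \<otimes> coset_rep G S x" "coset_rep G S x \<in> carrier G"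
proof -
  have "coset_rep G S x \<in> S #> x"
    unfolding coset_rep_def using rcos_self[OF assms(2,1)] by (rule someI)
  then obtain s where s: "s \<in> S" "coset_rep G S x = s \<otimes> x" by (auto simp: r_coset_def)
  have "s \<in> carrier G" using s(1) subgroup.subset[OF assms(1)] by blast
  then show thesis
    using that[of "inv s"] s assms subgroup.m_inv_closed[OF assms(1)] by (simp add: m_assoc[symmetric])
qed

lemma (in group) coset_rep_mult:
  assumes "subgroup S G" "s \<in> S" "x \<in> carrier G"
  shows "coset_rep G S (s \<otimes> x) = coset_rep G S x"
proof -
  have "S #> (s \<otimes> x) = S #> x"
    using assms subgroup.subset[OF assms(1)] coset_mult_assoc[of S s x] coset_join2[of s S]
    by (auto simp: subset_iff)
  then show ?thesis by (simp add: coset_rep_def)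
qed

lemma finite_image_factor:
  assumes "finite (f ` A)" "\<And>x y. x \<in> A \<Longrightarrow> y \<in> A \<Longrightarrow> f x = f y \<Longrightarrow> g x = g y"
  shows "finite (g ` A)"
proof -
  have "g ` A \<subseteq> (\<lambda>c. g (SOME x. x \<in> A \<and> f x = c)) ` f ` A"
  proof
    fix y assume "y \<in> g ` A"
    then obtain x where x: "x \<in> A" "y = g x" by blast
    let ?x = "SOME z. z \<in> A \<and> f z = f x"
    have "?x \<in> A \<and> f ?x = f x" by (rule someI[of _ x]) (use x in simp)
    then have "y = g ?x" using assms(2)[of ?x x] x by simp
    then show "y \<in> (\<lambda>c. g (SOME x. x \<in> A \<and> f x = c)) ` f ` A"
      by (rule image_eqI) (rule imageI[OF x(1)])
  qed
  then show ?thesis using assms(1) by (meson finite_imageI finite_subset)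
qed

lemma ex_inj_pairing:
  assumes "infinite (UNIV :: 'u set)"
  shows "\<exists>p :: 'u \<times> 'u \<Rightarrow> 'u. inj p"
proof -
  have "(card_of ((UNIV :: 'u set) \<times> (UNIV :: 'u set)), card_of (UNIV :: 'u set)) \<in> ordLeq"
    using card_of_Times_same_infinite[OF assms] ordIso_iff_ordLeq by blast
  then show ?thesis
    using card_of_ordLeq[of "(UNIV :: 'u set) \<times> (UNIV :: 'u set)" "UNIV :: 'u set"] by auto
qed

text \<open>
  A list is coded by iterating a pairing function; the letters \<open>a\<close> and \<open>b\<close> mark the end and the
  continuation.
\<close>

lemma lists_lepoll_infinite:
  assumes "infinite (UNIV :: 'u set)"
  shows "(UNIV :: 'u list set) \<lesssim> (UNIV :: 'u set)"
proof -
  obtain p :: "'u \<times> 'u \<Rightarrow> 'u" where p: "inj p" using ex_inj_pairing[OF assms] by blast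
  obtain a b :: 'u where ab: "a \<noteq> b"
    using assms by (metis (full_types) UNIV_eq_I finite.emptyI finite.insertI insertCI)
  define enc where "enc = rec_list (p (a, a)) (\<lambda>x _ r. p (b, p (x, r)))"
  have enc: "enc [] = p (a, a)" "enc (x # xs) = p (b, p (x, enc xs))" for x xs
    by (simp_all add: enc_def)
  have "enc xs = enc ys \<Longrightarrow> xs = ys" for xs ys
  proof (induction xs arbitrary: ys)
    case Nil
    then show ?case using ab by (cases ys) (auto simp: enc dest!: injD[OF p])
  next
    case (Cons x xs)
    then show ?case using ab by (cases ys) (auto simp: enc dest!: injD[OF p])
  qed
  then show ?thesis by (auto simp: lepoll_def inj_def)
qed

lemma times_infinite_eqpoll:
  assumes "R \<noteq> {}" "R \<lesssim> W" "infinite W"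
  shows "R \<times> W \<approx> W"
proof -
  have "(card_of R, card_of W) \<in> ordLeq" using assms(2) by (simp add: lepoll_def card_of_ordLeq)
  then show ?thesis
    using card_of_Times_infinite[OF assms(3,1)] by (simp add: eqpoll_iff_card_of_ordIso)
qed

section \<open>Root classes of periodic groups\<close>

lemma in_class_iso:
  assumes "in_class C X" "X \<cong> Y" "group Y"
  shows "in_class C Y"
  using assms group.iso_sym iso_trans unfolding in_class_def by metis

locale root_class_of_periodic_groups =
  fixes C :: "'u monoid set"
  assumes infinite_universe: "infinite (UNIV :: 'u set)"
    and root: "root_class C"
    and periodic: "\<forall>G\<in>C. periodic_group G"
    and quotient: "quotient_closed C"
begin

abbreviation kernels where "kernels X \<equiv> class_quotient_kernels C X"

lemma in_class_group: "in_class C X \<Longrightarrow> group X"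
  by (simp add: in_class_def)

lemma member_group: "G \<in> C \<Longrightarrow> group G"
  using root by (simp add: root_class_def group_class_def)

lemma in_class_member: "G \<in> C \<Longrightarrow> in_class C G"
  unfolding in_class_def using member_group iso_refl by blast

lemma in_class_inj_hom:
  assumes "group X" "in_class C Y" "f \<in> hom X Y" "inj_on f (carrier X)"
  shows "in_class C X"
proof -
  obtain G g where G: "G \<in> C" "g \<in> iso Y G"
    using assms(2) by (auto simp: in_class_def is_iso_def)
  note gG = member_group[OF G(1)] and gY = in_class_group[OF assms(2)]
  have h: "g \<circ> f \<in> hom X G"
    using assms(3) G(2) by (metis hom_compose iso_imp_homomorphism)
  have i: "inj_on (g \<circ> f) (carrier X)"
    using assms(3,4) G(2)
    by (intro comp_inj_on)
      (auto simp: iso_def bij_betw_def hom_def intro: inj_on_subset)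
  have "subgroup ((g \<circ> f) ` carrier X) G"
    using group_hom.img_is_subgroup[of X G "g \<circ> f"] h assms(1) gG
    by (simp add: group_hom_def group_hom_axioms_def)
  then have "G\<lparr>carrier := (g \<circ> f) ` carrier X\<rparr> \<in> C"
    using root G(1) by (auto simp: root_class_def subgroup_closed_def)
  then show ?thesis
    using iso_image_of_inj_hom[OF assms(1) gG h i] assms(1) by (auto simp: in_class_def)
qed

lemma in_class_subgroup:
  assumes "in_class C X" "subgroup S X"
  shows "in_class C (X\<lparr>carrier := S\<rparr>)"
proof -
  interpret group X using in_class_group assms(1) .
  show ?thesis
    by (rule in_class_inj_hom[where f = id, OF _ assms(1)])
      (use assms(2) subgroup.subset[OF assms(2)] subgroup.subgroup_is_group in \<open>auto simp: hom_def\<close>)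
qed

lemma in_class_epi:
  assumes "in_class C X" "group Y" "f \<in> epi X Y"
  shows "in_class C Y"
proof -
  have "\<exists>G\<in>C. G \<cong> X"
    using assms(1) group.iso_sym unfolding in_class_def by blast
  then obtain G g where G: "G \<in> C" "g \<in> iso G X" by (auto simp: is_iso_def)
  note gG = member_group[OF G(1)]
  have "g \<in> epi G X" using G(2) by (simp add: iso_iff_mon_epi)
  then have e: "f \<circ> g \<in> epi G Y" using assms(3) by (rule epi_compose)
  then interpret group_hom G Y "f \<circ> g"
    using gG assms(2) by (simp add: group_hom_def group_hom_axioms_def epi_def)
  have "in_class C (G Mod kernel G Y (f \<circ> g))"
    using quotient G(1) normal_kernel by (auto simp: quotient_closed_def)
  moreover have "G Mod kernel G Y (f \<circ> g) \<cong> Y"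
    by (rule FactGroup_iso) (use e in \<open>auto simp: epi_def\<close>)
  ultimately show ?thesis using in_class_iso assms(2) by blast
qed

lemma kernelsD:
  assumes "N \<in> kernels X"
  shows "N \<lhd> X" "in_class C (X Mod N)" "group X"
  using assms by (auto simp: class_quotient_kernels_def normal_def)

text \<open>
  The next two lemmas describe \<open>\<C>\<^sup>*(X)\<close> as the set of kernels of homomorphisms into groups of the class,
  which is the form in which it is used below.
\<close>

lemma kernelsI_hom:
  assumes "group X" "in_class C Y" "f \<in> hom X Y" and N: "N = {x \<in> carrier X. f x = \<one>\<^bsub>Y\<^esub>}"
  shows "N \<in> kernels X"
proof -
  interpret group_hom X Y f
    using assms in_class_group by (simp add: group_hom_def group_hom_axioms_def)
  have Nk: "N = kernel X Y f" by (simp add: N kernel_def)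
  have nN: "N \<lhd> X" using normal_kernel Nk by simp
  have "(\<lambda>X. the_elem (f ` X)) \<in> hom (X Mod N) Y" "inj_on (\<lambda>X. the_elem (f ` X)) (carrier (X Mod N))"
    unfolding Nk by (rule FactGroup_hom FactGroup_inj_on)+
  then have "in_class C (X Mod N)"
    using in_class_inj_hom assms(2) normal.factorgroup_is_group[OF nN] by blast
  then show ?thesis using nN by (simp add: class_quotient_kernels_def)
qed

lemma kernelsE:
  assumes "N \<in> kernels X"
  obtains G f where "G \<in> C" "f \<in> epi X G" "N = {x \<in> carrier X. f x = \<one>\<^bsub>G\<^esub>}"
proof -
  interpret normal N X using kernelsD(1)[OF assms] .
  obtain G g where G: "G \<in> C" "g \<in> iso (X Mod N) G"
    using kernelsD(2)[OF assms] by (auto simp: in_class_def is_iso_def)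
  note gG = member_group[OF G(1)]
  interpret Q: group "X Mod N" by (rule factorgroup_is_group)
  interpret gh: group_hom "X Mod N" G g
    using G gG by (simp add: group_hom_def group_hom_axioms_def iso_imp_homomorphism Q.group_axioms)
  have "(#>\<^bsub>X\<^esub>) N \<in> epi X (X Mod N)"
    using r_coset_hom_Mod by (simp add: epi_def carrier_FactGroup)
  moreover have "g \<in> epi (X Mod N) G" using G(2) by (simp add: iso_iff_mon_epi)
  ultimately have e: "g \<circ> (#>\<^bsub>X\<^esub>) N \<in> epi X G" by (rule epi_compose)
  have inj: "inj_on g (carrier (X Mod N))" using G(2) by (simp add: iso_def bij_betw_def)
  have "x \<in> N \<longleftrightarrow> g (N #>\<^bsub>X\<^esub> x) = \<one>\<^bsub>G\<^esub>" if x: "x \<in> carrier X" for x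
  proof -
    have "N #>\<^bsub>X\<^esub> x \<in> carrier (X Mod N)" "N \<in> carrier (X Mod N)"
      using x Q.one_closed by (auto simp: carrier_FactGroup)
    then have "g (N #>\<^bsub>X\<^esub> x) = g N \<longleftrightarrow> N #>\<^bsub>X\<^esub> x = N"
      using inj by (simp add: inj_on_eq_iff)
    also have "\<dots> \<longleftrightarrow> x \<in> N" using x by (rule coset_eq_iff_mem)
    finally have "x \<in> N \<longleftrightarrow> g (N #>\<^bsub>X\<^esub> x) = g N" by simp
    also have "g N = \<one>\<^bsub>G\<^esub>" using gh.hom_one by simp
    finally show ?thesis .
  qed
  then have "N = {x \<in> carrier X. (g \<circ> (#>\<^bsub>X\<^esub>) N) x = \<one>\<^bsub>G\<^esub>}"
    using subset by auto
  then show thesis using that G(1) e by blast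
qed

lemma kernels_vimage:
  assumes "group X" "T \<in> kernels Y" "f \<in> hom X Y"
  shows "{x \<in> carrier X. f x \<in> T} \<in> kernels X"
proof -
  obtain G g where G: "G \<in> C" "g \<in> epi Y G" "T = {x \<in> carrier Y. g x = \<one>\<^bsub>G\<^esub>}"
    using kernelsE[OF assms(2)] .
  have "g \<circ> f \<in> hom X G" using G(2) assms(3) by (auto simp: epi_def intro: hom_compose)
  then show ?thesis
    by (rule kernelsI_hom[OF assms(1) in_class_member[OF G(1)]])
      (use G(3) assms(3) in \<open>auto simp: hom_def\<close>)
qed

lemma kernels_upward:
  assumes "T \<in> kernels X" "T \<subseteq> N" "N \<lhd> X"
  shows "N \<in> kernels X"
proof -
  interpret T: normal T X using kernelsD(1)[OF assms(1)] .
  interpret N: normal N X using assms(3) .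
  interpret group_hom X "X Mod N" "(#>\<^bsub>X\<^esub>) N"
    using N.r_coset_hom_Mod N.factorgroup_is_group
    by (simp add: group_hom_def group_hom_axioms_def T.group_axioms)
  have "T \<subseteq> kernel X (X Mod N) ((#>\<^bsub>X\<^esub>) N)"
    using assms(2) T.subset N.coset_eq_iff_mem by (simp add: kernel_def subset_iff)
  then obtain g where g: "g \<in> hom (X Mod T) (X Mod N)" "\<And>x. x \<in> carrier X \<Longrightarrow> g (T #>\<^bsub>X\<^esub> x) = N #>\<^bsub>X\<^esub> x"
    using FactGroup_universal_kernel[OF kernelsD(1)[OF assms(1)]] by blast
  have "g \<in> epi (X Mod T) (X Mod N)"
    using g by (auto simp: epi_iff_subset carrier_FactGroup image_iff)
  then have "in_class C (X Mod N)"
    using in_class_epi kernelsD(2)[OF assms(1)] N.factorgroup_is_group by blast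
  then show ?thesis using assms(3) by (simp add: class_quotient_kernels_def)
qed

text \<open>
  The group \<open>X\<close>, whose elements may be of any type, is copied into the universe.  The Gruenberg
  condition then applies to \<open>1 \<le> Z \<le> N \<le> X\<close>, where \<open>Z\<close> is the kernel of \<open>\<chi>\<close>.
\<close>

lemma gruenberg:
  assumes small: "carrier X \<lesssim> (UNIV :: 'u set)"
    and N: "N \<in> kernels X"
    and A: "in_class C A" and \<chi>: "\<chi> \<in> hom (X\<lparr>carrier := N\<rparr>) A"
  shows "\<exists>T \<in> kernels X. T \<subseteq> {x \<in> N. \<chi> x = \<one>\<^bsub>A\<^esub>}"
proof -
  interpret group X using kernelsD(3)[OF N] .
  interpret N: normal N X using kernelsD(1)[OF N] .
  obtain g :: "_ \<Rightarrow> 'u" where g: "inj_on g (carrier X)"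
    using small by (auto simp: lepoll_def)
  define X' where "X' = \<lparr>carrier = g ` carrier X,
     mult = (\<lambda>a b. g (inv_into (carrier X) g a \<otimes>\<^bsub>X\<^esub> inv_into (carrier X) g b)), one = g \<one>\<^bsub>X\<^esub>\<rparr>"
  have gi: "g \<in> iso X X'"
    using g by (auto simp: X'_def iso_def hom_def bij_betw_def)
  then have X': "group X'"
    using iso_imp_img_group[OF gi] g by (simp add: X'_def)
  interpret X': group X' using X' .
  define k where "k = inv_into (carrier X) g"
  have ki: "k \<in> iso X' X" unfolding k_def using iso_set_sym[OF gi] .
  have kg: "k (g x) = x" if "x \<in> carrier X" for x using that g by (simp add: k_def)
  have kh: "k \<in> hom X' X" using ki by (rule iso_imp_homomorphism)
  have carX': "carrier X' = g ` carrier X" by (simp add: X'_def)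
  let ?N = "{x \<in> carrier X'. k x \<in> N}"
  have N': "?N \<in> kernels X'" using kernels_vimage[OF X' N kh] .
  have gN': "group (X'\<lparr>carrier := ?N\<rparr>)"
    using subgroup.subgroup_is_group[OF normal_imp_subgroup[OF kernelsD(1)[OF N']] X'] .
  have "\<chi> \<circ> k \<in> hom (X'\<lparr>carrier := ?N\<rparr>) A"
    using \<chi> kh by (auto simp: hom_def)
  from kernelsI_hom[OF gN' A this HOL.refl]
  have Z: "{x \<in> ?N. \<chi> (k x) = \<one>\<^bsub>A\<^esub>} \<in> kernels (X'\<lparr>carrier := ?N\<rparr>)" by simp
  have "\<exists>T. T \<lhd> X \<and> in_class C (X Mod T) \<and> T \<subseteq> Z"
    if "group X" "Y \<in> kernels X" "Z \<in> kernels (X\<lparr>carrier := Y\<rparr>)" for X :: "'u monoid" and Y Z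
    using root that unfolding root_class_def class_quotient_kernels_def by (simp, blast)
  from this[OF X' N' Z] obtain T where T: "T \<lhd> X'" "in_class C (X' Mod T)" "T \<subseteq> {x \<in> ?N. \<chi> (k x) = \<one>\<^bsub>A\<^esub>}"
    by (elim exE conjE)
  then have "{x \<in> carrier X. g x \<in> T} \<in> kernels X"
    by (intro kernels_vimage[of _ _ X'])
      (auto simp: class_quotient_kernels_def group_axioms gi iso_imp_homomorphism)
  moreover have "{x \<in> carrier X. g x \<in> T} \<subseteq> {x \<in> N. \<chi> x = \<one>\<^bsub>A\<^esub>}"
    using T(3) kg by fastforce
  ultimately show ?thesis by blast
qed

lemma kernels_Int:
  assumes "carrier X \<lesssim> (UNIV :: 'u set)" "N \<in> kernels X" "M \<in> kernels X"
  shows "N \<inter> M \<in> kernels X"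
proof -
  interpret group X using kernelsD(3)[OF assms(2)] .
  obtain G f where G: "G \<in> C" "f \<in> epi X G" "M = {x \<in> carrier X. f x = \<one>\<^bsub>G\<^esub>}"
    using kernelsE[OF assms(3)] .
  have s: "N \<subseteq> carrier X" using kernelsD(1)[OF assms(2)] normal_imp_subgroup subgroup.subset by blast
  have "f \<in> hom (X\<lparr>carrier := N\<rparr>) G"
    using G(2) s by (auto simp: epi_def hom_def Pi_iff subset_iff)
  then obtain T where T: "T \<in> kernels X" "T \<subseteq> {x \<in> N. f x = \<one>\<^bsub>G\<^esub>}"
    using gruenberg[OF assms(1,2) in_class_member[OF G(1)]] by blast
  show ?thesis
    by (rule kernels_upward[OF T(1)])
      (use T(2) G(3) s kernelsD(1)[OF assms(2)] kernelsD(1)[OF assms(3)] normal_subgroup_intersect in auto)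
qed

lemma carrier_in_kernels:
  assumes "group X" shows "carrier X \<in> kernels X"
proof -
  obtain G where G: "G \<in> C" using root by (auto simp: root_class_def)
  interpret G: group G using member_group[OF G] .
  show ?thesis
    by (rule kernelsI_hom[where f = "\<lambda>_. \<one>\<^bsub>G\<^esub>", OF assms in_class_member[OF G]]) (auto simp: hom_def)
qed

lemma residually_iff:
  "residually C X \<longleftrightarrow> group X \<and> (\<forall>x\<in>carrier X. x \<noteq> \<one>\<^bsub>X\<^esub> \<longrightarrow> (\<exists>T\<in>kernels X. x \<notin> T))"
proof -
  have "(\<exists>G\<in>C. \<exists>f\<in>epi X G. f x \<noteq> \<one>\<^bsub>G\<^esub>) \<longleftrightarrow> (\<exists>T\<in>kernels X. x \<notin> T)" if "group X" "x \<in> carrier X" for x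
  proof
    assume "\<exists>G\<in>C. \<exists>f\<in>epi X G. f x \<noteq> \<one>\<^bsub>G\<^esub>"
    then obtain G f where G: "G \<in> C" "f \<in> epi X G" "f x \<noteq> \<one>\<^bsub>G\<^esub>" by blast
    have "f \<in> hom X G" using G(2) by (simp add: epi_def)
    then have "{x \<in> carrier X. f x = \<one>\<^bsub>G\<^esub>} \<in> kernels X"
      by (rule kernelsI_hom[OF that(1) in_class_member[OF G(1)]]) simp
    then show "\<exists>T\<in>kernels X. x \<notin> T" by (rule bexI[rotated]) (use G(3) in simp)
  next
    assume "\<exists>T\<in>kernels X. x \<notin> T"
    then obtain T where T: "T \<in> kernels X" "x \<notin> T" by blast
    obtain G f where "G \<in> C" "f \<in> epi X G" "T = {x \<in> carrier X. f x = \<one>\<^bsub>G\<^esub>}"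
      using kernelsE[OF T(1)] .
    then show "\<exists>G\<in>C. \<exists>f\<in>epi X G. f x \<noteq> \<one>\<^bsub>G\<^esub>"
      using that(2) T(2) by blast
  qed
  then show ?thesis unfolding residually_def by (simp cong: conj_cong)
qed

lemma residually_Mod_separates:
  assumes "N \<lhd> X" "residually C (X Mod N)" "x \<in> carrier X" "x \<notin> N"
  shows "\<exists>T \<in> kernels X. N \<subseteq> T \<and> x \<notin> T"
proof -
  interpret normal N X by fact
  have "N #>\<^bsub>X\<^esub> x \<noteq> N" using assms(3,4) by (metis rcos_self is_subgroup)
  then obtain T where T: "T \<in> kernels (X Mod N)" "N #>\<^bsub>X\<^esub> x \<notin> T"
    using assms(2,3) unfolding residually_iff by (auto simp: carrier_FactGroup)
  interpret T: normal T "X Mod N" using kernelsD(1)[OF T(1)] .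
  have "{x \<in> carrier X. N #>\<^bsub>X\<^esub> x \<in> T} \<in> kernels X"
    by (rule kernels_vimage[OF _ T(1) r_coset_hom_Mod]) (rule group_axioms)
  moreover have "N \<subseteq> {x \<in> carrier X. N #>\<^bsub>X\<^esub> x \<in> T}"
  proof
    fix y assume y: "y \<in> N"
    then have "N #>\<^bsub>X\<^esub> y = \<one>\<^bsub>X Mod N\<^esub>" using coset_eq_iff_mem[of y] subset by auto
    then show "y \<in> {x \<in> carrier X. N #>\<^bsub>X\<^esub> x \<in> T}"
      using y subset T.subgroup_axioms[THEN subgroup.one_closed] by auto
  qed
  ultimately show ?thesis using T(2) by blast
qed

lemma ex_nontrivial_comm_group:
  obtains A a where "A \<in> C" "comm_group A" "a \<in> carrier A" "a \<noteq> \<one>\<^bsub>A\<^esub>"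
proof -
  obtain G where G: "G \<in> C" "carrier G \<noteq> {\<one>\<^bsub>G\<^esub>}" using root by (auto simp: root_class_def)
  interpret group G using member_group[OF G(1)] .
  obtain a where a: "a \<in> carrier G" "a \<noteq> \<one>\<^bsub>G\<^esub>" using G(2) one_closed by blast
  let ?A = "subgroup_generated G {a}"
  have "?A \<in> C"
    using root G(1) a(1) generate_is_subgroup[of "{a}"]
    by (auto simp: root_class_def subgroup_closed_def subgroup_generated_def)
  moreover have "comm_group ?A"
    using cyclic_group_generated[of a] group.cyclic_imp_abelian_group group_subgroup_generated by blast
  moreover have "a \<in> carrier ?A"
    using a(1) by (simp add: subgroup_generated_def generate.incl)
  ultimately show thesis using that a(2) by simp
qed

lemma kernels_finite_choice:
  assumes small: "carrier X \<lesssim> (UNIV :: 'u set)" and X: "group X" and fin: "finite I"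
    and ex: "\<And>i. i \<in> I \<Longrightarrow> \<exists>T\<in>kernels X. P T i"
    and anti: "\<And>i S T. i \<in> I \<Longrightarrow> S \<subseteq> T \<Longrightarrow> P T i \<Longrightarrow> P S i"
  shows "\<exists>T\<in>kernels X. \<forall>i\<in>I. P T i"
  using fin ex anti
proof (induction I)
  case empty
  then show ?case using carrier_in_kernels[OF X] by auto
next
  case (insert i I)
  have "\<exists>T\<in>kernels X. \<forall>i\<in>I. P T i"
    by (rule insert.IH) (use insert.prems in auto)
  then obtain T where T: "T \<in> kernels X" "\<forall>i\<in>I. P T i" by (elim bexE)
  have "\<exists>S\<in>kernels X. P S i" by (rule insert.prems(1)) simp
  then obtain S where S: "S \<in> kernels X" "P S i" by (elim bexE)
  have "P (T \<inter> S) k" if "k \<in> insert i I" for k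
    using that insert.prems(2)[OF that, of "T \<inter> S"] T(2) S(2) by auto
  then show ?case by (intro bexI[OF _ kernels_Int[OF small T(1) S(1)]]) simp
qed

lemma residually_separates_finite:
  assumes "carrier X \<lesssim> (UNIV :: 'u set)" "residually C X" "finite S" "S \<subseteq> carrier X"
  shows "\<exists>T\<in>kernels X. T \<inter> S \<subseteq> {\<one>\<^bsub>X\<^esub>}"
proof -
  have "\<exists>T\<in>kernels X. \<forall>x\<in>S - {\<one>\<^bsub>X\<^esub>}. x \<notin> T"
    by (rule kernels_finite_choice[OF assms(1)])
      (use assms(2-4) in \<open>auto simp: residually_iff\<close>)
  then obtain T where T: "T \<in> kernels X" "\<And>x. x \<in> S \<Longrightarrow> x \<noteq> \<one>\<^bsub>X\<^esub> \<Longrightarrow> x \<notin> T" by blast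
  show ?thesis by (rule bexI[OF _ T(1)]) (use T(2) in auto)
qed

text \<open>
  Since \<open>S\<close> covers only finitely many cosets of \<open>N\<close>, finitely many members of \<open>\<C>\<^sup>*(X)\<close> above \<open>N\<close> suffice to
  avoid all of them except \<open>N\<close>.
\<close>

lemma residually_Mod_separates_finite:
  assumes small: "carrier X \<lesssim> (UNIV :: 'u set)" and N: "N \<lhd> X" and res: "residually C (X Mod N)"
    and S: "S \<subseteq> carrier X" "finite ((#>\<^bsub>X\<^esub>) N ` S)"
  shows "\<exists>T\<in>kernels X. N \<subseteq> T \<and> T \<inter> S \<subseteq> N"
proof -
  interpret N: normal N X by fact
  have "\<exists>T\<in>kernels X. \<forall>c\<in>(#>\<^bsub>X\<^esub>) N ` S - {N}. (N <#>\<^bsub>X\<^esub> T) \<inter> c = {}"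
  proof (rule kernels_finite_choice[OF small N.group_axioms])
    show "finite ((#>\<^bsub>X\<^esub>) N ` S - {N})" using S(2) by simp
    show "(N <#>\<^bsub>X\<^esub> U) \<inter> c = {}" if "U \<subseteq> T" "(N <#>\<^bsub>X\<^esub> T) \<inter> c = {}" for c T U
      using that unfolding set_mult_def by blast
    show "\<exists>T\<in>kernels X. (N <#>\<^bsub>X\<^esub> T) \<inter> c = {}" if c: "c \<in> (#>\<^bsub>X\<^esub>) N ` S - {N}" for c
    proof -
      obtain s where s: "s \<in> S" "c = N #>\<^bsub>X\<^esub> s" "c \<noteq> N" using c by auto
      have sX: "s \<in> carrier X" using s(1) S(1) by blast
      have "s \<notin> N" using s(2,3) N.coset_eq_iff_mem[OF sX] by simp
      then obtain T where T: "T \<in> kernels X" "N \<subseteq> T" "s \<notin> T"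
        using residually_Mod_separates[OF N res sX] by blast
      interpret T: normal T X using kernelsD(1)[OF T(1)] .
      have "x \<notin> c" if x: "x \<in> N <#>\<^bsub>X\<^esub> T" for x
      proof
        assume "x \<in> c"
        then obtain n where n: "n \<in> N" "x = n \<otimes>\<^bsub>X\<^esub> s" using s(2) by (auto simp: r_coset_def)
        have "x \<in> T" using x T(2) T.m_closed by (auto simp: set_mult_def)
        then have "inv\<^bsub>X\<^esub> n \<otimes>\<^bsub>X\<^esub> x \<in> T" using n(1) T(2) T.m_closed T.m_inv_closed by blast
        then show False using n sX T(3) N.mem_carrier by (simp add: N.mult_inv_mult)
      qed
      then have "(N <#>\<^bsub>X\<^esub> T) \<inter> c = {}" by blast
      then show ?thesis by (rule bexI[OF _ T(1)])
    qed
  qed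
  then obtain T where T: "T \<in> kernels X" "\<forall>c\<in>(#>\<^bsub>X\<^esub>) N ` S - {N}. (N <#>\<^bsub>X\<^esub> T) \<inter> c = {}" by (elim bexE)
  interpret T: normal T X using kernelsD(1)[OF T(1)] .
  have nNT: "N <#>\<^bsub>X\<^esub> T \<lhd> X" by (rule N.normal_subgroup_set_mult_closed[OF N T.normal_axioms])
  have sub: "T \<subseteq> N <#>\<^bsub>X\<^esub> T" "N \<subseteq> N <#>\<^bsub>X\<^esub> T"
    using N.subset_set_mult[OF N.subgroup_axioms T.subgroup_axioms] by blast+
  have "x \<in> N" if x: "x \<in> N <#>\<^bsub>X\<^esub> T" "x \<in> S" for x
  proof (rule ccontr)
    assume "x \<notin> N"
    have xX: "x \<in> carrier X" using x(2) S(1) by blast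
    then have "N #>\<^bsub>X\<^esub> x \<noteq> N" using N.coset_eq_iff_mem[OF xX] \<open>x \<notin> N\<close> by simp
    then have "(N <#>\<^bsub>X\<^esub> T) \<inter> (N #>\<^bsub>X\<^esub> x) = {}" using T(2) x(2) by simp
    moreover have "x \<in> N #>\<^bsub>X\<^esub> x" using N.rcos_self[OF xX N.is_subgroup] .
    ultimately show False using x(1) by blast
  qed
  then show ?thesis
    using kernels_upward[OF T(1) sub(1) nNT] sub(2) by (intro bexI[of _ "N <#>\<^bsub>X\<^esub> T"]) auto
qed

lemma residually_ModI:
  assumes N: "N \<lhd> X"
    and sep: "\<And>x. x \<in> carrier X \<Longrightarrow> x \<notin> N \<Longrightarrow> \<exists>T\<in>kernels X. N \<subseteq> T \<and> x \<notin> T"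
  shows "residually C (X Mod N)"
proof -
  interpret N: normal N X by fact
  have "\<exists>T\<in>kernels (X Mod N). c \<notin> T" if c: "c \<in> carrier (X Mod N)" "c \<noteq> \<one>\<^bsub>X Mod N\<^esub>" for c
  proof -
    obtain x where x: "x \<in> carrier X" "c = N #>\<^bsub>X\<^esub> x" using c(1) by (auto simp: carrier_FactGroup)
    then have "x \<notin> N" using c(2) N.coset_eq_iff_mem[OF x(1)] by simp
    then obtain T where T: "T \<in> kernels X" "N \<subseteq> T" "x \<notin> T" using sep x(1) by blast
    obtain G f where G: "G \<in> C" "f \<in> epi X G" "T = {x \<in> carrier X. f x = \<one>\<^bsub>G\<^esub>}" using kernelsE[OF T(1)] .
    interpret f: group_hom X G f
      using G member_group by (simp add: group_hom_def group_hom_axioms_def N.group_axioms epi_def)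
    have "N \<subseteq> kernel X G f" using T(2) G(3) by (simp add: kernel_def)
    then obtain g where g: "g \<in> hom (X Mod N) G" "\<And>x. x \<in> carrier X \<Longrightarrow> g (N #>\<^bsub>X\<^esub> x) = f x"
      using f.FactGroup_universal_kernel[OF N] by blast
    have "{c \<in> carrier (X Mod N). g c = \<one>\<^bsub>G\<^esub>} \<in> kernels (X Mod N)"
      by (rule kernelsI_hom[OF N.factorgroup_is_group in_class_member[OF G(1)] g(1)]) simp
    moreover have "g c \<noteq> \<one>\<^bsub>G\<^esub>" using g(2)[OF x(1)] x T(3) G(3) by simp
    ultimately show ?thesis by (intro bexI[of _ "{c \<in> carrier (X Mod N). g c = \<one>\<^bsub>G\<^esub>}"]) simp_all
  qed
  then show ?thesis by (simp add: residually_iff N.factorgroup_is_group)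
qed

lemma in_class_epi_kernel:
  assumes "N \<in> kernels X" "group Y" "f \<in> epi X Y" "\<And>x. x \<in> N \<Longrightarrow> f x = \<one>\<^bsub>Y\<^esub>"
  shows "in_class C Y"
proof -
  interpret N: normal N X using kernelsD(1)[OF assms(1)] .
  interpret f: group_hom X Y f
    using assms by (simp add: group_hom_def group_hom_axioms_def N.group_axioms epi_def)
  have "kernel X Y f \<in> kernels X"
    by (rule kernels_upward[OF assms(1) _ f.normal_kernel]) (use assms(4) in \<open>auto simp: kernel_def\<close>)
  then have "in_class C (X Mod kernel X Y f)" by (rule kernelsD(2))
  moreover have "X Mod kernel X Y f \<cong> Y"
    by (rule f.FactGroup_iso) (use assms(3) in \<open>simp add: epi_def\<close>)
  ultimately show ?thesis using in_class_iso assms(2) by blast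
qed

lemma in_class_Mod_if_generated:
  assumes "group G" and D: "D \<lhd> G" and W: "subgroup W G" "D \<subseteq> W"
    and A: "subgroup A G" "A \<subseteq> W" "W \<subseteq> D <#>\<^bsub>G\<^esub> A" and A': "A' \<in> kernels (G\<lparr>carrier := A\<rparr>)" "A' \<subseteq> D"
  shows "D \<lhd> G\<lparr>carrier := W\<rparr>" "in_class C (G\<lparr>carrier := W\<rparr> Mod D)" "(#>\<^bsub>G\<^esub>) D \<in> hom (G\<lparr>carrier := W\<rparr>) (G\<lparr>carrier := W\<rparr> Mod D)"
proof -
  interpret G: group G by fact
  let ?W = "G\<lparr>carrier := W\<rparr>"
  interpret W: group ?W using subgroup.subgroup_is_group[OF W(1) assms(1)] .
  show nD: "D \<lhd> ?W" using G.normal_restrict_supergroup[OF W(1) D W(2)] .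
  interpret D: normal D ?W by (rule nD)
  have cos: "D #>\<^bsub>?W\<^esub> x = D #>\<^bsub>G\<^esub> x" for x by (simp add: r_coset_def)
  have cosf: "(#>\<^bsub>?W\<^esub>) D = (#>\<^bsub>G\<^esub>) D" by (rule ext) (rule cos)
  show h: "(#>\<^bsub>G\<^esub>) D \<in> hom ?W (?W Mod D)" using D.r_coset_hom_Mod by (simp add: cosf)
  have "(#>\<^bsub>G\<^esub>) D \<in> hom (G\<lparr>carrier := A\<rparr>) (?W Mod D)"
    using hom_subset_carrier[OF h A(2)] .
  moreover have "carrier (?W Mod D) \<subseteq> (#>\<^bsub>G\<^esub>) D ` A"
  proof
    fix c assume "c \<in> carrier (?W Mod D)"
    then obtain w where w: "w \<in> W" "c = D #>\<^bsub>G\<^esub> w" by (auto simp: carrier_FactGroup cos)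
    then obtain d a where da: "d \<in> D" "a \<in> A" "w = d \<otimes>\<^bsub>G\<^esub> a" using A(3) by (auto simp: set_mult_def)
    have "D #>\<^bsub>G\<^esub> w = D #>\<^bsub>G\<^esub> a"
      using G.coset_mult_assoc[of D d a] da D subgroup.subset[OF A(1)]
        subgroup.subset[OF normal_imp_subgroup[OF D]] G.coset_join2[OF _ normal_imp_subgroup[OF D] da(1)]
      by (auto simp: subset_iff)
    then show "c \<in> (#>\<^bsub>G\<^esub>) D ` A" using w da by blast
  qed
  ultimately have "(#>\<^bsub>G\<^esub>) D \<in> epi (G\<lparr>carrier := A\<rparr>) (?W Mod D)" by (simp add: epi_iff_subset)
  moreover have "D #>\<^bsub>G\<^esub> x = \<one>\<^bsub>?W Mod D\<^esub>" if "x \<in> A'" for x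
    using that A'(2) W(2) D.coset_eq_iff_mem[of x] by (auto simp: cos)
  ultimately show "in_class C (?W Mod D)"
    using in_class_epi_kernel[OF A'(1) D.factorgroup_is_group] by blast
qed

text \<open>
  There are two steps between \<open>SR\<close> and \<open>HK\<close>.  The group \<open>HK/HR\<close> is a quotient of \<open>K/R\<close>, and \<open>HR/SR\<close> is a quotient
  of \<open>H/S\<close>.
\<close>

lemma kernels_set_mult:
  assumes "group G" and small: "carrier G \<lesssim> (UNIV :: 'u set)"
    and H: "H \<lhd> G" and K: "K \<lhd> G" and S: "S \<lhd> G" and R: "R \<lhd> G"
    and SH: "S \<in> kernels (G\<lparr>carrier := H\<rparr>)" and RK: "R \<in> kernels (G\<lparr>carrier := K\<rparr>)"
  shows "S <#>\<^bsub>G\<^esub> R \<in> kernels (G\<lparr>carrier := H <#>\<^bsub>G\<^esub> K\<rparr>)"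
proof -
  interpret G: group G by fact
  interpret H: normal H G by fact
  interpret K: normal K G by fact
  interpret S: normal S G by fact
  interpret R: normal R G by fact
  have S_H: "S \<subseteq> H" and R_K: "R \<subseteq> K"
    using subgroup.subset[OF normal_imp_subgroup[OF kernelsD(1)[OF SH]]]
      subgroup.subset[OF normal_imp_subgroup[OF kernelsD(1)[OF RK]]] by simp_all
  define W where "W = H <#>\<^bsub>G\<^esub> K"
  define V where "V = H <#>\<^bsub>G\<^esub> R"
  define M where "M = S <#>\<^bsub>G\<^esub> R"
  have nW: "W \<lhd> G" and nV: "V \<lhd> G" and nM: "M \<lhd> G"
    unfolding W_def V_def M_def using G.normal_subgroup_set_mult_closed H K S R by auto
  note sW = normal_imp_subgroup[OF nW] and sV = normal_imp_subgroup[OF nV]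
  have VW: "V \<subseteq> W" and MV: "M \<subseteq> V" unfolding V_def W_def M_def using S_H R_K by (simp_all add: mono_set_mult)
  have right: "Y \<subseteq> X <#>\<^bsub>G\<^esub> Y" if "X \<lhd> G" "Y \<lhd> G" for X Y
    using G.subset_set_mult(2) that normal_imp_subgroup by blast
  have left: "X \<subseteq> X <#>\<^bsub>G\<^esub> Y" if "X \<lhd> G" "Y \<lhd> G" for X Y
    using G.subset_set_mult(1) that normal_imp_subgroup by blast
  have "W \<subseteq> V <#>\<^bsub>G\<^esub> K" unfolding W_def V_def by (rule mono_set_mult[OF left[OF H R] order_refl])
  then have 1: "V \<lhd> G\<lparr>carrier := W\<rparr>" "in_class C (G\<lparr>carrier := W\<rparr> Mod V)"
    using in_class_Mod_if_generated[OF assms(1) nV sW VW K.subgroup_axioms right[OF H K, folded W_def] _ RK right[OF H R, folded V_def]]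
    by blast+
  have "V \<subseteq> M <#>\<^bsub>G\<^esub> H"
  proof -
    have "V = R <#>\<^bsub>G\<^esub> H" unfolding V_def by (rule G.commut_normal[OF H.subgroup_axioms R])
    then show ?thesis using mono_set_mult[OF right[OF S R] order_refl] by (simp add: M_def)
  qed
  then have 2: "in_class C (G\<lparr>carrier := V\<rparr> Mod M)" "M \<lhd> G\<lparr>carrier := V\<rparr>" "(#>\<^bsub>G\<^esub>) M \<in> hom (G\<lparr>carrier := V\<rparr>) (G\<lparr>carrier := V\<rparr> Mod M)"
    using in_class_Mod_if_generated[OF assms(1) nM sV MV H.subgroup_axioms left[OF H R, folded V_def] _ SH left[OF S R, folded M_def]]
    by blast+
  have smallW: "carrier (G\<lparr>carrier := W\<rparr>) \<lesssim> (UNIV :: 'u set)"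
    using lepoll_trans[OF subset_imp_lepoll[OF subgroup.subset[OF sW]] small] by simp
  have "\<exists>T\<in>kernels (G\<lparr>carrier := W\<rparr>). T \<subseteq> {x \<in> V. M #>\<^bsub>G\<^esub> x = \<one>\<^bsub>G\<lparr>carrier := V\<rparr> Mod M\<^esub>}"
    by (rule gruenberg[OF smallW _ 2(1)]) (use 1 2(3) in \<open>simp_all add: class_quotient_kernels_def\<close>)
  then obtain T where T: "T \<in> kernels (G\<lparr>carrier := W\<rparr>)" "T \<subseteq> {x \<in> V. M #>\<^bsub>G\<^esub> x = \<one>\<^bsub>G\<lparr>carrier := V\<rparr> Mod M\<^esub>}" by blast
  have "T \<subseteq> M"
    using T(2) normal.coset_eq_iff_mem[OF nM] subgroup.mem_carrier[OF sV] by auto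
  moreover have "M \<lhd> G\<lparr>carrier := W\<rparr>" using G.normal_restrict_supergroup[OF sW nM] MV VW by blast
  ultimately show ?thesis using kernels_upward[OF T(1)] by (simp add: M_def W_def)
qed

end

section \<open>Abelian groups in the class have finite exponent\<close>

text \<open>
  The triple \<open>(n, c, g)\<close> stands for the unitriangular matrix with first row \<open>1, g, c\<close> and second row
  \<open>0, 1, n\<close>; the product of an integer \<open>m\<close> and an element \<open>g\<close> of the abelian group \<open>A\<close> is the power
  \<open>g\<^sup>m\<close>.
\<close>

definition heisenberg :: "('a, 'b) monoid_scheme \<Rightarrow> (int \<times> 'a \<times> 'a) monoid" where
  "heisenberg A = \<lparr>carrier = UNIV \<times> carrier A \<times> carrier A,
     mult = (\<lambda>(n, c, g) (m, d, h). (n + m, c \<otimes>\<^bsub>A\<^esub> d \<otimes>\<^bsub>A\<^esub> (g [^]\<^bsub>A\<^esub> m), g \<otimes>\<^bsub>A\<^esub> h)),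
     one = (0, \<one>\<^bsub>A\<^esub>, \<one>\<^bsub>A\<^esub>)\<rparr>"

lemma group_heisenberg:
  assumes "comm_group A" shows "group (heisenberg A)"
proof -
  interpret comm_group A by fact
  show ?thesis
  proof (rule groupI)
    fix x y z assume "x \<in> carrier (heisenberg A)" "y \<in> carrier (heisenberg A)" "z \<in> carrier (heisenberg A)"
    then show "x \<otimes>\<^bsub>heisenberg A\<^esub> y \<otimes>\<^bsub>heisenberg A\<^esub> z = x \<otimes>\<^bsub>heisenberg A\<^esub> (y \<otimes>\<^bsub>heisenberg A\<^esub> z)"
      by (auto simp: heisenberg_def int_pow_distrib int_pow_mult m_ac)
  next
    fix x assume x: "x \<in> carrier (heisenberg A)"
    obtain n c g where [simp]: "x = (n, c, g)" using prod_cases3 .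
    have *: "c \<in> carrier A" "g \<in> carrier A" using x by (auto simp: heisenberg_def)
    show "\<exists>y\<in>carrier (heisenberg A). y \<otimes>\<^bsub>heisenberg A\<^esub> x = \<one>\<^bsub>heisenberg A\<^esub>"
      by (rule bexI[of _ "(- n, inv\<^bsub>A\<^esub> (c \<otimes>\<^bsub>A\<^esub> (inv\<^bsub>A\<^esub> g [^]\<^bsub>A\<^esub> n)), inv\<^bsub>A\<^esub> g)"])
        (use * in \<open>auto simp: heisenberg_def m_assoc\<close>)
  qed (auto simp: heisenberg_def)
qed

lemma heisenberg_pow:
  assumes "comm_group A"
  shows "(1, \<one>\<^bsub>A\<^esub>, \<one>\<^bsub>A\<^esub>) [^]\<^bsub>heisenberg A\<^esub> (k :: nat) = (int k, \<one>\<^bsub>A\<^esub>, \<one>\<^bsub>A\<^esub>)"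
proof -
  interpret comm_group A by fact
  show ?thesis by (induction k) (auto simp: heisenberg_def nat_pow_def)
qed

text \<open>
  In the Heisenberg group over \<open>A\<close> the triples \<open>(n, c, 1)\<close> form a kernel with quotient \<open>A\<close>, on which \<open>(n, c, 1) \<mapsto> c\<close>
  is a homomorphism to \<open>A\<close>.  The Gruenberg condition yields a kernel \<open>T\<close> consisting of
  triples \<open>(n, 1, 1)\<close>.  As the quotient by \<open>T\<close> is periodic, \<open>T\<close> contains some \<open>(n, 1, 1)\<close> with
  \<open>n > 0\<close>, and conjugating it by \<open>(0, 1, a)\<close> gives \<open>(n, a\<^sup>n, 1)\<close>, whence \<open>a\<^sup>n = 1\<close>.
\<close>

lemma (in root_class_of_periodic_groups) finite_exponent:
  assumes "in_class C A" "comm_group A"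
  shows "\<exists>n>0. \<forall>a\<in>carrier A. a [^]\<^bsub>A\<^esub> (n :: nat) = \<one>\<^bsub>A\<^esub>"
proof -
  interpret A: comm_group A by fact
  let ?X = "heisenberg A"
  interpret X: group ?X using group_heisenberg[OF assms(2)] .
  define N where "N = {x \<in> carrier ?X. snd (snd x) = \<one>\<^bsub>A\<^esub>}"
  have N: "N \<in> kernels ?X"
    by (rule kernelsI_hom[where f = "\<lambda>x. snd (snd x)", OF X.group_axioms assms(1) _ N_def])
      (auto simp: heisenberg_def hom_def)
  have \<chi>: "(\<lambda>x. fst (snd x)) \<in> hom (?X\<lparr>carrier := N\<rparr>) A"
    by (auto simp: heisenberg_def hom_def N_def)
  have small: "carrier ?X \<lesssim> (UNIV :: 'u set)"
  proof -
    obtain g :: "'a \<Rightarrow> 'u" where g: "inj_on g (carrier A)"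
    proof -
      obtain G where "G \<in> C" "A \<cong> G" using assms(1) by (auto simp: in_class_def)
      then show thesis using that by (auto simp: is_iso_def iso_def bij_betw_def)
    qed
    obtain i :: "int \<Rightarrow> 'u" where i: "inj i"
      using infinite_universe infinite_countable_subset[of "UNIV :: 'u set"]
      by (metis from_nat_into_to_nat_on inj_compose inj_to_nat)
    obtain p :: "'u \<times> 'u \<Rightarrow> 'u" where p: "inj p" using ex_inj_pairing[OF infinite_universe] by blast
    have "inj_on (\<lambda>(n, c, h). p (i n, p (g c, g h))) (carrier ?X)"
      using g by (auto simp: inj_on_def heisenberg_def dest!: injD[OF p] injD[OF i])
    then show ?thesis by (auto simp: lepoll_def)
  qed
  obtain T where T: "T \<in> kernels ?X" "T \<subseteq> {x \<in> N. fst (snd x) = \<one>\<^bsub>A\<^esub>}"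
    using gruenberg[OF small N assms(1) \<chi>] by blast
  obtain G f where G: "G \<in> C" "f \<in> epi ?X G" "T = {x \<in> carrier ?X. f x = \<one>\<^bsub>G\<^esub>}"
    using kernelsE[OF T(1)] .
  interpret f: group_hom ?X G f
    using G member_group by (simp add: group_hom_def group_hom_axioms_def X.group_axioms epi_def)
  let ?u = "(1, \<one>\<^bsub>A\<^esub>, \<one>\<^bsub>A\<^esub>)"
  have u: "?u \<in> carrier ?X" by (simp add: heisenberg_def)
  then obtain n :: nat where n: "n > 0" "f ?u [^]\<^bsub>G\<^esub> n = \<one>\<^bsub>G\<^esub>"
    using periodic G(1) f.hom_closed[OF u] unfolding periodic_group_def by blast
  have inT: "(int n, \<one>\<^bsub>A\<^esub>, \<one>\<^bsub>A\<^esub>) \<in> T"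
    using n(2) u f.hom_nat_pow[of ?u n] heisenberg_pow[OF assms(2), of n] X.nat_pow_closed[OF u, of n]
    by (simp add: G(3))
  have "a [^]\<^bsub>A\<^esub> n = \<one>\<^bsub>A\<^esub>" if a: "a \<in> carrier A" for a
  proof -
    let ?a = "(0, \<one>\<^bsub>A\<^esub>, a)"
    have a': "?a \<in> carrier ?X" using a by (simp add: heisenberg_def)
    have inva: "inv\<^bsub>?X\<^esub> ?a = (0, \<one>\<^bsub>A\<^esub>, inv\<^bsub>A\<^esub> a)"
      by (rule X.inv_equality) (use a in \<open>auto simp: heisenberg_def\<close>)
    have "?a \<otimes>\<^bsub>?X\<^esub> (int n, \<one>\<^bsub>A\<^esub>, \<one>\<^bsub>A\<^esub>) \<otimes>\<^bsub>?X\<^esub> inv\<^bsub>?X\<^esub> ?a \<in> T"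
      by (rule normal.inv_op_closed2[OF kernelsD(1)[OF T(1)] a' inT])
    then have "(int n, a [^]\<^bsub>A\<^esub> int n, \<one>\<^bsub>A\<^esub>) \<in> T"
      unfolding inva using a by (simp add: heisenberg_def)
    then show ?thesis using T(2) by (auto simp: int_pow_int)
  qed
  then show ?thesis using n(1) by blast
qed

section \<open>Locally cyclic groups\<close>

text \<open>
  Local cyclicity relative to an ambient group.  Powers and generated subgroups are those of \<open>G\<close>, so
  that the property passes to subsets and to homomorphic images without a change of carrier.
\<close>

definition locally_cyclic_in :: "('a, 'b) monoid_scheme \<Rightarrow> 'a set \<Rightarrow> bool" where
  "locally_cyclic_in G H \<longleftrightarrow>
     (\<forall>S. finite S \<and> S \<subseteq> H \<longrightarrow> (\<exists>y\<in>generate G S. \<forall>s\<in>S. \<exists>n::int. s = y [^]\<^bsub>G\<^esub> n))"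

lemma locally_cyclic_in_subset:
  "locally_cyclic_in G H \<Longrightarrow> M \<subseteq> H \<Longrightarrow> locally_cyclic_in G M"
  unfolding locally_cyclic_in_def by blast

lemma locally_cyclic_inE:
  assumes "locally_cyclic_in G H" "finite S" "S \<subseteq> H"
  obtains y where "y \<in> generate G S" "\<forall>s\<in>S. \<exists>n::int. s = y [^]\<^bsub>G\<^esub> n"
proof -
  have "\<exists>y\<in>generate G S. \<forall>s\<in>S. \<exists>n::int. s = y [^]\<^bsub>G\<^esub> n"
    using assms by (simp add: locally_cyclic_in_def)
  then show thesis using that by (elim bexE)
qed

lemma (in group) locally_cyclic_inI:
  assumes "subgroup H G" "locally_cyclic_group (G\<lparr>carrier := H\<rparr>)"
  shows "locally_cyclic_in G H"
  unfolding locally_cyclic_in_def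
proof safe
  fix S assume S: "finite S" "S \<subseteq> H"
  let ?H = "G\<lparr>carrier := H\<rparr>"
  interpret H: group ?H using assms(1) by (rule subgroup.subgroup_is_group) (rule group_axioms)
  have gen: "generate ?H S = generate G S"
    using generate_consistent[OF S(2) assms(1)] by simp
  have "cyclic_group (subgroup_generated ?H S)"
    using S assms(2) by (simp add: locally_cyclic_group_def)
  then obtain y where y: "y \<in> carrier (subgroup_generated ?H S)"
      "carrier (subgroup_generated ?H S) = range (\<lambda>n::int. y [^]\<^bsub>subgroup_generated ?H S\<^esub> n)"
    using group.cyclic_group[OF H.group_subgroup_generated] by blast
  have car: "carrier (subgroup_generated ?H S) = generate G S"
    using gen S by (simp add: subgroup_generated_def Int_absorb1)
  have "y [^]\<^bsub>subgroup_generated ?H S\<^esub> n = y [^] n" for n :: int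
    using y(1) H.int_pow_subgroup_generated[of y S n] int_pow_consistent[OF assms(1), of y n]
      car generate_subgroup_incl[OF S(2) assms(1)] by (metis subset_iff)
  then show "\<exists>y\<in>generate G S. \<forall>s\<in>S. \<exists>n::int. s = y [^] n"
    using y car generate.incl[of _ S G] by (intro bexI[of _ y]) auto
qed

lemma (in group_hom) locally_cyclic_in_image:
  assumes "locally_cyclic_in G M" "M \<subseteq> carrier G"
  shows "locally_cyclic_in H (h ` M)"
  unfolding locally_cyclic_in_def
proof safe
  fix S assume S: "finite S" "S \<subseteq> h ` M"
  then obtain S' where S': "S' \<subseteq> M" "finite S'" "S = h ` S'"
    by (meson finite_subset_image)
  obtain y where y: "y \<in> generate G S'" "\<forall>s\<in>S'. \<exists>n::int. s = y [^] n"
    using locally_cyclic_inE[OF assms(1) S'(2,1)] .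
  have yc: "y \<in> carrier G" using y(1) S' assms(2) G.generate_in_carrier by blast
  have "h y \<in> generate H S"
    using generate_img[of S'] y(1) S' assms(2) by (metis image_eqI order_trans)
  moreover have "\<exists>n::int. s = h y [^]\<^bsub>H\<^esub> n" if "s \<in> S" for s
    using that S'(3) y(2) yc hom_int_pow by (metis imageE)
  ultimately show "\<exists>y\<in>generate H S. \<forall>s\<in>S. \<exists>n::int. s = y [^]\<^bsub>H\<^esub> n" by blast
qed

lemma (in group) locally_cyclic_in_commute:
  assumes "locally_cyclic_in G H" "H \<subseteq> carrier G" "x \<in> H" "y \<in> H"
  shows "x \<otimes> y = y \<otimes> x"
proof -
  have "finite {x, y}" "{x, y} \<subseteq> H" using assms by simp_all
  then obtain u where u: "u \<in> generate G {x, y}" "\<forall>s\<in>{x, y}. \<exists>n::int. s = u [^] n"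
    using locally_cyclic_inE[OF assms(1)] by metis
  obtain m n :: int where "x = u [^] m" "y = u [^] n" using u(2) by auto
  moreover have "u \<in> carrier G" using u(1) assms generate_in_carrier[of "{x, y}" u] by blast
  ultimately show ?thesis by (simp add: add.commute flip: int_pow_mult)
qed

lemma (in group) comm_image_of_locally_cyclic:
  assumes "subgroup H G" "locally_cyclic_in G H"
    and "f \<in> hom (G\<lparr>carrier := H\<rparr>) (G\<lparr>carrier := K\<rparr>)" "f ` H = K"
    and "x \<in> K" "y \<in> K"
  shows "x \<otimes> y = y \<otimes> x"
proof -
  obtain a b where ab: "a \<in> H" "b \<in> H" "x = f a" "y = f b" using assms(4-6) by blast
  have "f (a \<otimes> b) = x \<otimes> y" "f (b \<otimes> a) = y \<otimes> x"
    using hom_mult[OF assms(3), of a b] hom_mult[OF assms(3), of b a] ab by simp_all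
  then show ?thesis
    using locally_cyclic_in_commute[OF assms(2) subgroup.subset[OF assms(1)] ab(1,2)] by simp
qed

lemma (in group) locally_cyclic_comm_group:
  assumes "subgroup H G" "locally_cyclic_in G H"
  shows "comm_group (G\<lparr>carrier := H\<rparr>)"
proof -
  interpret H: group "G\<lparr>carrier := H\<rparr>" using assms(1) by (rule subgroup.subgroup_is_group) (rule group_axioms)
  show ?thesis
    by (rule H.group_comm_groupI)
      (use locally_cyclic_in_commute[OF assms(2)] subgroup.subset[OF assms(1)] in simp)
qed

text \<open>
  A finite locally cyclic group is generated by one element \<open>y\<close>; an endomorphism is the power map with the exponent
  by which it acts on \<open>y\<close>.
\<close>

lemma (in group) endomorphisms_of_finite_locally_cyclic_commute:
  assumes "subgroup M G" "finite M" "locally_cyclic_in G M"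
    and "\<alpha> \<in> hom (G\<lparr>carrier := M\<rparr>) (G\<lparr>carrier := M\<rparr>)" "\<beta> \<in> hom (G\<lparr>carrier := M\<rparr>) (G\<lparr>carrier := M\<rparr>)"
    and "x \<in> M"
  shows "\<alpha> (\<beta> x) = \<beta> (\<alpha> x)"
proof -
  let ?M = "G\<lparr>carrier := M\<rparr>"
  interpret M: group ?M using assms(1) by (rule subgroup.subgroup_is_group) (rule group_axioms)
  interpret \<alpha>: group_hom ?M ?M \<alpha>
    using assms(4) by (simp add: group_hom_def group_hom_axioms_def M.group_axioms)
  interpret \<beta>: group_hom ?M ?M \<beta>
    using assms(5) by (simp add: group_hom_def group_hom_axioms_def M.group_axioms)
  obtain y where y: "y \<in> generate G M" "\<forall>s\<in>M. \<exists>n::int. s = y [^] n"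
    using locally_cyclic_inE[OF assms(3,2) order_refl] .
  have yM: "y \<in> M" using y(1) generate_subgroup_incl[OF order_refl assms(1)] by blast
  have pow: "z [^]\<^bsub>?M\<^esub> n = z [^] n" if "z \<in> M" for z and n :: int
    using int_pow_consistent[OF assms(1) that] by simp
  obtain k l m :: int where klm: "x = y [^] k" "\<alpha> y = y [^] l" "\<beta> y = y [^] m"
    using y(2)[rule_format, OF assms(6)] y(2)[rule_format, of "\<alpha> y"] y(2)[rule_format, of "\<beta> y"] yM \<alpha>.hom_closed[of y] \<beta>.hom_closed[of y] by auto
  have yc: "y \<in> carrier G" using yM subgroup.subset[OF assms(1)] by blast
  have \<alpha>: "\<alpha> (y [^] n) = y [^] (l * n)" and \<beta>: "\<beta> (y [^] n) = y [^] (m * n)" for n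
    using \<alpha>.hom_int_pow[of y n] \<beta>.hom_int_pow[of y n] yM \<alpha>.hom_closed[of y] \<beta>.hom_closed[of y] klm(2,3) yc
    by (simp_all add: pow int_pow_pow)
  show ?thesis by (simp add: klm(1) \<alpha> \<beta> algebra_simps)
qed

context root_class_of_periodic_groups
begin

text \<open>
  The image has some exponent \<open>n\<close>.  Finitely many of its elements lie in a common cyclic subgroup, so
  there are at most \<open>n\<close> of them.
\<close>

lemma finite_image_of_locally_cyclic:
  assumes "group G" "subgroup H G" "locally_cyclic_in G H"
    and "in_class C A" "f \<in> hom (G\<lparr>carrier := H\<rparr>) A"
  shows "finite (f ` H)"
proof -
  interpret G: group G by fact
  let ?H = "G\<lparr>carrier := H\<rparr>"
  interpret H: comm_group ?H using G.locally_cyclic_comm_group assms(2,3) .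
  interpret A: group A using in_class_group assms(4) .
  interpret f: group_hom ?H A f
    using assms(5) by (simp add: group_hom_def group_hom_axioms_def H.group_axioms A.group_axioms)
  have sub: "subgroup (f ` H) A" using f.img_is_subgroup by simp
  have ab: "comm_group (A\<lparr>carrier := f ` H\<rparr>)"
  proof (rule group.group_comm_groupI)
    show "group (A\<lparr>carrier := f ` H\<rparr>)" using sub A.group_axioms by (rule subgroup.subgroup_is_group)
    fix x y assume "x \<in> carrier (A\<lparr>carrier := f ` H\<rparr>)" "y \<in> carrier (A\<lparr>carrier := f ` H\<rparr>)"
    then obtain a b where ab: "a \<in> H" "b \<in> H" "x = f a" "y = f b" by auto
    then have "f (a \<otimes>\<^bsub>G\<^esub> b) = f (b \<otimes>\<^bsub>G\<^esub> a)" using H.m_comm[of a b] by simp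
    then show "x \<otimes>\<^bsub>A\<lparr>carrier := f ` H\<rparr>\<^esub> y = y \<otimes>\<^bsub>A\<lparr>carrier := f ` H\<rparr>\<^esub> x"
      using ab f.hom_mult[of a b] f.hom_mult[of b a] by simp
  qed
  obtain n :: nat where n: "n > 0" "\<forall>a\<in>f ` H. a [^]\<^bsub>A\<^esub> n = \<one>\<^bsub>A\<^esub>"
    using finite_exponent[OF in_class_subgroup[OF assms(4) sub] ab]
    by (auto simp flip: A.nat_pow_consistent)
  have "finite F \<and> card F \<le> n" if F: "finite F" "F \<subseteq> f ` H" for F
  proof -
    obtain S where S: "S \<subseteq> H" "finite S" "F = f ` S" using F by (meson finite_subset_image)
    obtain y where y: "y \<in> generate G S" "\<forall>s\<in>S. \<exists>n::int. s = y [^]\<^bsub>G\<^esub> n"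
      using locally_cyclic_inE[OF assms(3) S(2,1)] .
    have yH: "y \<in> H" using y(1) G.generate_subgroup_incl[OF S(1) assms(2)] by blast
    have fy: "f y \<in> carrier A" using f.hom_closed[of y] yH by simp
    have "F \<subseteq> (\<lambda>i. f y [^]\<^bsub>A\<^esub> i) ` {..<n}"
    proof
      fix a assume "a \<in> F"
      then obtain s k where s: "s \<in> S" "a = f s" "s = y [^]\<^bsub>G\<^esub> (k::int)" using S(3) y(2) by (metis imageE)
      have "a = f y [^]\<^bsub>A\<^esub> k"
        using s(2,3) f.hom_int_pow[of y k] yH G.int_pow_consistent[OF assms(2) yH, of k] by simp
      also have "\<dots> = f y [^]\<^bsub>A\<^esub> (int n * (k div int n) + k mod int n)" by simp
      also have "\<dots> = (f y [^]\<^bsub>A\<^esub> int n) [^]\<^bsub>A\<^esub> (k div int n) \<otimes>\<^bsub>A\<^esub> f y [^]\<^bsub>A\<^esub> (k mod int n)"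
        using fy by (simp only: A.int_pow_mult A.int_pow_pow)
      also have "\<dots> = f y [^]\<^bsub>A\<^esub> (k mod int n)"
        using n(2) yH fy by (simp add: int_pow_int)
      also have "\<dots> = f y [^]\<^bsub>A\<^esub> nat (k mod int n)"
        using n(1) by (metis int_pow_int nat_0_le of_nat_0_less_iff pos_mod_sign)
      finally show "a \<in> (\<lambda>i. f y [^]\<^bsub>A\<^esub> i) ` {..<n}"
        using n(1) by (intro image_eqI[of _ _ "nat (k mod int n)"]) (simp_all add: nat_less_iff)
    qed
    then show ?thesis using F(1) surj_card_le[of "{..<n}"] by simp
  qed
  then have "finite (f ` H) \<and> card (f ` H) \<le> n"
    by (intro finite_if_finite_subsets_card_bdd) blast
  then show ?thesis ..
qed

text \<open>
  Let \<open>n\<close> be the exponent of \<open>H/N\<close> and \<open>x \<in> N\<close>.  For every \<open>m\<close> with \<open>0 < m < n\<close> there is an element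
  of \<open>H\<close> whose \<open>m\<close>-th power is not in \<open>N\<close>.  These elements and \<open>x\<close> are powers of one element \<open>y\<close>, whose order modulo
  \<open>N\<close> is therefore exactly \<open>n\<close>.  Hence \<open>x\<close> is a power of \<open>y\<^sup>n\<close>.
\<close>

lemma kernel_of_locally_cyclic_is_power:
  assumes "group G" "subgroup H G" "locally_cyclic_in G H"
    and N: "N \<in> kernels (G\<lparr>carrier := H\<rparr>)"
  shows "\<exists>n::nat. N = (\<lambda>h. h [^]\<^bsub>G\<^esub> n) ` H"
proof -
  interpret G: group G by fact
  let ?H = "G\<lparr>carrier := H\<rparr>"
  interpret H: comm_group ?H using G.locally_cyclic_comm_group assms(2,3) .
  obtain A f where A: "A \<in> C" "f \<in> epi ?H A" "N = {x \<in> carrier ?H. f x = \<one>\<^bsub>A\<^esub>}"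
    using kernelsE[OF N] .
  interpret A: group A using member_group A(1) .
  interpret f: group_hom ?H A f
    using A(2) by (simp add: group_hom_def group_hom_axioms_def H.group_axioms A.group_axioms epi_def)
  have ab: "comm_group A"
  proof (rule A.group_comm_groupI)
    fix x y assume "x \<in> carrier A" "y \<in> carrier A"
    moreover have "carrier A = f ` H" using A(2) by (simp add: epi_def)
    ultimately obtain a b where ab: "a \<in> H" "b \<in> H" "x = f a" "y = f b" by blast
    then have "f (a \<otimes>\<^bsub>G\<^esub> b) = f (b \<otimes>\<^bsub>G\<^esub> a)" using H.m_comm[of a b] by simp
    then show "x \<otimes>\<^bsub>A\<^esub> y = y \<otimes>\<^bsub>A\<^esub> x"
      using ab f.hom_mult[of a b] f.hom_mult[of b a] by simp
  qed
  have sN: "subgroup N G"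
    using normal_imp_subgroup[OF kernelsD(1)[OF N]] G.incl_subgroup[OF assms(2)] by blast
  have pow: "z [^]\<^bsub>?H\<^esub> n = z [^]\<^bsub>G\<^esub> n" for z and n :: nat
    using G.nat_pow_consistent by metis
  have powH: "z [^]\<^bsub>G\<^esub> n \<in> H" if "z \<in> H" for z and n :: nat
    using H.nat_pow_closed[of z n] that pow by simp
  have powHi: "z [^]\<^bsub>G\<^esub> n \<in> H" if "z \<in> H" for z and n :: int
    using H.int_pow_closed[of z n] that G.int_pow_consistent[OF assms(2)] by simp
  have memN: "z \<in> N \<longleftrightarrow> f z = \<one>\<^bsub>A\<^esub>" if "z \<in> H" for z using A(3) that by simp
  obtain e :: nat where "e > 0" "\<forall>a\<in>carrier A. a [^]\<^bsub>A\<^esub> e = \<one>\<^bsub>A\<^esub>"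
    using finite_exponent[OF in_class_member[OF A(1)] ab] by blast
  then have "\<exists>n::nat. n > 0 \<and> (\<forall>h\<in>H. h [^]\<^bsub>G\<^esub> n \<in> N)"
    using f.hom_nat_pow[of _ e] f.hom_closed
    by (intro exI[of _ e]) (simp add: memN powH pow)
  define n where "n = (LEAST n::nat. n > 0 \<and> (\<forall>h\<in>H. h [^]\<^bsub>G\<^esub> n \<in> N))"
  have n: "n > 0" "\<And>h. h \<in> H \<Longrightarrow> h [^]\<^bsub>G\<^esub> n \<in> N"
    using LeastI_ex[OF \<open>\<exists>n::nat. _\<close>] unfolding n_def by blast+
  have "\<exists>h\<in>H. h [^]\<^bsub>G\<^esub> m \<notin> N" if "m > 0" "m < n" for m
    using not_less_Least[of m "\<lambda>n. n > 0 \<and> (\<forall>h\<in>H. h [^]\<^bsub>G\<^esub> n \<in> N)"] that unfolding n_def by blast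
  then obtain c where c: "\<And>m. m > 0 \<Longrightarrow> m < n \<Longrightarrow> c m \<in> H \<and> c m [^]\<^bsub>G\<^esub> m \<notin> N" by metis
  have "N \<subseteq> (\<lambda>h. h [^]\<^bsub>G\<^esub> n) ` H"
  proof
    fix x assume x: "x \<in> N"
    define S where "S = insert x (c ` {0<..<n})"
    have S: "finite S" "S \<subseteq> H" using x A(3) c by (auto simp: S_def)
    obtain y where y: "y \<in> generate G S" "\<forall>s\<in>S. \<exists>n::int. s = y [^]\<^bsub>G\<^esub> n"
      using locally_cyclic_inE[OF assms(3) S] .
    have yH: "y \<in> H" using y(1) G.generate_subgroup_incl[OF S(2) assms(2)] by blast
    have yc: "y \<in> carrier G" using yH subgroup.subset[OF assms(2)] by blast
    obtain k :: int where k: "x = y [^]\<^bsub>G\<^esub> k" using y(2) by (auto simp: S_def)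
    have "y [^]\<^bsub>G\<^esub> m \<notin> N" if m: "m > 0" "m < n" for m :: nat
    proof
      assume *: "y [^]\<^bsub>G\<^esub> m \<in> N"
      obtain l :: int where l: "c m = y [^]\<^bsub>G\<^esub> l" using y(2)[rule_format, of "c m"] m by (auto simp: S_def)
      have "c m [^]\<^bsub>G\<^esub> m = (y [^]\<^bsub>G\<^esub> m) [^]\<^bsub>G\<^esub> l"
        unfolding l int_pow_int[symmetric] using yc by (simp add: G.int_pow_pow mult.commute)
      also have "\<dots> \<in> N" using G.subgroup_int_pow_closed[OF sN *] .
      finally show False using c m by blast
    qed
    moreover have "y [^]\<^bsub>G\<^esub> nat (k mod int n) \<in> N"
    proof -
      have "y [^]\<^bsub>G\<^esub> nat (k mod int n) = y [^]\<^bsub>G\<^esub> (k mod int n)"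
        using n(1) by (metis int_pow_int nat_0_le of_nat_0_less_iff pos_mod_sign)
      also have "\<dots> = y [^]\<^bsub>G\<^esub> (k + int n * (- (k div int n)))"
        by (simp add: minus_mult_div_eq_mod[symmetric] algebra_simps)
      also have "\<dots> = x \<otimes>\<^bsub>G\<^esub> (y [^]\<^bsub>G\<^esub> int n) [^]\<^bsub>G\<^esub> (- (k div int n))"
        using yc k by (simp only: G.int_pow_mult G.int_pow_pow)
      also have "\<dots> \<in> N"
        using x n(2)[OF yH] sN G.subgroup_int_pow_closed[OF sN]
        by (simp add: int_pow_int subgroup.m_closed)
      finally show ?thesis .
    qed
    ultimately have "nat (k mod int n) = 0"
      using n(1) by (metis gr0I nat_less_iff of_nat_0_less_iff pos_mod_bound pos_mod_sign)
    then have "k = (k div int n) * int n"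
      using n(1) pos_mod_sign[of "int n" k] div_mult_mod_eq[of k "int n"] by linarith
    then have "x = (y [^]\<^bsub>G\<^esub> (k div int n)) [^]\<^bsub>G\<^esub> n"
      using k yc by (metis G.int_pow_pow int_pow_int)
    then show "x \<in> (\<lambda>h. h [^]\<^bsub>G\<^esub> n) ` H" using powHi[OF yH] by blast
  qed
  then show ?thesis using n(2) by blast
qed

end

section \<open>The universal property of an HNN-extension\<close>

locale hnn = group B for B :: "('a, 'b) monoid_scheme" (structure) +
  fixes H K :: "'a set" and \<phi> :: "'a \<Rightarrow> 'a"
  assumes subgroup_H: "subgroup H B" and subgroup_K: "subgroup K B"
    and iso: "\<phi> \<in> iso (B\<lparr>carrier := H\<rparr>) (B\<lparr>carrier := K\<rparr>)"
begin

lemma H_subset: "H \<subseteq> carrier B" and K_subset: "K \<subseteq> carrier B"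
  using subgroup_H subgroup_K subgroup.subset by auto

lemma \<phi>_image: "\<phi> ` H = K" and \<phi>_inj: "inj_on \<phi> H"
  using iso by (auto simp: iso_def bij_betw_def)

lemma \<phi>_mem: "h \<in> H \<Longrightarrow> \<phi> h \<in> K"
  using \<phi>_image by blast

lemma \<phi>_carrier: "h \<in> H \<Longrightarrow> \<phi> h \<in> carrier B"
  using \<phi>_mem K_subset by blast

lemma \<phi>_mult: "h \<in> H \<Longrightarrow> h' \<in> H \<Longrightarrow> \<phi> (h \<otimes> h') = \<phi> h \<otimes> \<phi> h'"
  using iso by (auto simp: iso_def hom_def)

lemma \<phi>_carrier_subset: "\<phi> ` H \<subseteq> carrier B"
  using \<phi>_image K_subset by simp

lemma \<phi>_div:
  assumes "x \<in> H" "y \<in> H" shows "\<phi> (x \<otimes> inv y) = \<phi> x \<otimes> inv (\<phi> y)"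
proof -
  have c: "x \<in> carrier B" "y \<in> carrier B" "\<phi> x \<in> carrier B" "\<phi> y \<in> carrier B"
    using assms H_subset \<phi>_carrier by auto
  have z: "x \<otimes> inv y \<in> H" using assms subgroup_H by (simp add: subgroup.m_closed subgroup.m_inv_closed)
  have "\<phi> (x \<otimes> inv y) \<otimes> \<phi> y = \<phi> x" using \<phi>_mult[OF z assms(2)] c by (simp add: m_assoc)
  then have "\<phi> x \<otimes> inv (\<phi> y) = \<phi> (x \<otimes> inv y) \<otimes> \<phi> y \<otimes> inv (\<phi> y)" by simp
  then show ?thesis using c \<phi>_carrier[OF z] by (simp add: m_assoc)
qed

lemma \<phi>_one: "\<phi> \<one> = \<one>"
  using \<phi>_div[of \<one> \<one>] subgroup.one_closed[OF subgroup_H] \<phi>_carrier[of \<one>] by simp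

lemma H_pow_closed: "h \<in> H \<Longrightarrow> h [^] (n::nat) \<in> H"
  by (induction n) (auto simp: subgroup.one_closed[OF subgroup_H] subgroup.m_closed[OF subgroup_H])

lemma \<phi>_pow: "h \<in> H \<Longrightarrow> \<phi> (h [^] (n::nat)) = \<phi> h [^] n"
  by (induction n) (auto simp: \<phi>_one \<phi>_mult H_pow_closed)

definition E where "E = hnn_extension B H \<phi>"

definition cls where "cls w = hnn_rel B H \<phi> `` {w}"

definition \<iota> where "\<iota> b = cls [Base b]"

definition t where "t = cls [Stable]"

sublocale E: group E
  unfolding E_def by (rule group_hnn_extension[OF group_axioms H_subset \<phi>_carrier_subset])

abbreviation E_mult (infixl "\<cdot>" 70) where "d \<cdot> e \<equiv> d \<otimes>\<^bsub>E\<^esub> e"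

abbreviation E_one ("\<one>\<^sub>E") where "\<one>\<^sub>E \<equiv> \<one>\<^bsub>E\<^esub>"

abbreviation E_inv ("inv\<^sub>E _" [81] 80) where "inv\<^sub>E e \<equiv> m_inv E e"

lemma cls_in_E: "w \<in> hnn_words B \<Longrightarrow> cls w \<in> carrier E"
  unfolding E_def cls_def hnn_extension_def by (auto intro: quotientI)

lemma E_cases:
  assumes "e \<in> carrier E" obtains w where "w \<in> hnn_words B" "e = cls w"
  using assms unfolding E_def cls_def hnn_extension_def by (auto elim: quotientE)

lemma cls_eq_iff:
  assumes "v \<in> hnn_words B" "w \<in> hnn_words B"
  shows "cls v = cls w \<longleftrightarrow> hnn_cong B H \<phi> v w"
  unfolding cls_def using assms eq_equiv_class_iff[OF equiv_hnn_rel[OF group_axioms H_subset \<phi>_carrier_subset]]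
  by (simp add: hnn_rel_def)

lemma cls_append:
  "v \<in> hnn_words B \<Longrightarrow> w \<in> hnn_words B \<Longrightarrow> cls (v @ w) = cls v \<cdot> cls w"
  unfolding cls_def E_def using hnn_mult_class[OF group_axioms H_subset \<phi>_carrier_subset] by simp

lemma cls_Nil: "cls [] = \<one>\<^sub>E"
  unfolding cls_def E_def hnn_extension_def by simp

lemma Base_word: "b \<in> carrier B \<Longrightarrow> [Base b] \<in> hnn_words B"
  and Stable_word: "[Stable] \<in> hnn_words B"
  and Stable_Inv_word: "[Stable_Inv] \<in> hnn_words B"
  by (auto simp: hnn_words_def)

lemma t_closed [simp]: "t \<in> carrier E"
  unfolding t_def using cls_in_E Stable_word by blast

lemma \<iota>_closed [simp]: "b \<in> carrier B \<Longrightarrow> \<iota> b \<in> carrier E"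
  unfolding \<iota>_def using cls_in_E Base_word by blast

lemma \<iota>_hom: "\<iota> \<in> hom B E"
proof (rule homI)
  fix a b assume ab: "a \<in> carrier B" "b \<in> carrier B"
  have "cls [Base (a \<otimes> b)] = cls ([Base a] @ [Base b])"
    using ab hnn_cong.sym[OF hnn_cong.base_mult[OF ab]]
    by (subst cls_eq_iff) (auto simp: hnn_words_def)
  then show "\<iota> (a \<otimes> b) = \<iota> a \<cdot> \<iota> b"
    using ab Base_word by (simp add: \<iota>_def cls_append del: append_Cons)
qed simp

sublocale \<iota>: group_hom B E \<iota>
  using \<iota>_hom by (simp add: group_hom_def group_hom_axioms_def group_axioms E.group_axioms)

lemma cls_Stable_Inv: "cls [Stable_Inv] = inv\<^sub>E t"
proof -
  have "cls ([Stable_Inv] @ [Stable]) = cls []"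
    by (subst cls_eq_iff) (auto simp: hnn_words_def intro: hnn_cong.stable_left_inv)
  then have "cls [Stable_Inv] \<cdot> t = \<one>\<^sub>E"
    using Stable_word Stable_Inv_word by (simp add: t_def cls_append cls_Nil del: append_Cons)
  then show ?thesis
    using E.inv_equality cls_in_E Stable_Inv_word t_closed by metis
qed

lemma t_conj: "h \<in> H \<Longrightarrow> inv\<^sub>E t \<cdot> \<iota> h \<cdot> t = \<iota> (\<phi> h)"
proof -
  assume h: "h \<in> H"
  then have hB: "h \<in> carrier B" using H_subset by blast
  have "cls ([Stable_Inv] @ [Base h] @ [Stable]) = cls [Base (\<phi> h)]"
    using h hB \<phi>_carrier[OF h]
    by (subst cls_eq_iff) (auto simp: hnn_words_def intro: hnn_cong.stable_conj)
  moreover have "cls ([Stable_Inv] @ [Base h] @ [Stable]) = cls [Stable_Inv] \<cdot> cls ([Base h] @ [Stable])"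
    by (rule cls_append) (use hB in \<open>auto simp: hnn_words_def\<close>)
  moreover have "cls ([Base h] @ [Stable]) = cls [Base h] \<cdot> cls [Stable]"
    by (rule cls_append) (use hB in \<open>auto simp: hnn_words_def\<close>)
  ultimately have "cls [Stable_Inv] \<cdot> (cls [Base h] \<cdot> cls [Stable]) = cls [Base (\<phi> h)]"
    by simp
  then have "inv\<^sub>E t \<cdot> (\<iota> h \<cdot> t) = \<iota> (\<phi> h)"
    unfolding cls_Stable_Inv unfolding t_def \<iota>_def .
  then show ?thesis using hB by (simp add: E.m_assoc)
qed

lemma t_swap:
  assumes "h \<in> H" shows "\<iota> h \<cdot> t = t \<cdot> \<iota> (\<phi> h)"
proof -
  have h: "h \<in> carrier B" using assms H_subset by blast
  have "t \<cdot> (inv\<^sub>E t \<cdot> (\<iota> h \<cdot> t)) = \<iota> h \<cdot> t"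
    using h by (simp add: E.m_assoc[symmetric])
  then show ?thesis using t_conj[OF assms] h by (simp add: E.m_assoc)
qed

lemma E_induct [consumes 1, case_names one base stable stable_inv]:
  assumes "e \<in> carrier E"
    and "P \<one>\<^sub>E"
    and "\<And>b e. b \<in> carrier B \<Longrightarrow> e \<in> carrier E \<Longrightarrow> P e \<Longrightarrow> P (\<iota> b \<cdot> e)"
    and "\<And>e. e \<in> carrier E \<Longrightarrow> P e \<Longrightarrow> P (t \<cdot> e)"
    and "\<And>e. e \<in> carrier E \<Longrightarrow> P e \<Longrightarrow> P (inv\<^sub>E t \<cdot> e)"
  shows "P e"
proof -
  have "P (cls w)" if "w \<in> hnn_words B" for w
    using that
  proof (induction w)
    case Nil
    then show ?case using assms(2) cls_Nil by simp
  next
    case (Cons l w)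
    then have w: "w \<in> hnn_words B" and l: "[l] \<in> hnn_words B" by (auto simp: hnn_words_def)
    have "cls (l # w) = cls [l] \<cdot> cls w" using cls_append[OF l w] by simp
    moreover have "P (cls [l] \<cdot> cls w)"
      using assms(3-5) Cons.IH[OF w] cls_in_E[OF w] l
      by (cases l) (auto simp: \<iota>_def[symmetric] t_def[symmetric] cls_Stable_Inv hnn_words_def)
    ultimately show ?case by simp
  qed
  then show ?thesis using E_cases[OF assms(1)] by metis
qed

text \<open>
  Words can be evaluated in \<open>G\<close>, compatibly with the defining relations.  The group \<open>E\<close> is
  studied through this lemma, the relation \<open>t_conj\<close> and its generation by \<open>t\<close> and the image of \<open>B\<close> (\<open>E_induct\<close>)
  rather than through words.
\<close>

lemma universal_property:
  assumes "group G" "f \<in> hom B G" "\<tau> \<in> carrier G"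
    and "\<And>h. h \<in> H \<Longrightarrow> f h \<otimes>\<^bsub>G\<^esub> \<tau> = \<tau> \<otimes>\<^bsub>G\<^esub> f (\<phi> h)"
  shows "\<exists>F \<in> hom E G. (\<forall>b\<in>carrier B. F (\<iota> b) = f b) \<and> F t = \<tau>"
proof -
  interpret G: group G by fact
  interpret f: group_hom B G f
    using assms(2) by (simp add: group_hom_def group_hom_axioms_def group_axioms G.group_axioms)
  define lt where "lt l = (case l of Base b \<Rightarrow> f b | Stable \<Rightarrow> \<tau> | Stable_Inv \<Rightarrow> inv\<^bsub>G\<^esub> \<tau>)" for l
  define ev where "ev w = foldr (\<lambda>l g. lt l \<otimes>\<^bsub>G\<^esub> g) w \<one>\<^bsub>G\<^esub>" for w
  have lt: "lt l \<in> carrier G" if "[l] \<in> hnn_words B" for l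
    using that assms(3) by (auto simp: lt_def hnn_words_def)
  have ev_Cons: "ev (l # w) = lt l \<otimes>\<^bsub>G\<^esub> ev w" and ev_Nil: "ev [] = \<one>\<^bsub>G\<^esub>" for l w
    by (simp_all add: ev_def)
  have ev: "ev w \<in> carrier G" if "w \<in> hnn_words B" for w
    using that by (induction w) (auto simp: ev_Nil ev_Cons hnn_words_def intro!: lt G.m_closed)
  have ev_append: "ev (v @ w) = ev v \<otimes>\<^bsub>G\<^esub> ev w" if "v \<in> hnn_words B" "w \<in> hnn_words B" for v w
    using that(1)
  proof (induction v)
    case (Cons l v)
    then have "[l] \<in> hnn_words B" "v \<in> hnn_words B" by (auto simp: hnn_words_def)
    then show ?case using Cons.IH that(2) by (simp add: ev_Cons G.m_assoc lt ev)
  qed (use that(2) ev in \<open>simp add: ev_Nil\<close>)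
  have cong: "ev v = ev w" if "hnn_cong B H \<phi> v w" for v w
    using that
  proof induction
    case (app u u' v v')
    have "u \<in> hnn_words B" "u' \<in> hnn_words B" "v \<in> hnn_words B" "v' \<in> hnn_words B"
      using hnn_cong_words[OF group_axioms H_subset \<phi>_carrier_subset] app.hyps by blast+
    then show ?case using app.IH ev_append by simp
  next
    case base_one
    then show ?case by (simp add: ev_Cons ev_Nil lt_def)
  next
    case (base_mult a b)
    then show ?case by (simp add: ev_Cons ev_Nil lt_def)
  next
    case stable_right_inv
    then show ?case using assms(3) by (simp add: ev_Cons ev_Nil lt_def)
  next
    case stable_left_inv
    then show ?case using assms(3) by (simp add: ev_Cons ev_Nil lt_def)
  next
    case (stable_conj h)
    have h: "h \<in> carrier B" "\<phi> h \<in> carrier B" using stable_conj H_subset \<phi>_carrier by auto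
    have "inv\<^bsub>G\<^esub> \<tau> \<otimes>\<^bsub>G\<^esub> (\<tau> \<otimes>\<^bsub>G\<^esub> f (\<phi> h)) = f (\<phi> h)"
      using h assms(3) by (simp add: G.m_assoc[symmetric])
    then show ?case using assms(3,4) h stable_conj by (simp add: ev_Cons ev_Nil lt_def)
  qed auto
  define F where "F e = ev (SOME w. w \<in> hnn_words B \<and> e = cls w)" for e
  have F: "F (cls w) = ev w" if "w \<in> hnn_words B" for w
  proof -
    let ?v = "SOME v. v \<in> hnn_words B \<and> cls w = cls v"
    have "?v \<in> hnn_words B \<and> cls w = cls ?v"
      by (rule someI[where P = "\<lambda>v. v \<in> hnn_words B \<and> cls w = cls v"]) (use that in simp)
    then show ?thesis using cong cls_eq_iff that unfolding F_def by metis
  qed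
  have "F \<in> hom E G"
  proof (rule homI)
    show "F e \<in> carrier G" if "e \<in> carrier E" for e
      using that by (elim E_cases) (simp add: F ev)
    show "F (d \<cdot> e) = F d \<otimes>\<^bsub>G\<^esub> F e" if de: "d \<in> carrier E" "e \<in> carrier E" for d e
    proof -
      obtain v w where "v \<in> hnn_words B" "d = cls v" "w \<in> hnn_words B" "e = cls w"
        using de E_cases by metis
      moreover from this have "v @ w \<in> hnn_words B" by (auto simp: hnn_words_def)
      ultimately show ?thesis using F ev_append by (simp add: cls_append[symmetric])
    qed
  qed
  moreover have "F (\<iota> b) = f b" if "b \<in> carrier B" for b
    using F[OF Base_word[OF that]] that by (simp add: \<iota>_def ev_Cons ev_Nil lt_def)
  moreover have "F t = \<tau>"
    using F[OF Stable_word] assms(3) by (simp add: t_def ev_Cons ev_Nil lt_def)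
  ultimately show ?thesis by blast
qed

section \<open>Reduced words\<close>

text \<open>
  A list of pairs \<open>(s, b)\<close> stands for a product of factors \<open>t b\<close> (for \<open>s = True\<close>) and \<open>t\<^sup>-\<^sup>1 b\<close>
  (for \<open>s = False\<close>); every element of \<open>E\<close> is such a product, multiplied by an element of \<open>B\<close> from the left.
\<close>

definition letter where "letter s = (if s then t else inv\<^sub>E t)"

primrec val where
  "val [] = \<one>\<^sub>E"
| "val (x # xs) = letter (fst x) \<cdot> \<iota> (snd x) \<cdot> val xs"

lemma letter_closed [simp]: "letter s \<in> carrier E"
  by (simp add: letter_def)

lemma val_closed: "snd ` set xs \<subseteq> carrier B \<Longrightarrow> val xs \<in> carrier E"
  by (induction xs) auto

lemma val_append:
  "snd ` set xs \<subseteq> carrier B \<Longrightarrow> snd ` set ys \<subseteq> carrier B \<Longrightarrow> val (xs @ ys) = val xs \<cdot> val ys"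
  by (induction xs) (auto simp: val_closed E.m_assoc)

text \<open>
  Two consecutive pairs form a pinch if they contain \<open>t\<^sup>-\<^sup>1 u t\<close> with \<open>u \<in> U\<close> or \<open>t v t\<^sup>-\<^sup>1\<close> with \<open>v \<in> V\<close>.  Words
  without pinches for \<open>U = H\<close> and \<open>V = K\<close> are the reduced words; larger \<open>U\<close> and \<open>V\<close> express that a word stays
  reduced modulo a normal subgroup.
\<close>

definition no_pinch :: "'a set \<Rightarrow> 'a set \<Rightarrow> bool \<times> 'a \<Rightarrow> bool \<times> 'a \<Rightarrow> bool" where
  "no_pinch U V x y \<longleftrightarrow> fst x = fst y \<or> snd x \<notin> (if fst x then V else U)"

lemma representation:
  assumes "e \<in> carrier E"
  shows "\<exists>b xs. b \<in> carrier B \<and> snd ` set xs \<subseteq> carrier B \<and> e = \<iota> b \<cdot> val xs"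
  using assms
proof (induction rule: E_induct)
  case one
  show ?case by (intro exI[of _ \<one>] exI[of _ "[]"]) simp
next
  case (base a e)
  then obtain b xs where "b \<in> carrier B" "snd ` set xs \<subseteq> carrier B" "e = \<iota> b \<cdot> val xs" by blast
  then show ?case using base(1)
    by (intro exI[of _ "a \<otimes> b"] exI[of _ xs]) (auto simp: E.m_assoc val_closed)
next
  case (stable e)
  then obtain b xs where "b \<in> carrier B" "snd ` set xs \<subseteq> carrier B" "e = \<iota> b \<cdot> val xs" by blast
  then show ?case
    by (intro exI[of _ \<one>] exI[of _ "(True, b) # xs"]) (auto simp: E.m_assoc val_closed letter_def)
next
  case (stable_inv e)
  then obtain b xs where "b \<in> carrier B" "snd ` set xs \<subseteq> carrier B" "e = \<iota> b \<cdot> val xs" by blast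
  then show ?case
    by (intro exI[of _ \<one>] exI[of _ "(False, b) # xs"]) (auto simp: E.m_assoc val_closed letter_def)
qed

lemma pinch:
  assumes "\<not> no_pinch H K x y" "snd x \<in> carrier B" "snd y \<in> carrier B"
  shows "\<exists>c\<in>carrier B. val [x, y] = \<iota> c"
proof -
  obtain s b where x: "x = (s, b)" by fastforce
  obtain c where y: "y = (\<not> s, c)" using assms(1) x by (cases y) (auto simp: no_pinch_def)
  have bc: "b \<in> carrier B" "c \<in> carrier B" using assms x y by auto
  have "\<exists>d\<in>carrier B. letter s \<cdot> \<iota> b \<cdot> letter (\<not> s) = \<iota> d"
  proof (cases s)
    case True
    then have "b \<in> K" using assms(1) x y by (simp add: no_pinch_def)
    then obtain h where h: "h \<in> H" "b = \<phi> h" using \<phi>_image by blast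
    have hB: "h \<in> carrier B" using h H_subset by blast
    have "t \<cdot> \<iota> b \<cdot> inv\<^sub>E t = \<iota> h"
      using t_swap[OF h(1)] h(2) hB by (simp add: E.m_assoc E.inv_solve_right[symmetric] flip: t_swap[OF h(1)])
    then show ?thesis using True hB by (auto simp: letter_def)
  next
    case False
    then have "b \<in> H" using assms(1) x y by (simp add: no_pinch_def)
    then show ?thesis using False t_conj \<phi>_carrier by (auto simp: letter_def)
  qed
  then obtain d where d: "d \<in> carrier B" "letter s \<cdot> \<iota> b \<cdot> letter (\<not> s) = \<iota> d" by blast
  have "val [x, y] = letter s \<cdot> \<iota> b \<cdot> letter (\<not> s) \<cdot> \<iota> c"
    using bc x y by (simp add: E.m_assoc)
  also have "\<dots> = \<iota> (d \<otimes> c)" using d bc by simp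
  finally show ?thesis using d bc by blast
qed

text \<open>
  A shortest representation is reduced, since a pinch evaluates to an element of \<open>B\<close>.
\<close>

lemma reduced_representation:
  assumes "e \<in> carrier E"
  obtains b xs where "b \<in> carrier B" "snd ` set xs \<subseteq> carrier B" "e = \<iota> b \<cdot> val xs"
    "successively (no_pinch H K) xs"
proof -
  define P where "P b xs \<longleftrightarrow> b \<in> carrier B \<and> snd ` set xs \<subseteq> carrier B \<and> e = \<iota> b \<cdot> val xs" for b xs
  obtain b0 xs0 where "P b0 xs0" using representation[OF assms] by (auto simp: P_def)
  then have "\<exists>bx. P (fst bx) (snd bx)" by (intro exI[of _ "(b0, xs0)"]) simp
  then obtain bx where bx: "P (fst bx) (snd bx)" "\<And>by. P (fst by) (snd by) \<Longrightarrow> length (snd bx) \<le> length (snd by)"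
    using ex_has_least_nat[of "\<lambda>bx. P (fst bx) (snd bx)" _ "\<lambda>bx. length (snd bx)"] by blast
  define b xs where "b = fst bx" and "xs = snd bx"
  have P: "P b xs" and min: "\<And>c ys. P c ys \<Longrightarrow> length xs \<le> length ys"
    using bx(1) bx(2)[of "(_, _)"] by (simp_all add: b_def xs_def)
  have "successively (no_pinch H K) xs"
  proof (rule ccontr)
    assume "\<not> ?thesis"
    then obtain us x y vs where xs: "xs = us @ [x, y] @ vs" "\<not> no_pinch H K x y"
    proof (induction xs arbitrary: thesis)
      case (Cons x zs)
      show thesis
      proof (cases "successively (no_pinch H K) zs")
        case True
        then obtain y ws where "zs = y # ws" "\<not> no_pinch H K x y"
          using Cons.prems(2) by (cases zs) auto
        then show thesis using Cons.prems(1)[of "[]" x y ws] by simp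
      next
        case False
        then show thesis using Cons.IH Cons.prems(1)[of "x # _"] by (metis append_Cons)
      qed
    qed simp
    have s: "snd ` set us \<subseteq> carrier B" "snd ` set vs \<subseteq> carrier B" "snd x \<in> carrier B" "snd y \<in> carrier B"
      and bB: "b \<in> carrier B"
      using P xs(1) by (auto simp: P_def)
    obtain c where c: "c \<in> carrier B" "val [x, y] = \<iota> c" using pinch[OF xs(2) s(3,4)] by blast
    have e: "e = \<iota> b \<cdot> (val us \<cdot> (\<iota> c \<cdot> val vs))"
    proof -
      have "val xs = val us \<cdot> val ([x, y] @ vs)" unfolding xs(1) using s by (intro val_append) auto
      also have "val ([x, y] @ vs) = \<iota> c \<cdot> val vs" unfolding c(2)[symmetric] using s by (intro val_append) auto
      finally show ?thesis using P by (simp add: P_def)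
    qed
    show False
    proof (cases us rule: rev_cases)
      case Nil
      then have "P (b \<otimes> c) vs"
        using s bB c(1) e by (simp add: P_def E.m_assoc val_closed)
      then show False using min xs(1) by fastforce
    next
      case (snoc ws z)
      have z: "snd z \<in> carrier B" "snd ` set ws \<subseteq> carrier B" using s snoc by auto
      have "val us = val ws \<cdot> (letter (fst z) \<cdot> \<iota> (snd z))"
        unfolding snoc using z val_append[of ws "[z]"] by simp
      then have "val us \<cdot> (\<iota> c \<cdot> val vs) = val ws \<cdot> val ((fst z, snd z \<otimes> c) # vs)"
        using z c(1) s by (simp add: E.m_assoc val_closed)
      also have "\<dots> = val (ws @ (fst z, snd z \<otimes> c) # vs)"
        using z c(1) s by (intro val_append[symmetric]) auto
      finally have "P b (ws @ (fst z, snd z \<otimes> c) # vs)"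
        using z c(1) s bB e by (auto simp: P_def)
      then show False using min xs(1) snoc by fastforce
    qed
  qed
  with P show thesis unfolding P_def by (elim conjE) (rule that)
qed

lemma E_lepoll:
  assumes "infinite (UNIV :: 'u set)" "carrier B \<lesssim> (UNIV :: 'u set)"
  shows "carrier E \<lesssim> (UNIV :: 'u set)"
proof -
  obtain g :: "'a \<Rightarrow> 'u" where g: "inj_on g (carrier B)" using assms(2) by (auto simp: lepoll_def)
  obtain a b :: 'u where ab: "a \<noteq> b"
    using assms(1) by (metis (full_types) UNIV_eq_I finite.emptyI finite.insertI insertCI)
  define k :: "'a hnn_letter \<Rightarrow> 'u list"
    where "k l = (case l of Base x \<Rightarrow> [a, a, g x] | Stable \<Rightarrow> [a, b, a] | Stable_Inv \<Rightarrow> [b, b, a])" for l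
  define m where "m w = concat (map k w)" for w
  have "m v = m w \<Longrightarrow> v = w" if "v \<in> hnn_words B" "w \<in> hnn_words B" for v w
    using that
  proof (induction v arbitrary: w)
    case Nil
    then show ?case by (cases w) (auto simp: m_def k_def split: hnn_letter.splits)
  next
    case (Cons l v)
    then obtain l' w' where w: "w = l' # w'" by (cases w) (auto simp: m_def k_def split: hnn_letter.splits)
    have lw: "v \<in> hnn_words B" "w' \<in> hnn_words B" using Cons.prems w by (auto simp: hnn_words_def)
    have "l = l' \<and> m v = m w'"
      using Cons.prems w ab g
      by (cases l; cases l') (auto simp: m_def k_def hnn_words_def inj_on_def)
    then show ?case using Cons.IH lw w by blast
  qed
  then have "hnn_words B \<lesssim> (UNIV :: 'u list set)" by (auto simp: lepoll_def inj_on_def)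
  moreover have "carrier E \<lesssim> hnn_words B"
  proof -
    have "carrier E \<subseteq> cls ` hnn_words B" by (auto elim: E_cases)
    then show ?thesis by (rule lepoll_trans[OF subset_imp_lepoll image_lepoll])
  qed
  ultimately show ?thesis using lists_lepoll_infinite[OF assms(1)] by (metis lepoll_trans)
qed

end

section \<open>The base group embeds\<close>

context hnn
begin

text \<open>
  Let \<open>B\<close> act by left multiplication on the first factor of \<open>B \<times> W\<close>, where \<open>W\<close> is infinite and at least as large as
  \<open>B\<close>.  The actions of \<open>H\<close> and \<open>K\<close> are free with the same number of orbits.  Thus a bijection between the orbits
  gives a permutation \<open>\<tau>\<close> with \<open>\<tau>(\<phi>(h) \<omega>) = h \<tau>(\<omega>)\<close>, and by the universal property the faithful action of \<open>B\<close>
  extends to \<open>E\<close>.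
\<close>

lemma \<iota>_inj: "inj_on \<iota> (carrier B)"
proof -
  define W :: "'a list set" where "W = UNIV"
  define \<Omega> where "\<Omega> = carrier B \<times> W"
  define rH where "rH = coset_rep B H"
  define rK where "rK = coset_rep B K"
  have rH: "\<exists>h\<in>H. x = h \<otimes> rH x" "rH x \<in> carrier B" if "x \<in> carrier B" for x
    using coset_rep_decomp[OF subgroup_H that] unfolding rH_def by metis+
  have rK: "\<exists>k\<in>K. x = k \<otimes> rK x" "rK x \<in> carrier B" if "x \<in> carrier B" for x
    using coset_rep_decomp[OF subgroup_K that] unfolding rK_def by metis+
  have rH_mult: "rH (h \<otimes> x) = rH x" if "h \<in> H" "x \<in> carrier B" for h x
    unfolding rH_def using coset_rep_mult[OF subgroup_H that] .
  have rK_mult: "rK (k \<otimes> x) = rK x" if "k \<in> K" "x \<in> carrier B" for k x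
    unfolding rK_def using coset_rep_mult[OF subgroup_K that] .
  have rH_idem: "rH (rH x) = rH x" if "x \<in> carrier B" for x
    using rH[OF that] rH_mult by metis
  have rK_idem: "rK (rK x) = rK x" if "x \<in> carrier B" for x
    using rK[OF that] rK_mult by metis
  have W: "infinite W" unfolding W_def by (rule infinite_UNIV_listI)
  have "inj_on (\<lambda>x. [x]) S" for S :: "'a set" by (simp add: inj_on_def)
  then have le: "S \<lesssim> W" for S :: "'a set" unfolding lepoll_def W_def by blast
  have "carrier B \<noteq> {}" using one_closed by blast
  then have "rK ` carrier B \<times> W \<approx> W" "rH ` carrier B \<times> W \<approx> W"
    by (simp_all add: times_infinite_eqpoll[OF _ le W])
  then have "rK ` carrier B \<times> W \<approx> rH ` carrier B \<times> W" using eqpoll_sym eqpoll_trans by metis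
  then obtain j where j: "bij_betw j (rK ` carrier B \<times> W) (rH ` carrier B \<times> W)"
    by (auto simp: eqpoll_def)
  define \<psi> where "\<psi> = inv_into H \<phi>"
  have \<psi>: "\<psi> k \<in> H" "\<phi> (\<psi> k) = k" if "k \<in> K" for k
    using that \<phi>_image unfolding \<psi>_def by (auto simp: f_inv_into_f inv_into_into)
  have \<psi>\<phi>: "\<psi> (\<phi> h) = h" if "h \<in> H" for h
    using that \<phi>_inj unfolding \<psi>_def by simp
  define kK where "kK x = x \<otimes> inv (rK x)" for x
  have kK: "kK x \<in> K" "x = kK x \<otimes> rK x" if x: "x \<in> carrier B" for x
  proof -
    obtain k where k: "k \<in> K" "x = k \<otimes> rK x" using rK(1)[OF x] by blast
    have "kK x = k \<otimes> rK x \<otimes> inv (rK x)" using k(2) by (simp add: kK_def)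
    also have "\<dots> = k" using k(1) rK(2)[OF x] K_subset by (simp add: m_assoc subset_iff)
    finally show "kK x \<in> K" "x = kK x \<otimes> rK x" using k by simp_all
  qed
  have kK_mult: "kK (k \<otimes> x) = k \<otimes> kK x" if "k \<in> K" "x \<in> carrier B" for k x
    using that rK_mult[OF that] rK(2)[of x] K_subset by (auto simp: kK_def m_assoc subset_iff)
  define \<tau> where "\<tau> = (\<lambda>(x, w)\<in>\<Omega>. (\<psi> (kK x) \<otimes> fst (j (rK x, w)), snd (j (rK x, w))))"
  have jin: "fst (j (rK x, w)) \<in> rH ` carrier B" "snd (j (rK x, w)) \<in> W" if "x \<in> carrier B" for x w
  proof -
    have "j (rK x, w) \<in> rH ` carrier B \<times> W"
      using bij_betwE[OF j] that by (simp add: W_def)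
    then show "fst (j (rK x, w)) \<in> rH ` carrier B" "snd (j (rK x, w)) \<in> W" by auto
  qed
  have jB: "fst (j (rK x, w)) \<in> carrier B" if "x \<in> carrier B" for x w
    using jin(1)[OF that, of w] rH(2) by auto
  have \<tau>_bij: "\<tau> \<in> Bij \<Omega>"
  proof -
    have "\<tau> \<in> extensional \<Omega>" by (simp add: \<tau>_def)
    moreover have "inj_on \<tau> \<Omega>"
    proof (rule inj_onI, clarify)
      fix x w x' w' assume \<Omega>: "(x, w) \<in> \<Omega>" "(x', w') \<in> \<Omega>" and eq: "\<tau> (x, w) = \<tau> (x', w')"
      then have x: "x \<in> carrier B" "x' \<in> carrier B" by (auto simp: \<Omega>_def)
      have e1: "\<psi> (kK x) \<otimes> fst (j (rK x, w)) = \<psi> (kK x') \<otimes> fst (j (rK x', w'))"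
        and e2: "snd (j (rK x, w)) = snd (j (rK x', w'))"
        using eq \<Omega> by (simp_all add: \<tau>_def)
      have "rH (\<psi> (kK x) \<otimes> fst (j (rK x, w))) = fst (j (rK x, w))" if "x \<in> carrier B" for x w
        using rH_mult[OF \<psi>(1)[OF kK(1)[OF that]] jB[OF that]] jin(1)[OF that, of w] rH_idem by auto
      then have "fst (j (rK x, w)) = fst (j (rK x', w'))" using e1 x by metis
      then have "j (rK x, w) = j (rK x', w')" "\<psi> (kK x) = \<psi> (kK x')"
        using e1 e2 x jB \<psi>(1) kK(1) H_subset by (auto simp: prod_eq_iff subset_iff)
      then have "rK x = rK x'" "w = w'" "kK x = kK x'"
        using bij_betw_imp_inj_on[OF j] x \<psi>(2) kK(1) by (auto simp: inj_on_def W_def) metis+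
      then show "x = x' \<and> w = w'" using kK(2) x by metis
    qed
    moreover have "\<tau> ` \<Omega> = \<Omega>"
    proof
      show "\<tau> ` \<Omega> \<subseteq> \<Omega>"
        using jB \<psi>(1) kK(1) H_subset by (auto simp: \<Omega>_def \<tau>_def W_def subset_iff)
      show "\<Omega> \<subseteq> \<tau> ` \<Omega>"
      proof clarify
        fix y v assume "(y, v) \<in> \<Omega>"
        then have y: "y \<in> carrier B" by (simp add: \<Omega>_def)
        obtain h where h: "h \<in> H" "y = h \<otimes> rH y" using rH(1)[OF y] by blast
        have "(rH y, v) \<in> j ` (rK ` carrier B \<times> W)"
          using y bij_betw_imp_surj_on[OF j] by (simp add: W_def)
        then obtain z w where z: "z \<in> carrier B" "(rH y, v) = j (rK z, w)" by auto
        let ?x = "\<phi> h \<otimes> rK z"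
        have x: "?x \<in> carrier B" using \<phi>_carrier[OF h(1)] rK(2)[OF z(1)] by simp
        have rx: "rK ?x = rK z" using rK_mult[OF \<phi>_mem[OF h(1)] rK(2)[OF z(1)]] rK_idem[OF z(1)] by simp
        have "kK ?x = \<phi> h"
          unfolding kK_def rx using \<phi>_carrier[OF h(1)] rK(2)[OF z(1)] by (simp add: m_assoc)
        then have "\<tau> (?x, w) = (y, v)"
          using x rx z(2)[symmetric] h by (simp add: \<tau>_def \<Omega>_def W_def \<psi>\<phi>)
        moreover have "(?x, w) \<in> \<Omega>" using x by (simp add: \<Omega>_def W_def)
        ultimately show "(y, v) \<in> \<tau> ` \<Omega>" by (metis image_eqI)
      qed
    qed
    ultimately show ?thesis by (simp add: Bij_def bij_betw_def)
  qed
  define f where "f b = (\<lambda>(x, w)\<in>\<Omega>. (b \<otimes> x, w))" for b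
  have fB: "f b \<in> Bij \<Omega>" if b: "b \<in> carrier B" for b
  proof -
    have "bij_betw (f b) \<Omega> \<Omega>"
      by (rule bij_betwI[where g = "f (inv b)"])
        (use b in \<open>auto simp: f_def \<Omega>_def m_assoc[symmetric]\<close>)
    then show ?thesis by (simp add: Bij_def f_def)
  qed
  have fh: "f \<in> hom B (BijGroup \<Omega>)"
  proof (rule homI)
    fix a b assume ab: "a \<in> carrier B" "b \<in> carrier B"
    have "f (a \<otimes> b) = compose \<Omega> (f a) (f b)"
      unfolding f_def compose_def by (rule restrict_ext) (use ab in \<open>auto simp: \<Omega>_def m_assoc\<close>)
    then show "f (a \<otimes> b) = f a \<otimes>\<^bsub>BijGroup \<Omega>\<^esub> f b" using fB ab by (simp add: BijGroup_def)
  qed (simp add: BijGroup_def fB)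
  have rel: "f h \<otimes>\<^bsub>BijGroup \<Omega>\<^esub> \<tau> = \<tau> \<otimes>\<^bsub>BijGroup \<Omega>\<^esub> f (\<phi> h)" if h: "h \<in> H" for h
  proof -
    have hB: "h \<in> carrier B" "\<phi> h \<in> carrier B" using h H_subset \<phi>_carrier by auto
    have "compose \<Omega> (f h) \<tau> = compose \<Omega> \<tau> (f (\<phi> h))"
      unfolding compose_def
    proof (rule restrict_ext, clarify)
      fix x w assume "(x, w) \<in> \<Omega>"
      then have x: "x \<in> carrier B" by (simp add: \<Omega>_def)
      have \<psi>h: "\<psi> (\<phi> h \<otimes> kK x) = h \<otimes> \<psi> (kK x)"
        using \<phi>_mult[OF h \<psi>(1)[OF kK(1)[OF x]]] \<psi>(2)[OF kK(1)[OF x]] \<psi>\<phi>[of "h \<otimes> \<psi> (kK x)"]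
          subgroup.m_closed[OF subgroup_H h \<psi>(1)[OF kK(1)[OF x]]] by simp
      have "\<psi> (kK x) \<in> carrier B" using \<psi>(1)[OF kK(1)[OF x]] H_subset by blast
      then show "f h (\<tau> (x, w)) = \<tau> (f (\<phi> h) (x, w))"
        using x hB jB[OF x, of w] rK_mult[OF \<phi>_mem[OF h] x] kK_mult[OF \<phi>_mem[OF h] x] \<psi>h
        by (simp add: f_def \<tau>_def \<Omega>_def W_def m_assoc)
    qed
    then show ?thesis using fB hB \<tau>_bij by (simp add: BijGroup_def)
  qed
  obtain F where F: "F \<in> hom E (BijGroup \<Omega>)" "\<And>b. b \<in> carrier B \<Longrightarrow> F (\<iota> b) = f b"
    using universal_property[OF group_BijGroup fh _ rel] \<tau>_bij by (auto simp: BijGroup_def)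
  show ?thesis
  proof (rule inj_onI)
    fix a b assume ab: "a \<in> carrier B" "b \<in> carrier B" "\<iota> a = \<iota> b"
    then have "f a = f b" using F(2) by metis
    then have "f a (\<one>, []) = f b (\<one>, [])" by simp
    then show "a = b" using ab by (simp add: f_def \<Omega>_def W_def)
  qed
qed

end

section \<open>Cocycles\<close>

text \<open>
  The unrestricted wreath product of \<open>A\<close> by the regular representation of \<open>G\<close>.
\<close>

definition wreath :: "('c, 'd) monoid_scheme \<Rightarrow> ('e, 'f) monoid_scheme \<Rightarrow> (('e \<Rightarrow> 'c) \<times> 'e) monoid" where
  "wreath A G = \<lparr>carrier = (carrier G \<rightarrow>\<^sub>E carrier A) \<times> carrier G,
     mult = (\<lambda>(u, g) (v, h). (\<lambda>x\<in>carrier G. u x \<otimes>\<^bsub>A\<^esub> v (x \<otimes>\<^bsub>G\<^esub> g), g \<otimes>\<^bsub>G\<^esub> h)),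
     one = (\<lambda>x\<in>carrier G. \<one>\<^bsub>A\<^esub>, \<one>\<^bsub>G\<^esub>)\<rparr>"

lemma group_wreath:
  assumes "group A" "group G" shows "group (wreath A G)"
proof -
  interpret A: group A by fact
  interpret G: group G by fact
  show ?thesis
  proof (rule groupI)
    fix x assume x: "x \<in> carrier (wreath A G)"
    obtain u g where [simp]: "x = (u, g)" by fastforce
    have ug: "\<And>y. y \<in> carrier G \<Longrightarrow> u y \<in> carrier A" "g \<in> carrier G" "u \<in> extensional (carrier G)"
      using x by (auto simp: wreath_def PiE_def)
    show "\<exists>y\<in>carrier (wreath A G). y \<otimes>\<^bsub>wreath A G\<^esub> x = \<one>\<^bsub>wreath A G\<^esub>"
      by (rule bexI[of _ "(\<lambda>y\<in>carrier G. inv\<^bsub>A\<^esub> u (y \<otimes>\<^bsub>G\<^esub> inv\<^bsub>G\<^esub> g), inv\<^bsub>G\<^esub> g)"])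
        (use ug in \<open>auto simp: wreath_def intro!: restrict_ext\<close>)
    show "\<one>\<^bsub>wreath A G\<^esub> \<otimes>\<^bsub>wreath A G\<^esub> x = x"
      using ug by (auto simp: wreath_def fun_eq_iff extensional_def)
  next
    fix x y z assume "x \<in> carrier (wreath A G)" "y \<in> carrier (wreath A G)" "z \<in> carrier (wreath A G)"
    then show "x \<otimes>\<^bsub>wreath A G\<^esub> y \<otimes>\<^bsub>wreath A G\<^esub> z = x \<otimes>\<^bsub>wreath A G\<^esub> (y \<otimes>\<^bsub>wreath A G\<^esub> z)"
      by (auto simp: wreath_def G.m_assoc PiE_iff intro!: restrict_ext A.m_assoc)
  qed (auto simp: wreath_def PiE_iff)
qed

context hnn
begin

text \<open>
  Cocycles are the first components of the homomorphisms from \<open>E\<close> to the wreath product of \<open>A\<close> by \<open>E\<close> whose second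
  component is the identity.  They serve to construct homomorphisms on subgroups of \<open>E\<close>: on a
  subgroup under whose left translations \<open>\<mu>\<close> is invariant, \<open>\<mu> 1\<close> is a homomorphism (\<open>cocycle_hom\<close>).
\<close>

definition cocycle :: "('c, 'd) monoid_scheme \<Rightarrow> ('a hnn_letter list set \<Rightarrow> 'a hnn_letter list set \<Rightarrow> 'c) \<Rightarrow> bool" where
  "cocycle A \<mu> \<longleftrightarrow>
     (\<forall>x\<in>carrier E. \<forall>e\<in>carrier E. \<mu> x e \<in> carrier A) \<and>
     (\<forall>x\<in>carrier E. \<forall>d\<in>carrier E. \<forall>e\<in>carrier E. \<mu> x (d \<cdot> e) = \<mu> x d \<otimes>\<^bsub>A\<^esub> \<mu> (x \<cdot> d) e)"

text \<open>
  By the universal property a cocycle may be prescribed on \<open>B\<close> and on \<open>t\<close>, subject to one condition for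
  each element of \<open>H\<close>.
\<close>

lemma ex_cocycle:
  assumes "group A"
    and \<beta>: "\<And>x b. x \<in> carrier E \<Longrightarrow> b \<in> carrier B \<Longrightarrow> \<beta> x b \<in> carrier A"
    and \<beta>_mult: "\<And>x b c. x \<in> carrier E \<Longrightarrow> b \<in> carrier B \<Longrightarrow> c \<in> carrier B \<Longrightarrow>
      \<beta> x (b \<otimes> c) = \<beta> x b \<otimes>\<^bsub>A\<^esub> \<beta> (x \<cdot> \<iota> b) c"
    and \<sigma>: "\<And>x. x \<in> carrier E \<Longrightarrow> \<sigma> x \<in> carrier A"
    and rel: "\<And>x h. x \<in> carrier E \<Longrightarrow> h \<in> H \<Longrightarrow>
      \<beta> x h \<otimes>\<^bsub>A\<^esub> \<sigma> (x \<cdot> \<iota> h) = \<sigma> x \<otimes>\<^bsub>A\<^esub> \<beta> (x \<cdot> t) (\<phi> h)"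
  obtains \<mu> where "cocycle A \<mu>"
    "\<And>x b. x \<in> carrier E \<Longrightarrow> b \<in> carrier B \<Longrightarrow> \<mu> x (\<iota> b) = \<beta> x b"
    "\<And>x. x \<in> carrier E \<Longrightarrow> \<mu> x t = \<sigma> x"
proof -
  interpret A: group A by fact
  let ?W = "wreath A E"
  interpret W: group ?W using group_wreath[OF assms(1) E.group_axioms] .
  define f where "f b = (\<lambda>x\<in>carrier E. \<beta> x b, \<iota> b)" for b
  define \<tau> where "\<tau> = (\<lambda>x\<in>carrier E. \<sigma> x, t)"
  have f: "f \<in> hom B ?W"
    by (rule homI) (auto simp: f_def wreath_def \<beta> \<beta>_mult intro!: restrict_ext)
  have \<tau>: "\<tau> \<in> carrier ?W" by (auto simp: \<tau>_def wreath_def \<sigma>)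
  have rel': "f h \<otimes>\<^bsub>?W\<^esub> \<tau> = \<tau> \<otimes>\<^bsub>?W\<^esub> f (\<phi> h)" if "h \<in> H" for h
    using that H_subset \<phi>_carrier[OF that] rel[OF _ that] t_swap[OF that]
    by (auto simp: f_def \<tau>_def wreath_def subset_iff intro!: restrict_ext)
  obtain F where F: "F \<in> hom E ?W" "\<And>b. b \<in> carrier B \<Longrightarrow> F (\<iota> b) = f b" "F t = \<tau>"
    using universal_property[OF W.group_axioms f \<tau> rel'] by blast
  interpret F: group_hom E ?W F
    using F(1) by (simp add: group_hom_def group_hom_axioms_def E.group_axioms W.group_axioms)
  have snd_mult: "snd (p \<otimes>\<^bsub>?W\<^esub> q) = snd p \<cdot> snd q" for p q
    by (simp add: wreath_def split: prod.splits)
  have snd_closed: "snd (F e) \<in> carrier E" if "e \<in> carrier E" for e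
    using F.hom_closed[OF that] by (auto simp: wreath_def)
  have snd_F: "snd (F e) = e" if "e \<in> carrier E" for e
    using that
  proof (induction rule: E_induct)
    case one
    then show ?case using F.hom_one by (simp add: wreath_def)
  next
    case (base b e)
    then show ?case by (simp add: F.hom_mult snd_mult F(2) f_def)
  next
    case (stable e)
    then show ?case by (simp add: F.hom_mult snd_mult F(3) \<tau>_def)
  next
    case (stable_inv e)
    have "t \<cdot> snd (F (inv\<^sub>E t)) = \<one>\<^sub>E"
      using F.hom_mult[of t "inv\<^sub>E t"] F.hom_one snd_mult[of "F t" "F (inv\<^sub>E t)"]
      by (simp add: F(3) \<tau>_def wreath_def)
    then have "snd (F (inv\<^sub>E t)) = inv\<^sub>E t"
      using snd_closed by (metis E.inv_closed E.inv_equality E.inv_inv t_closed)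
    then show ?case using stable_inv by (simp add: F.hom_mult snd_mult)
  qed
  have fst_mult: "fst (p \<otimes>\<^bsub>?W\<^esub> q) x = fst p x \<otimes>\<^bsub>A\<^esub> fst q (x \<cdot> snd p)" if "x \<in> carrier E" for p q x
    using that by (simp add: wreath_def split: prod.splits)
  define \<mu> where "\<mu> x e = fst (F e) x" for x e
  have "\<mu> x e \<in> carrier A" if "x \<in> carrier E" "e \<in> carrier E" for x e
    using F.hom_closed[OF that(2)] that(1) by (auto simp: \<mu>_def wreath_def PiE_mem)
  then have "cocycle A \<mu>"
    by (auto simp: cocycle_def \<mu>_def F.hom_mult fst_mult snd_F)
  moreover have "\<mu> x (\<iota> b) = \<beta> x b" if "x \<in> carrier E" "b \<in> carrier B" for x b
    using that by (simp add: \<mu>_def F(2) f_def)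
  moreover have "\<mu> x t = \<sigma> x" if "x \<in> carrier E" for x
    using that by (simp add: \<mu>_def F(3) \<tau>_def)
  ultimately show thesis by (rule that)
qed

lemma cocycle_closed: "cocycle A \<mu> \<Longrightarrow> x \<in> carrier E \<Longrightarrow> e \<in> carrier E \<Longrightarrow> \<mu> x e \<in> carrier A"
  by (simp add: cocycle_def)

lemma cocycle_mult: "cocycle A \<mu> \<Longrightarrow> x \<in> carrier E \<Longrightarrow> d \<in> carrier E \<Longrightarrow> e \<in> carrier E \<Longrightarrow>
    \<mu> x (d \<cdot> e) = \<mu> x d \<otimes>\<^bsub>A\<^esub> \<mu> (x \<cdot> d) e"
  by (simp add: cocycle_def)

lemma cocycle_one:
  assumes "group A" "cocycle A \<mu>" "x \<in> carrier E"
  shows "\<mu> x \<one>\<^sub>E = \<one>\<^bsub>A\<^esub>"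
proof -
  interpret A: group A by fact
  show ?thesis
    using cocycle_mult[OF assms(2,3), of "\<one>\<^sub>E" "\<one>\<^sub>E"] cocycle_closed[OF assms(2,3), of "\<one>\<^sub>E"] assms(3)
    by simp
qed

lemma cocycle_inv_t:
  assumes "group A" "cocycle A \<mu>" "x \<in> carrier E"
  shows "\<mu> x (inv\<^sub>E t) = inv\<^bsub>A\<^esub> \<mu> (x \<cdot> inv\<^sub>E t) t"
proof -
  interpret A: group A by fact
  let ?y = "x \<cdot> inv\<^sub>E t"
  have "\<mu> ?y (t \<cdot> inv\<^sub>E t) = \<mu> ?y t \<otimes>\<^bsub>A\<^esub> \<mu> x (inv\<^sub>E t)"
    using cocycle_mult[OF assms(2), of ?y t "inv\<^sub>E t"] assms(3) by (simp add: E.m_assoc)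
  then have "\<mu> ?y t \<otimes>\<^bsub>A\<^esub> \<mu> x (inv\<^sub>E t) = \<one>\<^bsub>A\<^esub>"
    using cocycle_one[OF assms(1,2), of ?y] assms(3) by simp
  then show ?thesis
    using cocycle_closed[OF assms(2)] assms(3)
    by (metis A.inv_equality A.inv_inv A.inv_closed E.inv_closed E.m_closed t_closed)
qed

lemma cocycle_invariant:
  assumes "group A" "cocycle A \<mu>" "y \<in> carrier E"
    and "\<And>x b. x \<in> carrier E \<Longrightarrow> b \<in> carrier B \<Longrightarrow> \<mu> (y \<cdot> x) (\<iota> b) = \<mu> x (\<iota> b)"
    and "\<And>x. x \<in> carrier E \<Longrightarrow> \<mu> (y \<cdot> x) t = \<mu> x t"
    and "x \<in> carrier E" "e \<in> carrier E"
  shows "\<mu> (y \<cdot> x) e = \<mu> x e"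
proof -
  note y = assms(3)
  show ?thesis
    using assms(7,6)
  proof (induction arbitrary: x rule: E_induct)
    case one
    then show ?case using cocycle_one[OF assms(1,2)] y by simp
  next
    case (base b e)
    then show ?case using y assms(4) by (simp add: cocycle_mult[OF assms(2)] E.m_assoc)
  next
    case (stable e)
    then show ?case using y assms(5) by (simp add: cocycle_mult[OF assms(2)] E.m_assoc)
  next
    case (stable_inv e)
    then show ?case using y assms(5)
      by (simp add: cocycle_mult[OF assms(2)] cocycle_inv_t[OF assms(1,2)] E.m_assoc)
  qed
qed

lemma cocycle_hom:
  assumes "group A" "cocycle A \<mu>" "N \<subseteq> carrier E"
    and "\<And>x y b. y \<in> N \<Longrightarrow> x \<in> carrier E \<Longrightarrow> b \<in> carrier B \<Longrightarrow> \<mu> (y \<cdot> x) (\<iota> b) = \<mu> x (\<iota> b)"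
    and "\<And>x y. y \<in> N \<Longrightarrow> x \<in> carrier E \<Longrightarrow> \<mu> (y \<cdot> x) t = \<mu> x t"
  shows "\<mu> \<one>\<^sub>E \<in> hom (E\<lparr>carrier := N\<rparr>) A"
proof (rule homI)
  fix x y assume "x \<in> carrier (E\<lparr>carrier := N\<rparr>)" "y \<in> carrier (E\<lparr>carrier := N\<rparr>)"
  then have xy: "x \<in> N" "x \<in> carrier E" "y \<in> carrier E" using assms(3) by auto
  have "\<mu> (x \<cdot> \<one>\<^sub>E) y = \<mu> \<one>\<^sub>E y"
    by (rule cocycle_invariant[OF assms(1,2) xy(2)]) (use assms(4,5) xy in auto)
  then show "\<mu> \<one>\<^sub>E (x \<otimes>\<^bsub>E\<lparr>carrier := N\<rparr>\<^esub> y) = \<mu> \<one>\<^sub>E x \<otimes>\<^bsub>A\<^esub> \<mu> \<one>\<^sub>E y"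
    using xy by (simp add: cocycle_mult[OF assms(2)])
qed (use assms(3) cocycle_closed[OF assms(2)] in auto)

section \<open>Separating reduced words\<close>

definition base_translate :: "'a hnn_letter list set set \<Rightarrow> 'a set \<Rightarrow> 'a hnn_letter list set set" where
  "base_translate N S = N <#>\<^bsub>E\<^esub> \<iota> ` S"

lemma in_base_translate_iff: "e \<in> base_translate N S \<longleftrightarrow> (\<exists>y\<in>N. \<exists>s\<in>S. e = y \<cdot> \<iota> s)"
  by (auto simp: base_translate_def set_mult_def)

lemma base_translateI: "y \<in> N \<Longrightarrow> s \<in> S \<Longrightarrow> y \<cdot> \<iota> s \<in> base_translate N S"
  unfolding base_translate_def set_mult_def by blast

lemma base_translate_mono: "N \<subseteq> N' \<Longrightarrow> S \<subseteq> S' \<Longrightarrow> base_translate N S \<subseteq> base_translate N' S'"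
  unfolding base_translate_def set_mult_def by blast

definition reduced_mod :: "'a hnn_letter list set set \<Rightarrow> (bool \<times> 'a) list \<Rightarrow> bool" where
  "reduced_mod N xs \<longleftrightarrow> successively (no_pinch {b. \<iota> b \<in> base_translate N H} {b. \<iota> b \<in> base_translate N K}) xs"

lemma reduced_mod_append:
  "reduced_mod N (xs @ ys) \<Longrightarrow> reduced_mod N xs \<and> reduced_mod N ys"
  by (auto simp: reduced_mod_def successively_append_iff)

text \<open>
  Induction on the length of the word.  Proper segments of the word are not in \<open>M B\<close> for some member \<open>M\<close> of the family, and by
  closure under intersections one member \<open>T\<close> works for all segments that are needed.  To each letter \<open>t\<^sup>\<plusminus>\<^sup>1\<close>
  of the word belongs a coset \<open>T p H\<close>, namely the edge which it traverses in the quotient of the Bass-Serre tree by \<open>T\<close>.  By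
  the choice of \<open>T\<close> the first edge is not traversed again later: this would make a proper segment closed or reveal a
  pinch.  The cocycle which is trivial on \<open>B\<close> and has on \<open>t\<close> the value \<open>a\<close> at this edge and \<open>1\<close>
  elsewhere thus takes the value \<open>a\<^sup>\<plusminus>\<^sup>1\<close> on the word, whereas it is trivial on \<open>M B\<close>
  if \<open>M\<close> is contained in the kernel of its restriction to \<open>T\<close>.

  The family \<open>F\<close> will be \<open>\<C>\<^sup>*(E)\<close> or, for Britton's lemma, the family of all normal subgroups.
\<close>

lemma separate_reduced_word:
  fixes F :: "'a hnn_letter list set set set" and A :: "('c, 'd) monoid_scheme"
  assumes A: "group A" "a \<in> carrier A" "a \<noteq> \<one>\<^bsub>A\<^esub>"
    and F_normal: "\<And>N. N \<in> F \<Longrightarrow> N \<lhd> E"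
    and F_Int: "\<And>N M. N \<in> F \<Longrightarrow> M \<in> F \<Longrightarrow> N \<inter> M \<in> F"
    and F_ker: "\<And>N \<chi>. N \<in> F \<Longrightarrow> \<chi> \<in> hom (E\<lparr>carrier := N\<rparr>) A \<Longrightarrow> \<exists>M\<in>F. M \<subseteq> {x \<in> N. \<chi> x = \<one>\<^bsub>A\<^esub>}"
    and N: "N \<in> F" and xs: "xs \<noteq> []" "snd ` set xs \<subseteq> carrier B" "reduced_mod N xs"
  shows "\<exists>M\<in>F. M \<subseteq> N \<and> val xs \<notin> base_translate M (carrier B)"
  using xs
proof (induction xs rule: length_induct)
  case (1 xs)
  interpret A: group A by fact
  obtain s b zs where xs: "xs = (s, b) # zs" using 1(2) by (metis neq_Nil_conv surj_pair)
  have bB: "b \<in> carrier B" and zsB: "snd ` set zs \<subseteq> carrier B" using 1(3) xs by auto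
  define L where "L = (\<lambda>l. take l xs) ` {1..<length xs} \<union> (\<lambda>l. take l zs) ` {1..<length zs}"
  have "finite L" by (simp add: L_def)
  moreover have "\<exists>M\<in>F. M \<subseteq> N \<and> val ys \<notin> base_translate M (carrier B)" if ys: "ys \<in> L" for ys
  proof -
    obtain l where "ys = take l xs \<or> ys = take l zs" using ys unfolding L_def by blast
    then have "xs = [] @ ys @ drop l xs \<or> xs = [(s, b)] @ ys @ drop l zs" using xs by auto
    then obtain us vs where uv: "xs = us @ ys @ vs" by blast
    have "length ys < length xs" "ys \<noteq> []" using ys 1(2) xs by (auto simp: L_def)
    moreover have "snd ` set ys \<subseteq> carrier B" using 1(3) uv by auto
    moreover have "reduced_mod N ys" using 1(4) uv reduced_mod_append by metis
    ultimately show ?thesis using 1(1) by blast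
  qed
  ultimately have "\<exists>M\<in>F. M \<subseteq> N \<and> (\<forall>ys\<in>L. val ys \<notin> base_translate M (carrier B))"
  proof (induction L rule: finite_induct)
    case empty
    then show ?case using N by auto
  next
    case (insert ys L)
    obtain M1 where M1: "M1 \<in> F" "M1 \<subseteq> N" "\<forall>ys\<in>L. val ys \<notin> base_translate M1 (carrier B)"
      using insert.IH insert.prems by auto
    obtain M2 where M2: "M2 \<in> F" "M2 \<subseteq> N" "val ys \<notin> base_translate M2 (carrier B)"
      using insert.prems by blast
    have "base_translate (M1 \<inter> M2) (carrier B) \<subseteq> base_translate M1 (carrier B)" "base_translate (M1 \<inter> M2) (carrier B) \<subseteq> base_translate M2 (carrier B)"
      by (rule base_translate_mono; simp)+
    then show ?case using M1 M2 F_Int by (intro bexI[of _ "M1 \<inter> M2"]) auto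
  qed
  then obtain T where T: "T \<in> F" "T \<subseteq> N" "\<And>ys. ys \<in> L \<Longrightarrow> val ys \<notin> base_translate T (carrier B)" by blast
  interpret T: normal T E using F_normal[OF T(1)] .
  define c where "c = (if s then \<one>\<^sub>E else inv\<^sub>E t)"
  have c: "c \<in> carrier E" by (simp add: c_def)
  define D where "D = {e \<in> carrier E. \<exists>y\<in>T. \<exists>h\<in>H. e = y \<cdot> c \<cdot> \<iota> h}"
  have D_I: "y \<cdot> c \<cdot> \<iota> h \<in> D" if "y \<in> T" "h \<in> H" for y h
    using that c T.subset H_subset unfolding D_def by (auto simp: subset_iff)
  have D_H: "x \<cdot> \<iota> h \<in> D \<longleftrightarrow> x \<in> D" if x: "x \<in> carrier E" and h: "h \<in> H" for x h
  proof -
    have *: "x \<cdot> \<iota> h \<in> D" if x: "x \<in> D" and h: "h \<in> H" for x h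
    proof -
      obtain y k where yk: "y \<in> T" "k \<in> H" "x = y \<cdot> c \<cdot> \<iota> k" "x \<in> carrier E" using x by (auto simp: D_def)
      have "x \<cdot> \<iota> h = y \<cdot> c \<cdot> \<iota> (k \<otimes> h)"
        using yk c h H_subset T.subset by (simp add: E.m_assoc subset_iff)
      then show ?thesis
        using D_I[OF yk(1) subgroup.m_closed[OF subgroup_H yk(2) h]] by simp
    qed
    have hB: "h \<in> carrier B" using h H_subset by blast
    show ?thesis
      using *[OF _ h] *[of "x \<cdot> \<iota> h" "inv h"] subgroup.m_inv_closed[OF subgroup_H h] x hB
      by (auto simp: E.m_assoc)
  qed
  have D_T: "y \<cdot> x \<in> D \<longleftrightarrow> x \<in> D" if y: "y \<in> T" and x: "x \<in> carrier E" for x y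
  proof -
    have *: "y \<cdot> x \<in> D" if y: "y \<in> T" and x: "x \<in> D" for x y
    proof -
      obtain z k where zk: "z \<in> T" "k \<in> H" "x = z \<cdot> c \<cdot> \<iota> k" "x \<in> carrier E" using x by (auto simp: D_def)
      have "y \<cdot> x = y \<cdot> z \<cdot> c \<cdot> \<iota> k"
        using zk c y H_subset T.subset by (simp add: E.m_assoc subset_iff)
      then show ?thesis
        using D_I[OF T.m_closed[OF y zk(1)] zk(2)] by simp
    qed
    have yE: "y \<in> carrier E" using y T.subset by blast
    have "inv\<^sub>E y \<cdot> (y \<cdot> x) = x" using x yE by (simp add: E.m_assoc[symmetric])
    then show ?thesis using *[OF y, of x] *[of "inv\<^sub>E y" "y \<cdot> x"] T.m_inv_closed[OF y] by auto
  qed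
  define \<sigma> where "\<sigma> x = (if x \<in> D then a else \<one>\<^bsub>A\<^esub>)" for x
  obtain \<mu> where \<mu>: "cocycle A \<mu>" "\<And>x b. x \<in> carrier E \<Longrightarrow> b \<in> carrier B \<Longrightarrow> \<mu> x (\<iota> b) = \<one>\<^bsub>A\<^esub>"
      "\<And>x. x \<in> carrier E \<Longrightarrow> \<mu> x t = \<sigma> x"
    by (rule ex_cocycle[OF A(1), where \<beta> = "\<lambda>_ _. \<one>\<^bsub>A\<^esub>" and \<sigma> = \<sigma>])
      (use A D_H in \<open>auto simp: \<sigma>_def\<close>)
  have "\<mu> \<one>\<^sub>E \<in> hom (E\<lparr>carrier := T\<rparr>) A"
    by (rule cocycle_hom[OF A(1) \<mu>(1) T.subset])
      (use T.subset D_T in \<open>auto simp: \<mu>(2,3) \<sigma>_def subset_iff\<close>)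
  then obtain M where M: "M \<in> F" "M \<subseteq> {x \<in> T. \<mu> \<one>\<^sub>E x = \<one>\<^bsub>A\<^esub>}" using F_ker[OF T(1)] by blast
  have later: "\<mu> (val (take l xs)) (letter (fst (xs ! l))) = \<one>\<^bsub>A\<^esub>" if l: "1 \<le> l" "l < length xs" for l
  proof -
    define p where "p = val (take l xs)"
    define q where "q = val (take (l - 1) zs)"
    have pq: "p = letter s \<cdot> \<iota> b \<cdot> q"
      using l(1) unfolding p_def q_def xs by (cases l) auto
    have sub: "snd ` set (take (l - 1) zs) \<subseteq> carrier B"
      using zsB by (meson image_mono order_trans set_take_subset)
    have qE: "q \<in> carrier E" unfolding q_def using sub by (rule val_closed)
    have pE: "p \<in> carrier E" using pq qE bB by simp
    have p_notin: "p \<notin> base_translate T (carrier B)"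
      unfolding p_def using l by (intro T(3)) (auto simp: L_def)
    have same: False if "y \<in> T" "k \<in> carrier B" "p = y \<cdot> \<iota> k" for y k
      using p_notin base_translateI[OF that(1,2)] that(3) by simp
    have opposite: False if y: "y \<in> T" and k: "k \<in> (if s then K else H)" and s: "fst (xs ! l) \<noteq> s"
      and eq: "\<iota> b \<cdot> q = y \<cdot> \<iota> k" for y k
    proof (cases "l = 1")
      case True
      then obtain w ws where zs: "zs = w # ws" using l xs by (cases zs) auto
      have "\<iota> b = y \<cdot> \<iota> k" using eq True bB by (simp add: q_def)
      then have "\<iota> b \<in> base_translate T (if s then K else H)" using base_translateI[OF y k] by simp
      then have "\<iota> b \<in> base_translate N (if s then K else H)" using base_translate_mono[OF T(2) order_refl] by blast
      then have "\<not> no_pinch {b. \<iota> b \<in> base_translate N H} {b. \<iota> b \<in> base_translate N K} (s, b) w"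
        using s True zs xs by (auto simp: no_pinch_def)
      then show False using 1(4) xs zs by (simp add: reduced_mod_def)
    next
      case False
      have kB: "k \<in> carrier B" using k H_subset K_subset by (auto split: if_splits)
      have yE: "y \<in> carrier E" using y T.subset by blast
      have "q = inv\<^sub>E \<iota> b \<cdot> (y \<cdot> \<iota> k)"
        using eq[symmetric] qE bB by (simp add: E.m_assoc[symmetric])
      also have "\<dots> = (inv\<^sub>E \<iota> b \<cdot> y \<cdot> \<iota> b) \<cdot> \<iota> (inv b \<otimes> k)"
        using yE bB kB by (simp add: E.m_assoc E.mult_inv_mult)
      finally have "q \<in> base_translate T (carrier B)"
        using base_translateI[OF T.inv_op_closed1[of "\<iota> b" y], of "inv b \<otimes> k" "carrier B"] bB kB y by simp
      moreover have "l - 1 \<in> {1..<length zs}" using l False xs by auto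
      then have "take (l - 1) zs \<in> L" unfolding L_def by blast
      ultimately show False using T(3) q_def by blast
    qed
    have notD: "(if fst (xs ! l) then p else p \<cdot> inv\<^sub>E t) \<notin> D"
    proof
      assume "(if fst (xs ! l) then p else p \<cdot> inv\<^sub>E t) \<in> D"
      then obtain y h where yh: "y \<in> T" "h \<in> H"
        "(if fst (xs ! l) then p else p \<cdot> inv\<^sub>E t) = y \<cdot> c \<cdot> \<iota> h"
        by (auto simp: D_def)
      have yE: "y \<in> carrier E" and hB: "h \<in> carrier B" and \<phi>h: "\<phi> h \<in> carrier B" "\<phi> h \<in> K"
        using yh T.subset H_subset \<phi>_carrier \<phi>_mem by auto
      have pt: "p = p \<cdot> inv\<^sub>E t \<cdot> t" using pE by (simp add: E.m_assoc)
      show False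
      proof (cases "fst (xs ! l) = s")
        case True
        show False
        proof (cases s)
          case True
          then show False using same[of y h] yh hB yE \<open>fst (xs ! l) = s\<close> by (simp add: c_def)
        next
          case False
          then have "p = y \<cdot> inv\<^sub>E t \<cdot> \<iota> h \<cdot> t"
            using pt yh(3) \<open>fst (xs ! l) = s\<close> by (simp add: c_def)
          also have "\<dots> = y \<cdot> \<iota> (\<phi> h)" using t_conj[OF yh(2)] yE hB by (simp add: E.m_assoc)
          finally show False using same yh \<phi>h by blast
        qed
      next
        case neq: False
        show False
        proof (cases s)
          case True
          then have "p = y \<cdot> \<iota> h \<cdot> t" using pt yh(3) neq yE by (simp add: c_def)
          then have "t \<cdot> (\<iota> b \<cdot> q) = y \<cdot> (t \<cdot> \<iota> (\<phi> h))"
            using pq True t_swap[OF yh(2)] yE hB bB qE by (simp add: letter_def E.m_assoc)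
          then have "\<iota> b \<cdot> q = inv\<^sub>E t \<cdot> y \<cdot> t \<cdot> \<iota> (\<phi> h)"
            using yE \<phi>h bB qE by (simp add: E.m_assoc E.inv_solve_left)
          then show False
            using opposite[of "inv\<^sub>E t \<cdot> y \<cdot> t" "\<phi> h"] T.inv_op_closed1[OF t_closed yh(1)] \<phi>h True neq by simp
        next
          case False
          then have "inv\<^sub>E t \<cdot> (\<iota> b \<cdot> q) = y \<cdot> (inv\<^sub>E t \<cdot> \<iota> h)"
            using pq yh(3) neq yE hB bB qE by (simp add: letter_def E.m_assoc c_def)
          then have "\<iota> b \<cdot> q = t \<cdot> (y \<cdot> (inv\<^sub>E t \<cdot> \<iota> h))"
            using yE hB bB qE by (metis E.inv_solve_left E.inv_inv E.inv_closed E.m_closed \<iota>_closed t_closed)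
          then have "\<iota> b \<cdot> q = t \<cdot> y \<cdot> inv\<^sub>E t \<cdot> \<iota> h"
            using yE hB by (simp add: E.m_assoc)
          then show False
            using opposite[of "t \<cdot> y \<cdot> inv\<^sub>E t" h] T.inv_op_closed2[OF t_closed yh(1)] yh False neq by simp
        qed
      qed
    qed
    show ?thesis
      unfolding p_def[symmetric] using notD pE cocycle_inv_t[OF A(1) \<mu>(1) pE] \<mu>(3)
      by (auto simp: letter_def \<sigma>_def)
  qed
  define w where "w = \<mu> \<one>\<^sub>E (letter s)"
  have w: "w \<noteq> \<one>\<^bsub>A\<^esub>" "w \<in> carrier A"
  proof -
    have cD: "c \<in> D"
      using c T.one_closed subgroup.one_closed[OF subgroup_H]
      by (auto simp: D_def intro!: bexI[of _ "\<one>\<^sub>E"] bexI[of _ "\<one>"])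
    then have "w = (if s then a else inv\<^bsub>A\<^esub> a)"
      using cocycle_inv_t[OF A(1) \<mu>(1), of "\<one>\<^sub>E"] \<mu>(3)
      by (auto simp: w_def letter_def c_def \<sigma>_def)
    then show "w \<noteq> \<one>\<^bsub>A\<^esub>" "w \<in> carrier A" using A(2,3) by auto
  qed
  have take: "\<mu> \<one>\<^sub>E (val (take l xs)) = w" if "1 \<le> l" "l \<le> length xs" for l
    using that
  proof (induction l rule: dec_induct)
    case base
    then show ?case using bB w by (simp add: xs w_def[symmetric] cocycle_mult[OF \<mu>(1)] \<mu>(2))
  next
    case (step l)
    have l: "l < length xs" using step by simp
    have sub: "snd ` set (take l xs) \<subseteq> carrier B" "snd (xs ! l) \<in> carrier B"
      using 1(3) l set_take_subset[of l xs] by (auto simp: image_subset_iff)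
    have "val (take (Suc l) xs) = val (take l xs) \<cdot> (letter (fst (xs ! l)) \<cdot> \<iota> (snd (xs ! l)))"
      using sub val_append[OF sub(1), of "[xs ! l]"] l by (simp add: take_Suc_conv_app_nth)
    then show ?case
      using step.IH l later[OF step.hyps(1) l] sub val_closed[OF sub(1)] w
      by (simp add: cocycle_mult[OF \<mu>(1)] \<mu>(2))
  qed
  have "val xs \<notin> base_translate M (carrier B)"
  proof
    assume "val xs \<in> base_translate M (carrier B)"
    then obtain y d where yd: "y \<in> M" "d \<in> carrier B" "val xs = y \<cdot> \<iota> d" by (auto simp: in_base_translate_iff)
    have y: "y \<in> carrier E" "\<mu> \<one>\<^sub>E y = \<one>\<^bsub>A\<^esub>" using yd(1) M(2) T.subset by auto
    have "\<mu> \<one>\<^sub>E (val xs) = \<one>\<^bsub>A\<^esub>" using yd y by (simp add: cocycle_mult[OF \<mu>(1)] \<mu>(2))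
    then show False using take[of "length xs"] 1(2) w by (cases xs) auto
  qed
  then show ?case using M T(2) by blast
qed

text \<open>
  As the base group embeds, a reduced word is reduced modulo the trivial subgroup.
\<close>

lemma britton:
  assumes "xs \<noteq> []" "snd ` set xs \<subseteq> carrier B" "successively (no_pinch H K) xs"
  shows "val xs \<notin> \<iota> ` carrier B"
proof -
  have mem: "\<iota> b \<in> base_translate {\<one>\<^sub>E} S \<longleftrightarrow> b \<in> S" if "b \<in> carrier B" "S \<subseteq> carrier B" for b S
    using that \<iota>_inj by (auto simp: in_base_translate_iff inj_on_def subset_iff)
  have red: "reduced_mod {\<one>\<^sub>E} xs"
    unfolding reduced_mod_def
    by (rule successively_mono[OF assms(3)])
      (use assms(2) mem[OF _ H_subset] mem[OF _ K_subset] in \<open>auto simp: no_pinch_def image_subset_iff\<close>)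
  have "\<exists>M\<in>{N. N \<lhd> E}. M \<subseteq> {\<one>\<^sub>E} \<and> val xs \<notin> base_translate M (carrier B)"
  proof (rule separate_reduced_word[where A = integer_group and a = 1, rotated 6])
    fix N and \<chi> :: "_ \<Rightarrow> int" assume N: "N \<in> {N. N \<lhd> E}" and \<chi>: "\<chi> \<in> hom (E\<lparr>carrier := N\<rparr>) integer_group"
    have sN: "subgroup N E" using N normal_imp_subgroup by blast
    have "\<chi> \<one>\<^sub>E = 0"
      using hom_mult[OF \<chi>, of "\<one>\<^sub>E" "\<one>\<^sub>E"] subgroup.one_closed[OF sN] by simp
    then show "\<exists>M\<in>{N. N \<lhd> E}. M \<subseteq> {x \<in> N. \<chi> x = \<one>\<^bsub>integer_group\<^esub>}"
      using E.one_is_normal subgroup.one_closed[OF sN] by (intro bexI[of _ "{\<one>\<^sub>E}"]) auto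
  qed (use assms red E.one_is_normal E.normal_subgroup_intersect in auto)
  then obtain M where M: "M \<lhd> E" "val xs \<notin> base_translate M (carrier B)" by blast
  then show ?thesis
    using subgroup.one_closed[OF normal_imp_subgroup[OF M(1)]] by (force simp: in_base_translate_iff)
qed

end

section \<open>Extending homomorphisms from the vertex groups\<close>

locale hnn_in_class = hnn B H K \<phi> + root_class_of_periodic_groups C
  for B :: "('a, 'b) monoid_scheme" (structure) and H K \<phi> and C :: "'u monoid set" +
  assumes small: "carrier B \<lesssim> (UNIV :: 'u set)"
begin

lemma small_E: "carrier E \<lesssim> (UNIV :: 'u set)"
  using E_lepoll[OF infinite_universe small] .

lemma cocycle_kernel:
  assumes "in_class C A" "cocycle A \<mu>" "N \<in> kernels E"
    and "\<And>x y b. y \<in> N \<Longrightarrow> x \<in> carrier E \<Longrightarrow> b \<in> carrier B \<Longrightarrow> \<mu> (y \<cdot> x) (\<iota> b) = \<mu> x (\<iota> b)"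
    and "\<And>x y. y \<in> N \<Longrightarrow> x \<in> carrier E \<Longrightarrow> \<mu> (y \<cdot> x) t = \<mu> x t"
  shows "\<exists>T\<in>kernels E. T \<subseteq> {y \<in> N. \<mu> \<one>\<^sub>E y = \<one>\<^bsub>A\<^esub>}"
proof -
  have "N \<subseteq> carrier E" using kernelsD(1)[OF assms(3)] normal_imp_subgroup subgroup.subset by blast
  then have "\<mu> \<one>\<^sub>E \<in> hom (E\<lparr>carrier := N\<rparr>) A"
    by (rule cocycle_hom[OF in_class_group[OF assms(1)] assms(2)]) (use assms(4,5) in auto)
  then show ?thesis by (rule gruenberg[OF small_E assms(3,1)])
qed

lemma separate_reduced_word_in_class:
  assumes "N \<in> kernels E" "xs \<noteq> []" "snd ` set xs \<subseteq> carrier B" "reduced_mod N xs"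
  shows "\<exists>M\<in>kernels E. M \<subseteq> N \<and> val xs \<notin> base_translate M (carrier B)"
proof -
  obtain A a where A: "A \<in> C" "comm_group A" "a \<in> carrier A" "a \<noteq> \<one>\<^bsub>A\<^esub>"
    using ex_nontrivial_comm_group .
  show ?thesis
  proof (rule separate_reduced_word[OF _ A(3,4) _ _ _ assms])
    show "group A" using member_group A(1) .
    show "N \<lhd> E" if "N \<in> kernels E" for N using kernelsD(1)[OF that] .
    show "N \<inter> M \<in> kernels E" if "N \<in> kernels E" "M \<in> kernels E" for N M
      using kernels_Int[OF small_E that] .
    show "\<exists>M\<in>kernels E. M \<subseteq> {x \<in> N. \<chi> x = \<one>\<^bsub>A\<^esub>}"
      if "N \<in> kernels E" "\<chi> \<in> hom (E\<lparr>carrier := N\<rparr>) A" for N \<chi>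
      using gruenberg[OF small_E that(1) in_class_member[OF A(1)] that(2)] .
  qed
qed

text \<open>
  Here \<open>r e\<close> is a representative of the double coset \<open>Y e S\<close>, and \<open>s e\<close> is an element of \<open>S\<close> that carries it to
  \<open>e\<close> modulo \<open>Y\<close>; it depends only on the coset \<open>Y e\<close>.
\<close>

lemma ex_double_coset_representatives:
  assumes "Y \<lhd> E" "subgroup S B"
  obtains r s where
    "\<And>e. e \<in> carrier E \<Longrightarrow> r e \<in> carrier E \<and> s e \<in> S \<and> (\<exists>y\<in>Y. e = y \<cdot> r e \<cdot> \<iota> (s e))"
    "\<And>e c. e \<in> carrier E \<Longrightarrow> c \<in> S \<Longrightarrow> r (e \<cdot> \<iota> c) = r e"
    "\<And>y e. y \<in> Y \<Longrightarrow> e \<in> carrier E \<Longrightarrow> r (y \<cdot> e) = r e"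
    "\<And>y e. y \<in> Y \<Longrightarrow> e \<in> carrier E \<Longrightarrow> s (y \<cdot> e) = s e"
proof -
  interpret Y: normal Y E by fact
  interpret S: subgroup S B by fact
  have YE: "y \<in> carrier E" if "y \<in> Y" for y using that Y.subset by blast
  have SB: "c \<in> carrier B" if "c \<in> S" for c using that S.subset by blast
  define D where "D e = {y \<cdot> e \<cdot> \<iota> c |y c. y \<in> Y \<and> c \<in> S}" for e
  have D_sub: "D (y \<cdot> e \<cdot> \<iota> c) \<subseteq> D e" if "y \<in> Y" "c \<in> S" "e \<in> carrier E" for y c e
  proof
    fix d assume "d \<in> D (y \<cdot> e \<cdot> \<iota> c)"
    then obtain z d' where z: "z \<in> Y" "d' \<in> S" "d = z \<cdot> (y \<cdot> e \<cdot> \<iota> c) \<cdot> \<iota> d'"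
      by (auto simp: D_def)
    then have "d = (z \<cdot> y) \<cdot> e \<cdot> \<iota> (c \<otimes> d')"
      using that by (simp add: E.m_assoc YE SB)
    then show "d \<in> D e" using z that unfolding D_def by blast
  qed
  have D_eq: "D (y \<cdot> e \<cdot> \<iota> c) = D e" if "y \<in> Y" "c \<in> S" "e \<in> carrier E" for y c e
  proof
    let ?e = "y \<cdot> e \<cdot> \<iota> c"
    have "inv\<^sub>E y \<cdot> ?e \<cdot> \<iota> (inv c) = e"
      using that by (simp add: E.m_assoc YE SB E.mult_inv_mult)
    then show "D e \<subseteq> D ?e"
      using D_sub[of "inv\<^sub>E y" "inv c" ?e] that YE SB by simp
  qed (rule D_sub[OF that])
  have D_refl: "e \<in> D e" if "e \<in> carrier E" for e
    unfolding D_def using that Y.one_closed S.one_closed by (auto intro!: exI[of _ "\<one>\<^sub>E"] exI[of _ "\<one>"])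
  define r where "r e = (SOME d. d \<in> D e)" for e
  define P where "P e c \<longleftrightarrow> c \<in> S \<and> (\<exists>y\<in>Y. e = y \<cdot> r e \<cdot> \<iota> c)" for e c
  define s where "s e = (SOME c. P e c)" for e
  have r_eq: "r (y \<cdot> e \<cdot> \<iota> c) = r e" if "y \<in> Y" "c \<in> S" "e \<in> carrier E" for y c e
    using D_eq[OF that] by (simp add: r_def)
  have r_right: "r (e \<cdot> \<iota> c) = r e" if "e \<in> carrier E" "c \<in> S" for e c
    using r_eq[OF Y.one_closed that(2,1)] that by (simp add: SB)
  have r_left: "r (y \<cdot> e) = r e" if "y \<in> Y" "e \<in> carrier E" for y e
    using r_eq[OF that(1) S.one_closed that(2)] that YE by simp
  have rD: "r e \<in> D e" if "e \<in> carrier E" for e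
    unfolding r_def using D_refl[OF that] by (rule someI)
  have rE: "r e \<in> carrier E" if "e \<in> carrier E" for e
    using rD[OF that] that YE SB by (auto simp: D_def)
  have P_ex: "\<exists>c. P e c" if e: "e \<in> carrier E" for e
  proof -
    obtain y c where yc: "y \<in> Y" "c \<in> S" "r e = y \<cdot> e \<cdot> \<iota> c" using rD[OF e] by (auto simp: D_def)
    have "inv\<^sub>E y \<cdot> r e \<cdot> \<iota> (inv c) = e"
      using yc e by (simp add: E.m_assoc YE SB E.mult_inv_mult)
    then have "P e (inv c)" unfolding P_def using yc by (metis Y.m_inv_closed S.m_inv_closed)
    then show ?thesis ..
  qed
  have P: "P e (s e)" if "e \<in> carrier E" for e
    unfolding s_def using someI_ex[OF P_ex[OF that]] .
  have P_left: "P (y \<cdot> e) c \<longleftrightarrow> P e c" if y: "y \<in> Y" and e: "e \<in> carrier E" for y e c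
  proof -
    have *: "P (y \<cdot> e) c" if y: "y \<in> Y" and e: "e \<in> carrier E" and P: "P e c" for y e
    proof -
      obtain z where z: "z \<in> Y" "e = z \<cdot> r e \<cdot> \<iota> c" "c \<in> S" using P by (auto simp: P_def)
      have "y \<cdot> e = y \<cdot> z \<cdot> r e \<cdot> \<iota> c"
        using arg_cong[OF z(2), of "\<lambda>e. y \<cdot> e"] y z(1,3) rE[OF e] by (simp add: E.m_assoc YE SB)
      then show ?thesis
        unfolding P_def r_left[OF y e] using z(3) Y.m_closed[OF y z(1)] by blast
    qed
    have "inv\<^sub>E y \<cdot> (y \<cdot> e) = e" using YE[OF y] e by (simp add: E.mult_inv_mult)
    then show ?thesis
      using *[OF y e] *[OF Y.m_inv_closed[OF y], of "y \<cdot> e"] YE[OF y] e by auto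
  qed
  have s_left: "s (y \<cdot> e) = s e" if "y \<in> Y" "e \<in> carrier E" for y e
  proof -
    have "P (y \<cdot> e) = P e" by (rule ext) (rule P_left[OF that])
    then show ?thesis by (simp add: s_def)
  qed
  show thesis
    by (rule that[of r s]) (use rE P r_right r_left s_left in \<open>auto simp: P_def\<close>)
qed

lemma representative_quotient_in_normal:
  assumes Y: "Y \<lhd> E" and r: "r \<in> carrier E" and c: "c \<in> carrier B" "d \<in> carrier B" "b \<in> carrier B"
    and e: "y \<in> Y" "e = y \<cdot> r \<cdot> \<iota> c"
    and eb: "z \<in> Y" "e \<cdot> \<iota> b = z \<cdot> r \<cdot> \<iota> d"
  shows "\<iota> (c \<otimes> b \<otimes> inv d) \<in> Y"
proof -
  interpret Y: normal Y E by fact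
  have yz: "y \<in> carrier E" "z \<in> carrier E" using e(1) eb(1) Y.subset by auto
  have "y \<cdot> r \<cdot> \<iota> c \<cdot> \<iota> b \<cdot> inv\<^sub>E \<iota> d = z \<cdot> r"
    using eb(2) e(2) r c yz by (simp add: E.m_assoc)
  then have "\<iota> (c \<otimes> b \<otimes> inv d) = inv\<^sub>E r \<cdot> (inv\<^sub>E y \<cdot> (z \<cdot> r))"
    using r c yz by (simp add: E.m_assoc E.mult_inv_mult flip: \<open>_ = z \<cdot> r\<close>)
  also have "\<dots> = inv\<^sub>E r \<cdot> (inv\<^sub>E y \<cdot> z) \<cdot> r"
    using r yz by (simp add: E.m_assoc)
  also have "\<dots> \<in> Y" using Y.inv_op_closed1[OF r] e(1) eb(1) by simp
  finally show ?thesis .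
qed

text \<open>
  The subgroup \<open>Y\<close> acts on the Bass-Serre tree of \<open>E\<close>.  Its vertex groups are the conjugates of \<open>N = Y \<inter> B\<close> and its edge
  groups the conjugates of \<open>Y \<inter> H\<close>, so homomorphisms of the vertex groups to \<open>A\<close> that agree on the edge
  groups extend to a homomorphism \<open>\<psi>\<close> on \<open>Y\<close>.  In the lemma \<open>\<theta> e n\<close> is the prescribed value of \<open>\<psi>\<close> at
  \<open>e n e\<^sup>-\<^sup>1\<close>, the hypotheses are the evident relations between these values, and the conclusion
  follows from the Gruenberg condition for \<open>\<psi>\<close>.

  The proof avoids the tree and constructs a cocycle.  On \<open>B\<close> it is given by \<open>\<beta>\<close>, which uses
  representatives of the double cosets \<open>Y e B\<close> and extends \<open>\<theta>\<close>.  The failure of \<open>\<beta>\<close> to be compatible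
  with \<open>t\<close> is measured by \<open>\<delta>\<close>.  This is trivial on \<open>Y \<inter> H\<close>, hence can be compensated on each
  double coset \<open>Y e H\<close> by a suitable value \<open>\<sigma>\<close> of the cocycle on \<open>t\<close>.
\<close>

lemma extend_vertex_homs:
  assumes A: "comm_group A" "in_class C A" and Y: "Y \<in> kernels E"
    and N: "N = {b \<in> carrier B. \<iota> b \<in> Y}"
    and \<theta>: "\<And>e. e \<in> carrier E \<Longrightarrow> \<theta> e \<in> hom (B\<lparr>carrier := N\<rparr>) A"
    and \<theta>_base: "\<And>e b n. e \<in> carrier E \<Longrightarrow> b \<in> carrier B \<Longrightarrow> n \<in> N \<Longrightarrow>
      \<theta> (e \<cdot> \<iota> b) n = \<theta> e (b \<otimes> n \<otimes> inv b)"
    and \<theta>_t: "\<And>e h. e \<in> carrier E \<Longrightarrow> h \<in> H \<Longrightarrow> h \<in> N \<Longrightarrow> \<theta> (e \<cdot> t) (\<phi> h) = \<theta> e h"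
    and \<theta>_Y: "\<And>y e n. y \<in> Y \<Longrightarrow> e \<in> carrier E \<Longrightarrow> n \<in> N \<Longrightarrow> \<theta> (y \<cdot> e) n = \<theta> e n"
  shows "\<exists>T\<in>kernels E. T \<subseteq> Y \<and> (\<forall>n\<in>N. \<iota> n \<in> T \<longrightarrow> \<theta> \<one>\<^sub>E n = \<one>\<^bsub>A\<^esub>)"
proof -
  interpret A: comm_group A by fact
  have nY: "Y \<lhd> E" using kernelsD(1)[OF Y] .
  interpret Y: normal Y E using nY .
  have YE: "y \<in> carrier E" if "y \<in> Y" for y using that Y.subset by blast
  have NB: "n \<in> carrier B" if "n \<in> N" for n using that N by blast
  have sN: "subgroup N B"
    unfolding N by (rule subgroup.intro) (auto simp: Y.m_closed)
  obtain r s where rs: "\<And>e. e \<in> carrier E \<Longrightarrow> r e \<in> carrier E \<and> s e \<in> carrier B \<and> (\<exists>y\<in>Y. e = y \<cdot> r e \<cdot> \<iota> (s e))"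
    and r_right: "\<And>e c. e \<in> carrier E \<Longrightarrow> c \<in> carrier B \<Longrightarrow> r (e \<cdot> \<iota> c) = r e"
    and r_left: "\<And>y e. y \<in> Y \<Longrightarrow> e \<in> carrier E \<Longrightarrow> r (y \<cdot> e) = r e"
    and s_left: "\<And>y e. y \<in> Y \<Longrightarrow> e \<in> carrier E \<Longrightarrow> s (y \<cdot> e) = s e"
    by (rule ex_double_coset_representatives[OF nY subgroup_self]) (rule that; assumption)
  obtain q k where qk: "\<And>e. e \<in> carrier E \<Longrightarrow> q e \<in> carrier E \<and> k e \<in> H \<and> (\<exists>y\<in>Y. e = y \<cdot> q e \<cdot> \<iota> (k e))"
    and q_right: "\<And>e c. e \<in> carrier E \<Longrightarrow> c \<in> H \<Longrightarrow> q (e \<cdot> \<iota> c) = q e"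
    and q_left: "\<And>y e. y \<in> Y \<Longrightarrow> e \<in> carrier E \<Longrightarrow> q (y \<cdot> e) = q e"
    and k_left: "\<And>y e. y \<in> Y \<Longrightarrow> e \<in> carrier E \<Longrightarrow> k (y \<cdot> e) = k e"
    by (rule ex_double_coset_representatives[OF nY subgroup_H]) (rule that; assumption)
  have HB: "h \<in> carrier B" if "h \<in> H" for h using that H_subset by blast
  define m where "m e b = s e \<otimes> b \<otimes> inv (s (e \<cdot> \<iota> b))" for e b
  have m: "m e b \<in> N" if e: "e \<in> carrier E" and b: "b \<in> carrier B" for e b
  proof -
    obtain y where y: "y \<in> Y" "e = y \<cdot> r e \<cdot> \<iota> (s e)" using rs[OF e] by blast
    have eb: "e \<cdot> \<iota> b \<in> carrier E" using e b by simp
    obtain z where z: "z \<in> Y" "e \<cdot> \<iota> b = z \<cdot> r e \<cdot> \<iota> (s (e \<cdot> \<iota> b))"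
      using rs[OF eb] r_right[OF e b] by auto
    show ?thesis
      unfolding m_def N
      using representative_quotient_in_normal[OF nY _ _ _ b y z] rs[OF e] rs[OF eb] b by simp
  qed
  define \<beta> where "\<beta> e b = \<theta> (r e) (m e b)" for e b
  have \<beta>: "\<beta> e b \<in> carrier A" if "e \<in> carrier E" "b \<in> carrier B" for e b
    using hom_in_carrier[OF \<theta>, of "r e" "m e b"] m[OF that] rs[OF that(1)] by (simp add: \<beta>_def)
  have \<beta>_mult: "\<beta> e (b \<otimes> c) = \<beta> e b \<otimes>\<^bsub>A\<^esub> \<beta> (e \<cdot> \<iota> b) c"
    if e: "e \<in> carrier E" and b: "b \<in> carrier B" and c: "c \<in> carrier B" for e b c
  proof -
    have eb: "e \<cdot> \<iota> b \<in> carrier E" and ebc: "e \<cdot> \<iota> b \<cdot> \<iota> c \<in> carrier E" using e b c by simp_all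
    have ss: "s e \<in> carrier B" "s (e \<cdot> \<iota> b) \<in> carrier B" "s (e \<cdot> \<iota> b \<cdot> \<iota> c) \<in> carrier B"
      using rs[OF e] rs[OF eb] rs[OF ebc] by blast+
    have "e \<cdot> \<iota> (b \<otimes> c) = e \<cdot> \<iota> b \<cdot> \<iota> c" using e b c by (simp add: E.m_assoc)
    then have "m e (b \<otimes> c) = m e b \<otimes> m (e \<cdot> \<iota> b) c"
      using ss b c by (simp add: m_def m_assoc mult_inv_mult)
    then show ?thesis
      using hom_mult[OF \<theta>[of "r e"], of "m e b" "m (e \<cdot> \<iota> b) c"] m[OF e b] m[OF eb c] rs[OF e] r_right[OF e b]
      by (simp add: \<beta>_def)
  qed
  have conj_Y: "e \<cdot> \<iota> n \<cdot> inv\<^sub>E e \<in> Y" "e \<cdot> \<iota> n \<cdot> inv\<^sub>E e \<cdot> e = e \<cdot> \<iota> n"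
    if "e \<in> carrier E" "n \<in> N" for e n
    using that Y.inv_op_closed2[of e "\<iota> n"] by (simp_all add: N E.m_assoc)
  have \<beta>_N: "\<beta> e n = \<theta> e n" if e: "e \<in> carrier E" and n: "n \<in> N" for e n
  proof -
    obtain y where y: "y \<in> Y" "e = y \<cdot> r e \<cdot> \<iota> (s e)" using rs[OF e] by blast
    have re: "r e \<in> carrier E" "s e \<in> carrier B" using rs[OF e] by blast+
    have "s (e \<cdot> \<iota> n) = s e" using s_left[OF conj_Y(1)[OF e n] e] conj_Y(2)[OF e n] by simp
    then have "\<beta> e n = \<theta> (r e \<cdot> \<iota> (s e)) n" using \<theta>_base[OF re n] by (simp add: \<beta>_def m_def)
    also have "\<dots> = \<theta> (y \<cdot> (r e \<cdot> \<iota> (s e))) n" using \<theta>_Y[OF y(1) _ n] re by simp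
    also have "y \<cdot> (r e \<cdot> \<iota> (s e)) = e" using y re by (simp add: E.m_assoc YE)
    finally show ?thesis .
  qed
  have \<beta>_left: "\<beta> (y \<cdot> e) b = \<beta> e b" if "y \<in> Y" "e \<in> carrier E" "b \<in> carrier B" for y e b
    using that r_left s_left s_left[of y "e \<cdot> \<iota> b"] by (simp add: \<beta>_def m_def E.m_assoc YE)
  define \<delta> where "\<delta> e h = \<beta> (e \<cdot> t) (\<phi> h) \<otimes>\<^bsub>A\<^esub> inv\<^bsub>A\<^esub> \<beta> e h" for e h
  have \<delta>: "\<delta> e h \<in> carrier A" if "e \<in> carrier E" "h \<in> H" for e h
    using that \<beta> HB \<phi>_carrier by (simp add: \<delta>_def)
  have \<delta>_left: "\<delta> (y \<cdot> e) h = \<delta> e h" if "y \<in> Y" "e \<in> carrier E" "h \<in> H" for y e h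
    using that \<beta>_left[of y "e \<cdot> t" "\<phi> h"] \<beta>_left[of y e h] HB \<phi>_carrier by (simp add: \<delta>_def E.m_assoc YE)
  have \<delta>_mult: "\<delta> e (g \<otimes> h) = \<delta> e g \<otimes>\<^bsub>A\<^esub> \<delta> (e \<cdot> \<iota> g) h" if e: "e \<in> carrier E" and gh: "g \<in> H" "h \<in> H" for e g h
  proof -
    have sw: "e \<cdot> t \<cdot> \<iota> (\<phi> g) = e \<cdot> \<iota> g \<cdot> t"
      using t_swap[OF gh(1)] e gh HB \<phi>_carrier by (simp add: E.m_assoc)
    have "\<delta> e (g \<otimes> h) = \<beta> (e \<cdot> t) (\<phi> g) \<otimes>\<^bsub>A\<^esub> \<beta> (e \<cdot> \<iota> g \<cdot> t) (\<phi> h)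
        \<otimes>\<^bsub>A\<^esub> inv\<^bsub>A\<^esub> (\<beta> e g \<otimes>\<^bsub>A\<^esub> \<beta> (e \<cdot> \<iota> g) h)"
      using e gh HB \<phi>_carrier by (simp add: \<delta>_def \<phi>_mult \<beta>_mult sw)
    also have "\<dots> = \<delta> e g \<otimes>\<^bsub>A\<^esub> \<delta> (e \<cdot> \<iota> g) h"
      using e gh HB \<phi>_carrier \<beta> by (simp add: \<delta>_def A.inv_mult A.m_ac)
    finally show ?thesis .
  qed
  have \<delta>_N: "\<delta> e n = \<one>\<^bsub>A\<^esub>" if e: "e \<in> carrier E" and n: "n \<in> H" "n \<in> N" for e n
  proof -
    have "\<iota> (\<phi> n) \<in> Y"
      using Y.inv_op_closed1[OF t_closed, of "\<iota> n"] n t_conj[OF n(1)] by (simp add: N)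
    then have "\<phi> n \<in> N" using \<phi>_carrier[OF n(1)] by (simp add: N)
    then have "\<beta> (e \<cdot> t) (\<phi> n) = \<beta> e n" using \<beta>_N \<theta>_t[OF e n] e n by simp
    then show ?thesis using \<beta>[OF e HB[OF n(1)]] by (simp add: \<delta>_def)
  qed
  define \<sigma> where "\<sigma> e = \<delta> (q e) (k e)" for e
  have \<sigma>: "\<sigma> e \<in> carrier A" if "e \<in> carrier E" for e
    using \<delta> qk[OF that] by (simp add: \<sigma>_def)
  have \<sigma>_left: "\<sigma> (y \<cdot> e) = \<sigma> e" if "y \<in> Y" "e \<in> carrier E" for y e
    using q_left[OF that] k_left[OF that] by (simp add: \<sigma>_def)
  have \<sigma>_H: "\<sigma> (e \<cdot> \<iota> h) = \<sigma> e \<otimes>\<^bsub>A\<^esub> \<delta> e h" if e: "e \<in> carrier E" and h: "h \<in> H" for e h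
  proof -
    obtain y where y: "y \<in> Y" "e = y \<cdot> q e \<cdot> \<iota> (k e)" using qk[OF e] by blast
    have eh: "e \<cdot> \<iota> h \<in> carrier E" using e HB[OF h] by simp
    obtain z where z: "z \<in> Y" "e \<cdot> \<iota> h = z \<cdot> q e \<cdot> \<iota> (k (e \<cdot> \<iota> h))"
      using qk[OF eh] q_right[OF e h] by auto
    have kk: "k e \<in> H" "k (e \<cdot> \<iota> h) \<in> H" "q e \<in> carrier E" using qk[OF e] qk[OF eh] by blast+
    define n where "n = inv (k e \<otimes> h \<otimes> inv (k (e \<cdot> \<iota> h)))"
    have "\<iota> (k e \<otimes> h \<otimes> inv (k (e \<cdot> \<iota> h))) \<in> Y"
      using representative_quotient_in_normal[OF nY kk(3) _ _ _ y z] kk h HB by simp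
    then have nN: "n \<in> N" unfolding n_def using sN kk h HB by (intro subgroup.m_inv_closed) (auto simp: N)
    have nH: "n \<in> H" unfolding n_def
      using kk h subgroup_H by (simp add: subgroup.m_closed subgroup.m_inv_closed)
    have "k (e \<cdot> \<iota> h) = n \<otimes> (k e \<otimes> h)"
      unfolding n_def using kk h HB by (simp add: inv_mult_group m_assoc mult_inv_mult)
    moreover have kh: "k e \<otimes> h \<in> H" using kk h subgroup_H by (simp add: subgroup.m_closed)
    ultimately have "\<sigma> (e \<cdot> \<iota> h) = \<delta> (q e) n \<otimes>\<^bsub>A\<^esub> \<delta> (q e \<cdot> \<iota> n) (k e \<otimes> h)"
      using \<delta>_mult[OF kk(3) nH kh] q_right[OF e h] by (simp add: \<sigma>_def)
    also have "\<delta> (q e) n = \<one>\<^bsub>A\<^esub>" using \<delta>_N[OF kk(3) nH nN] .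
    also have "\<delta> (q e \<cdot> \<iota> n) (k e \<otimes> h) = \<delta> (q e) (k e \<otimes> h)"
      using \<delta>_left[OF conj_Y(1)[OF kk(3) nN] kk(3) kh] conj_Y(2)[OF kk(3) nN] by simp
    also have "\<delta> (q e) (k e \<otimes> h) = \<sigma> e \<otimes>\<^bsub>A\<^esub> \<delta> (q e \<cdot> \<iota> (k e)) h"
      using \<delta>_mult[OF kk(3,1) h] by (simp add: \<sigma>_def)
    also have "\<delta> (q e \<cdot> \<iota> (k e)) h = \<delta> (y \<cdot> (q e \<cdot> \<iota> (k e))) h"
      using \<delta>_left[OF y(1) _ h, of "q e \<cdot> \<iota> (k e)"] kk HB by simp
    also have "y \<cdot> (q e \<cdot> \<iota> (k e)) = e" using y kk HB by (simp add: E.m_assoc YE)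
    finally show ?thesis using \<sigma>[OF e] \<delta>[OF e h] by simp
  qed
  have rel: "\<beta> e h \<otimes>\<^bsub>A\<^esub> \<sigma> (e \<cdot> \<iota> h) = \<sigma> e \<otimes>\<^bsub>A\<^esub> \<beta> (e \<cdot> t) (\<phi> h)"
    if e: "e \<in> carrier E" and h: "h \<in> H" for e h
  proof -
    have c: "\<beta> e h \<in> carrier A" "\<beta> (e \<cdot> t) (\<phi> h) \<in> carrier A" "\<sigma> e \<in> carrier A"
      using \<beta> \<sigma> e h HB \<phi>_carrier by simp_all
    have "\<beta> e h \<otimes>\<^bsub>A\<^esub> \<sigma> (e \<cdot> \<iota> h) = \<sigma> e \<otimes>\<^bsub>A\<^esub> \<beta> (e \<cdot> t) (\<phi> h) \<otimes>\<^bsub>A\<^esub> (\<beta> e h \<otimes>\<^bsub>A\<^esub> inv\<^bsub>A\<^esub> \<beta> e h)"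
      unfolding \<sigma>_H[OF e h] \<delta>_def using c by (simp only: A.m_ac A.m_closed A.inv_closed)
    then show ?thesis using c by simp
  qed
  obtain \<mu> where \<mu>: "cocycle A \<mu>" "\<And>x b. x \<in> carrier E \<Longrightarrow> b \<in> carrier B \<Longrightarrow> \<mu> x (\<iota> b) = \<beta> x b"
      "\<And>x. x \<in> carrier E \<Longrightarrow> \<mu> x t = \<sigma> x"
    by (rule ex_cocycle[OF A.group_axioms \<beta> \<beta>_mult \<sigma> rel]) (assumption | (rule that; assumption))+
  obtain T where T: "T \<in> kernels E" "T \<subseteq> {y \<in> Y. \<mu> \<one>\<^sub>E y = \<one>\<^bsub>A\<^esub>}"
    using cocycle_kernel[OF A(2) \<mu>(1) Y] \<mu>(2,3) \<beta>_left \<sigma>_left YE by auto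
  have "\<theta> \<one>\<^sub>E n = \<one>\<^bsub>A\<^esub>" if "n \<in> N" "\<iota> n \<in> T" for n
    using T(2) that \<mu>(2)[of "\<one>\<^sub>E" n] \<beta>_N[of "\<one>\<^sub>E" n] NB by auto
  then show ?thesis using T by (intro bexI[OF _ T(1)]) auto
qed

end

section \<open>Quotients of HNN-extensions\<close>

context hnn
begin

text \<open>
  The isomorphism \<open>HN/N \<rightarrow> KN/N\<close> induced by \<open>\<phi>\<close>, under the condition \<open>(N \<inter> H)\<phi> = N \<inter> K\<close> that makes it well defined
  (\<open>quotient_iso_coset\<close>).
\<close>

definition quotient_iso :: "'a set \<Rightarrow> 'a set \<Rightarrow> 'a set" where
  "quotient_iso N X = N <#> \<phi> ` (X \<inter> H)"

lemma quotient_iso_coset: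
  assumes "N \<lhd> B" "\<phi> ` (N \<inter> H) = N \<inter> K" "h \<in> H"
  shows "quotient_iso N (N #> h) = N #> \<phi> h"
proof -
  interpret N: normal N B by fact
  have hB: "h \<in> carrier B" using assms(3) H_subset by blast
  have \<phi>hB: "\<phi> h \<in> carrier B" using \<phi>_carrier[OF assms(3)] .
  show ?thesis
  proof
    show "quotient_iso N (N #> h) \<subseteq> N #> \<phi> h"
    proof
      fix y assume "y \<in> quotient_iso N (N #> h)"
      then obtain n m where nm: "n \<in> N" "m \<in> N" "m \<otimes> h \<in> H" "y = n \<otimes> \<phi> (m \<otimes> h)"
        by (auto simp: quotient_iso_def set_mult_def r_coset_def)
      have mB: "m \<in> carrier B" and nB: "n \<in> carrier B" using nm N.subset by auto
      have "m \<otimes> h \<otimes> inv h \<in> H"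
        using nm(3) assms(3) subgroup_H by (simp add: subgroup.m_closed subgroup.m_inv_closed)
      then have mH: "m \<in> H" using mB hB by (simp add: m_assoc)
      then have m: "\<phi> m \<in> N" using assms(2) nm(2) by blast
      have "y = (n \<otimes> \<phi> m) \<otimes> \<phi> h"
        using nm(4) \<phi>_mult[OF mH assms(3)] nB \<phi>_carrier[OF mH] \<phi>hB by (simp add: m_assoc)
      then show "y \<in> N #> \<phi> h" using N.m_closed[OF nm(1) m] by (auto simp: r_coset_def)
    qed
    show "N #> \<phi> h \<subseteq> quotient_iso N (N #> h)"
    proof
      fix y assume "y \<in> N #> \<phi> h"
      then obtain n where n: "n \<in> N" "y = n \<otimes> \<phi> h" by (auto simp: r_coset_def)
      have "h \<in> N #> h" using rcos_self[OF hB N.is_subgroup] .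
      then have "\<phi> h \<in> \<phi> ` ((N #> h) \<inter> H)" using assms(3) by blast
      then show "y \<in> quotient_iso N (N #> h)"
        using n unfolding quotient_iso_def set_mult_def by blast
    qed
  qed
qed

lemma image_subgroup_Mod:
  assumes "N \<lhd> B" "subgroup S B"
  shows "subgroup ((#>) N ` S) (B Mod N)"
proof -
  interpret N: normal N B by fact
  interpret Q: group_hom B "B Mod N" "(#>) N"
    using N.r_coset_hom_Mod N.factorgroup_is_group
    by (simp add: group_hom_def group_hom_axioms_def group_axioms)
  show ?thesis using Q.subgroup_img_is_subgroup[OF assms(2)] .
qed

lemma hnn_quotient:
  assumes "N \<lhd> B" "\<phi> ` (N \<inter> H) = N \<inter> K"
  shows "hnn (B Mod N) ((#>) N ` H) ((#>) N ` K) (quotient_iso N)"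
proof -
  interpret N: normal N B by fact
  interpret Q: group_hom B "B Mod N" "(#>) N"
    using N.r_coset_hom_Mod N.factorgroup_is_group
    by (simp add: group_hom_def group_hom_axioms_def group_axioms)
  note qi = quotient_iso_coset[OF assms]
  have HB: "h \<in> carrier B" if "h \<in> H" for h using that H_subset by blast
  have "quotient_iso N \<in> iso ((B Mod N)\<lparr>carrier := (#>) N ` H\<rparr>) ((B Mod N)\<lparr>carrier := (#>) N ` K\<rparr>)"
    unfolding iso_def bij_betw_def
  proof (intro CollectI conjI homI inj_onI)
    fix X assume "X \<in> carrier ((B Mod N)\<lparr>carrier := (#>) N ` H\<rparr>)"
    then show "quotient_iso N X \<in> carrier ((B Mod N)\<lparr>carrier := (#>) N ` K\<rparr>)"
      using qi \<phi>_mem by auto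
  next
    fix X Y assume "X \<in> carrier ((B Mod N)\<lparr>carrier := (#>) N ` H\<rparr>)" "Y \<in> carrier ((B Mod N)\<lparr>carrier := (#>) N ` H\<rparr>)"
    then obtain x y where xy: "x \<in> H" "y \<in> H" "X = N #> x" "Y = N #> y" by auto
    have xyH: "x \<otimes> y \<in> H" using xy subgroup_H by (simp add: subgroup.m_closed)
    have "X \<otimes>\<^bsub>B Mod N\<^esub> Y = N #> (x \<otimes> y)" using xy HB Q.hom_mult[of x y] by simp
    moreover have "N #> \<phi> (x \<otimes> y) = (N #> \<phi> x) \<otimes>\<^bsub>B Mod N\<^esub> (N #> \<phi> y)"
      using xy \<phi>_carrier \<phi>_mult Q.hom_mult[of "\<phi> x" "\<phi> y"] by simp
    ultimately show "quotient_iso N (X \<otimes>\<^bsub>(B Mod N)\<lparr>carrier := (#>) N ` H\<rparr>\<^esub> Y)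
      = quotient_iso N X \<otimes>\<^bsub>(B Mod N)\<lparr>carrier := (#>) N ` K\<rparr>\<^esub> quotient_iso N Y"
      using xy xyH qi by simp
  next
    fix X Y assume "X \<in> carrier ((B Mod N)\<lparr>carrier := (#>) N ` H\<rparr>)" "Y \<in> carrier ((B Mod N)\<lparr>carrier := (#>) N ` H\<rparr>)"
      and eq: "quotient_iso N X = quotient_iso N Y"
    then obtain x y where xy: "x \<in> H" "y \<in> H" "X = N #> x" "Y = N #> y" by auto
    have z: "x \<otimes> inv y \<in> H" using xy subgroup_H by (simp add: subgroup.m_closed subgroup.m_inv_closed)
    note \<phi>z = \<phi>_div[OF xy(1,2)]
    have "N #> \<phi> x = N #> \<phi> y" using eq qi xy by simp
    then have "\<phi> (x \<otimes> inv y) \<in> N \<inter> K"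
      using coset_eq_iff[OF assms(1)] \<phi>_carrier xy \<phi>z \<phi>_mem[OF z] by simp
    then obtain w where "w \<in> N \<inter> H" "\<phi> (x \<otimes> inv y) = \<phi> w" using assms(2) by (metis imageE)
    then have "x \<otimes> inv y \<in> N" using \<phi>_inj z by (metis IntE inj_onD)
    then show "X = Y" using coset_eq_iff[OF assms(1)] xy HB by simp
  next
    show "quotient_iso N ` carrier ((B Mod N)\<lparr>carrier := (#>) N ` H\<rparr>) = carrier ((B Mod N)\<lparr>carrier := (#>) N ` K\<rparr>)"
      using qi by (simp add: image_image \<phi>_image[symmetric])
  qed
  then show ?thesis
    using image_subgroup_Mod[OF assms(1) subgroup_H] image_subgroup_Mod[OF assms(1) subgroup_K] N.factorgroup_is_group
    by (simp add: hnn_def hnn_axioms_def)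
qed

end

context hnn_in_class
begin

lemma hnn_in_class_quotient:
  assumes "N \<lhd> B" "\<phi> ` (N \<inter> H) = N \<inter> K"
  shows "hnn_in_class (B Mod N) ((#>) N ` H) ((#>) N ` K) (quotient_iso N) C"
proof -
  have "carrier (B Mod N) \<lesssim> (UNIV :: 'u set)"
    unfolding carrier_FactGroup by (rule lepoll_trans[OF image_lepoll small])
  then show ?thesis
    using hnn_quotient[OF assms] root_class_of_periodic_groups_axioms
    by (simp add: hnn_in_class_def hnn_in_class_axioms_def)
qed

lemma kernels_pullback_quotient:
  assumes "N \<lhd> B" "\<phi> ` (N \<inter> H) = N \<inter> K"
    and "T \<in> kernels (hnn.E (B Mod N) ((#>) N ` H) (quotient_iso N))"
  shows "\<exists>T'\<in>kernels E. \<forall>b\<in>carrier B. \<iota> b \<in> T' \<longleftrightarrow>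
    hnn.\<iota> (B Mod N) ((#>) N ` H) (quotient_iso N) (N #> b) \<in> T"
proof -
  interpret N: normal N B by fact
  interpret Q: hnn_in_class "B Mod N" "(#>) N ` H" "(#>) N ` K" "quotient_iso N" C
    using hnn_in_class_quotient[OF assms(1,2)] .
  have f: "Q.\<iota> \<circ> (#>) N \<in> hom B Q.E"
    using Group.hom_compose[OF N.r_coset_hom_Mod Q.\<iota>_hom] .
  have rel: "(Q.\<iota> \<circ> (#>) N) h \<otimes>\<^bsub>Q.E\<^esub> Q.t = Q.t \<otimes>\<^bsub>Q.E\<^esub> (Q.\<iota> \<circ> (#>) N) (\<phi> h)" if "h \<in> H" for h
    using Q.t_swap[of "N #> h"] that quotient_iso_coset[OF assms(1,2) that] by simp
  obtain F where F: "F \<in> hom E Q.E" "\<forall>b\<in>carrier B. F (\<iota> b) = (Q.\<iota> \<circ> (#>) N) b"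
    using universal_property[OF Q.E.group_axioms f Q.t_closed rel] by blast
  have "{x \<in> carrier E. F x \<in> T} \<in> kernels E"
    by (rule kernels_vimage[OF E.group_axioms assms(3) F(1)])
  then show ?thesis by (rule bexI[rotated]) (use F(2) in simp)
qed

section \<open>Separating the associated subgroups\<close>

text \<open>
  The projection of \<open>B\<close> onto \<open>B/M\<close> extends to \<open>E\<close> by \<open>t \<mapsto> 1\<close>.
\<close>

lemma kernel_containing_associated_subgroups:
  assumes "M \<in> kernels B" "H \<subseteq> M" "K \<subseteq> M"
  shows "\<exists>T\<in>kernels E. \<forall>b\<in>carrier B. \<iota> b \<in> T \<longleftrightarrow> b \<in> M"
proof -
  obtain G f where G: "G \<in> C" "f \<in> epi B G" "M = {x \<in> carrier B. f x = \<one>\<^bsub>G\<^esub>}"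
    using kernelsE[OF assms(1)] .
  interpret G: group G using member_group[OF G(1)] .
  have f: "f \<in> hom B G" using G(2) by (simp add: epi_def)
  have rel: "f h \<otimes>\<^bsub>G\<^esub> \<one>\<^bsub>G\<^esub> = \<one>\<^bsub>G\<^esub> \<otimes>\<^bsub>G\<^esub> f (\<phi> h)" if "h \<in> H" for h
  proof -
    have "h \<in> M" "\<phi> h \<in> M" using that \<phi>_mem[OF that] assms(2,3) by auto
    then show ?thesis using G(3) by simp
  qed
  obtain F where F: "F \<in> hom E G" "\<forall>b\<in>carrier B. F (\<iota> b) = f b"
    using universal_property[OF G.group_axioms f G.one_closed rel] by blast
  have "{x \<in> carrier E. F x = \<one>\<^bsub>G\<^esub>} \<in> kernels E"
    by (rule kernelsI_hom[OF E.group_axioms in_class_member[OF G(1)] F(1)]) simp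
  then show ?thesis by (rule bexI[rotated]) (use F(2) G(3) in simp)
qed

lemma ex_exponent_hom:
  assumes "group A" "a \<in> carrier A"
  shows "\<exists>F\<in>hom E A. (\<forall>b\<in>carrier B. F (\<iota> b) = \<one>\<^bsub>A\<^esub>) \<and> F t = a"
proof -
  interpret A: group A by fact
  have "(\<lambda>_. \<one>\<^bsub>A\<^esub>) \<in> hom B A" by (simp add: hom_def)
  then show ?thesis
    using universal_property[OF assms(1) _ assms(2), of "\<lambda>_. \<one>\<^bsub>A\<^esub>"] assms(2) by simp
qed

lemma trivial_in_kernels: "in_class C B \<Longrightarrow> {\<one>} \<in> kernels B"
  by (rule kernelsI_hom[where f = "\<lambda>x. x"]) (auto simp: hom_def group_axioms)

lemma normal_HK:
  assumes "H \<lhd> B" "K \<lhd> B"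
  shows "H <#> K \<lhd> B" "H \<subseteq> H <#> K" "K \<subseteq> H <#> K"
  using normal_subgroup_set_mult_closed[OF assms] subset_set_mult[OF subgroup_H subgroup_K] by simp_all

text \<open>
  Let \<open>p1\<close> and \<open>p2\<close> be the projections of \<open>HK = H \<times> K\<close>.  Fix a homomorphism of \<open>E\<close> onto a cyclic group, the level,
  which is trivial on \<open>B\<close> and maps \<open>t\<close> to \<open>a \<noteq> 1\<close>.  The homomorphism to be extended to a kernel \<open>Y\<close> of \<open>E\<close> is, on \<open>Y \<inter> B\<close>, the
  projection \<open>p1\<close> at level \<open>1\<close>, the map \<open>\<phi>\<^sup>-\<^sup>1 p2\<close> at level \<open>a\<close>, and trivial at the other levels.  This
  agrees with \<open>t\<^sup>-\<^sup>1 h t = h\<phi>\<close>: when \<open>t\<close> leads from level \<open>1\<close> to level \<open>a\<close>, both sides have the value \<open>h\<close>; when it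
  leads to level \<open>1\<close> or away from level \<open>a\<close>, both are trivial.

  However, \<open>B\<close> acts on the values, by conjugation on \<open>H\<close> (\<open>a1\<close>) at level \<open>1\<close> and by conjugation on \<open>K\<close>, carried over
  to \<open>H\<close> by \<open>\<phi>\<close> (\<open>a2\<close>), at level \<open>a\<close>.  The values are therefore twisted by an automorphism \<open>\<alpha> e\<close> of \<open>H\<close> that records
  how \<open>e\<close> has acted so far.  Both actions factor through \<open>B/HK\<close>, and the record consists of two cocycles with values in this
  group of the class, one for each of the two levels.  The two kinds of automorphisms commute because \<open>H\<close> is
  finite cyclic.
\<close>

lemma kernel_separating_associated_subgroups:
  assumes cB: "in_class C B" and nH: "H \<lhd> B" and nK: "K \<lhd> B" and fin: "finite H"
    and lc: "locally_cyclic_in B H" and triv: "H \<inter> K = {\<one>}"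
  shows "\<exists>T\<in>kernels E. \<forall>x\<in>H <#> K. \<iota> x \<in> T \<longrightarrow> x = \<one>"
proof -
  interpret nH: normal H B by fact
  interpret nK: normal K B by fact
  let ?B = "\<lambda>S. B\<lparr>carrier := S\<rparr>"
  have HB: "h \<in> carrier B" if "h \<in> H" for h using that H_subset by blast
  have KB: "k \<in> carrier B" if "k \<in> K" for k using that K_subset by blast
  interpret BH: comm_group "?B H" using locally_cyclic_comm_group[OF subgroup_H lc] .
  have HK_comm: "h \<otimes> k = k \<otimes> h" if "h \<in> H" "k \<in> K" for h k
    using normal_imp_commuting[OF nH nK _ that] triv by simp
  have H_comm: "h \<otimes> h' = h' \<otimes> h" if "h \<in> H" "h' \<in> H" for h h'
    using locally_cyclic_in_commute[OF lc H_subset that] .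
  have K_comm: "k \<otimes> k' = k' \<otimes> k" if "k \<in> K" "k' \<in> K" for k k'
    using comm_image_of_locally_cyclic[OF subgroup_H lc iso_imp_homomorphism[OF iso] \<phi>_image that] .
  define M where "M = H <#> K"
  have M: "M \<lhd> B" "H \<subseteq> M" "K \<subseteq> M" using normal_HK[OF nH nK] by (simp_all add: M_def)
  interpret M: normal M B using M(1) .
  have "\<exists>h k. h \<in> H \<and> k \<in> K \<and> x = h \<otimes> k" if "x \<in> M" for x
    using that by (auto simp: M_def set_mult_def)
  then obtain p1 p2 where p: "\<And>x. x \<in> M \<Longrightarrow> p1 x \<in> H \<and> p2 x \<in> K \<and> x = p1 x \<otimes> p2 x" by metis
  have p12: "p1 x \<in> H" "p2 x \<in> K" if "x \<in> M" for x
    using p[OF that] by blast+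
  have unique: "h = h' \<and> k = k'" if "h \<in> H" "h' \<in> H" "k \<in> K" "k' \<in> K" "h \<otimes> k = h' \<otimes> k'" for h h' k k'
  proof -
    have "inv h' \<otimes> h = inv h' \<otimes> (h \<otimes> k) \<otimes> inv k"
      using that(1-4) HB KB by (simp add: m_assoc)
    also have "\<dots> = k' \<otimes> inv k"
      unfolding that(5) using that(1-4) HB KB by (simp add: m_assoc[symmetric])
    finally have eq: "inv h' \<otimes> h = k' \<otimes> inv k" .
    have "inv h' \<otimes> h \<in> H" "k' \<otimes> inv k \<in> K" using that(1-4) by simp_all
    then have "inv h' \<otimes> h \<in> H \<inter> K" using eq by simp
    then have "inv h' \<otimes> h = \<one>" "k' \<otimes> inv k = \<one>" using eq by (simp_all add: triv)
    moreover have "h = h' \<otimes> (inv h' \<otimes> h)" "k' = k' \<otimes> inv k \<otimes> k"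
      using that(1-4) HB KB by (simp_all add: m_assoc mult_inv_mult)
    ultimately show ?thesis using that(1-4) HB KB by simp
  qed
  have p_unique: "p1 (h \<otimes> k) = h \<and> p2 (h \<otimes> k) = k" if "h \<in> H" "k \<in> K" for h k
  proof -
    have "h \<otimes> k \<in> M" using that by (auto simp: M_def set_mult_def)
    then show ?thesis using p[of "h \<otimes> k"] unique that by metis
  qed
  have p_mult: "p1 (x \<otimes> y) = p1 x \<otimes> p1 y \<and> p2 (x \<otimes> y) = p2 x \<otimes> p2 y" if "x \<in> M" "y \<in> M" for x y
  proof -
    have c: "p1 x \<in> carrier B" "p2 x \<in> carrier B" "p1 y \<in> carrier B" "p2 y \<in> carrier B"
      using p[OF that(1)] p[OF that(2)] HB KB by blast+
    have "x \<otimes> y = (p1 x \<otimes> p2 x) \<otimes> (p1 y \<otimes> p2 y)" using p[OF that(1)] p[OF that(2)] by simp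
    also have "\<dots> = p1 x \<otimes> (p2 x \<otimes> p1 y) \<otimes> p2 y" using c by (simp add: m_assoc)
    also have "p2 x \<otimes> p1 y = p1 y \<otimes> p2 x" using HK_comm[OF p12(1)[OF that(2)] p12(2)[OF that(1)]] by simp
    also have "p1 x \<otimes> (p1 y \<otimes> p2 x) \<otimes> p2 y = (p1 x \<otimes> p1 y) \<otimes> (p2 x \<otimes> p2 y)"
      using c by (simp add: m_assoc)
    finally have "x \<otimes> y = (p1 x \<otimes> p1 y) \<otimes> (p2 x \<otimes> p2 y)" .
    then show ?thesis using p_unique[of "p1 x \<otimes> p1 y" "p2 x \<otimes> p2 y"] p12[OF that(1)] p12[OF that(2)] by simp
  qed
  have p_conj: "p1 (b \<otimes> x \<otimes> inv b) = b \<otimes> p1 x \<otimes> inv b \<and> p2 (b \<otimes> x \<otimes> inv b) = b \<otimes> p2 x \<otimes> inv b"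
    if "x \<in> M" "b \<in> carrier B" for x b
  proof -
    have "b \<otimes> x \<otimes> inv b = (b \<otimes> p1 x \<otimes> inv b) \<otimes> (b \<otimes> p2 x \<otimes> inv b)"
    proof -
      have c: "p1 x \<in> carrier B" "p2 x \<in> carrier B" using p12[OF that(1)] HB KB by simp_all
      have "b \<otimes> x \<otimes> inv b = b \<otimes> (p1 x \<otimes> p2 x) \<otimes> inv b" using p[OF that(1)] by simp
      then show ?thesis using c that(2) by (simp add: m_assoc mult_inv_mult)
    qed
    then show ?thesis
      using p_unique[of "b \<otimes> p1 x \<otimes> inv b" "b \<otimes> p2 x \<otimes> inv b"] nH.inv_op_closed2[OF that(2) p12(1)[OF that(1)]] nK.inv_op_closed2[OF that(2) p12(2)[OF that(1)]] by simp
  qed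
  define \<psi> where "\<psi> = inv_into H \<phi>"
  have \<psi>_iso: "\<psi> \<in> iso (?B K) (?B H)"
    using BH.iso_set_sym[OF iso] by (simp add: \<psi>_def)
  then have \<psi>: "\<psi> k \<in> H" "\<phi> (\<psi> k) = k" if "k \<in> K" for k
    using that \<phi>_image unfolding \<psi>_def by (auto simp: f_inv_into_f inv_into_into)
  have \<psi>\<phi>: "\<psi> (\<phi> h) = h" if "h \<in> H" for h using that \<phi>_inj by (simp add: \<psi>_def)
  have \<psi>_mult: "\<psi> (k \<otimes> k') = \<psi> k \<otimes> \<psi> k'" if "k \<in> K" "k' \<in> K" for k k'
    using hom_mult[OF iso_imp_homomorphism[OF \<psi>_iso], of k k'] that by simp
  have \<psi>_one: "k = \<one>" if "k \<in> K" "\<psi> k = \<one>" for k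
  proof -
    have "\<phi> (\<one> \<otimes> \<one>) = \<phi> \<one> \<otimes> \<phi> \<one>"  using \<phi>_mult[OF nH.one_closed nH.one_closed] .
    then have "\<phi> \<one> = \<one>" using \<phi>_carrier[of \<one>] by simp
    then show ?thesis using \<psi>(2)[OF that(1)] that(2) by simp
  qed
  define a1 where "a1 u h = u \<otimes> h \<otimes> inv u" for u h
  define a2 where "a2 u h = \<psi> (u \<otimes> \<phi> h \<otimes> inv u)" for u h
  have conj_mult: "u \<otimes> (x \<otimes> y) \<otimes> inv u = (u \<otimes> x \<otimes> inv u) \<otimes> (u \<otimes> y \<otimes> inv u)"
    if "u \<in> carrier B" "x \<in> carrier B" "y \<in> carrier B" for u x y
    using that by (simp add: m_assoc mult_inv_mult)
  have conj_conj: "(u \<otimes> v) \<otimes> x \<otimes> inv (u \<otimes> v) = u \<otimes> (v \<otimes> x \<otimes> inv v) \<otimes> inv u"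
    if "u \<in> carrier B" "v \<in> carrier B" "x \<in> carrier B" for u v x
    using that by (simp add: m_assoc inv_mult_group)
  have conj_one: "x = \<one>" if "u \<otimes> x \<otimes> inv u = \<one>" "u \<in> carrier B" "x \<in> carrier B" for u x
  proof -
    have "x = inv u \<otimes> (u \<otimes> x \<otimes> inv u) \<otimes> u" using that(2,3) by (simp add: m_assoc mult_inv_mult)
    then show ?thesis using that by simp
  qed
  have a1_closed: "a1 u h \<in> H" if "u \<in> carrier B" "h \<in> H" for u h
    using nH.inv_op_closed2[OF that] by (simp add: a1_def)
  have a2_K: "u \<otimes> \<phi> h \<otimes> inv u \<in> K" if "u \<in> carrier B" "h \<in> H" for u h
    using nK.inv_op_closed2[OF that(1) \<phi>_mem[OF that(2)]] .
  have a2_closed: "a2 u h \<in> H" if "u \<in> carrier B" "h \<in> H" for u h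
    using \<psi>(1) a2_K[OF that] by (simp add: a2_def)
  have a1_hom: "a1 u \<in> hom (?B H) (?B H)" if "u \<in> carrier B" for u
    by (rule homI) (use that a1_closed conj_mult HB in \<open>simp_all add: a1_def\<close>)
  have a2_hom: "a2 u \<in> hom (?B H) (?B H)" if u: "u \<in> carrier B" for u
  proof (rule homI)
    fix x y assume "x \<in> carrier (?B H)" "y \<in> carrier (?B H)"
    then have xy: "x \<in> H" "y \<in> H" by simp_all
    have "a2 u (x \<otimes> y) = \<psi> ((u \<otimes> \<phi> x \<otimes> inv u) \<otimes> (u \<otimes> \<phi> y \<otimes> inv u))"
      using \<phi>_mult[OF xy] conj_mult[OF u \<phi>_carrier[OF xy(1)] \<phi>_carrier[OF xy(2)]] by (simp add: a2_def)
    also have "\<dots> = a2 u x \<otimes> a2 u y" using \<psi>_mult a2_K[OF u] xy by (simp add: a2_def)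
    finally show "a2 u (x \<otimes>\<^bsub>?B H\<^esub> y) = a2 u x \<otimes>\<^bsub>?B H\<^esub> a2 u y" by simp
  qed (use a2_closed u in simp)
  have a12: "a1 u (a2 v h) = a2 v (a1 u h)" if "u \<in> carrier B" "v \<in> carrier B" "h \<in> H" for u v h
    using endomorphisms_of_finite_locally_cyclic_commute[OF subgroup_H fin lc a1_hom[OF that(1)] a2_hom[OF that(2)] that(3)] .
  have a1_a1: "a1 (u \<otimes> v) h = a1 u (a1 v h)" if "u \<in> carrier B" "v \<in> carrier B" "h \<in> H" for u v h
    using conj_conj that HB by (simp add: a1_def)
  have a2_a2: "a2 (u \<otimes> v) h = a2 u (a2 v h)" if "u \<in> carrier B" "v \<in> carrier B" "h \<in> H" for u v h
    using conj_conj[OF that(1,2) \<phi>_carrier[OF that(3)]] \<psi>(2)[OF a2_K[OF that(2,3)]] by (simp add: a2_def)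
  have M_central: "z \<otimes> x \<otimes> inv z = x" if "z \<in> M" "x \<in> H \<or> x \<in> K" for z x
  proof -
    have z: "p1 z \<in> H" "p2 z \<in> K" "z = p1 z \<otimes> p2 z" using p[OF that(1)] by blast+
    have xB: "x \<in> carrier B" using that(2) HB KB by blast
    have "z \<otimes> x = x \<otimes> z"
    proof -
      have "p2 z \<otimes> x = x \<otimes> p2 z" using that(2) HK_comm[of x "p2 z"] K_comm[of x "p2 z"] z by auto
      moreover have "p1 z \<otimes> x = x \<otimes> p1 z" using that(2) HK_comm[of "p1 z" x] H_comm[of x "p1 z"] z by auto
      ultimately have "p1 z \<otimes> p2 z \<otimes> x = x \<otimes> (p1 z \<otimes> p2 z)"
        using z HB KB xB by (metis m_assoc)
      then show ?thesis using z(3) by simp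
    qed
    then show ?thesis using xB that(1) by (simp add: m_assoc)
  qed
  \<comment> \<open>The group \<open>G\<close> is a copy of \<open>B/HK\<close>.\<close>
  have Mk: "M \<in> kernels B"
    by (rule kernels_upward[OF trivial_in_kernels[OF cB] _ M(1)]) (use M.one_closed in simp)
  obtain G f where G: "G \<in> C" "f \<in> epi B G" "M = {x \<in> carrier B. f x = \<one>\<^bsub>G\<^esub>}"
    using kernelsE[OF Mk] .
  interpret G: group G using member_group[OF G(1)] .
  interpret f: group_hom B G f
    using G(2) by (simp add: group_hom_def group_hom_axioms_def group_axioms G.group_axioms epi_def)
  have memM: "x \<in> M \<longleftrightarrow> f x = \<one>\<^bsub>G\<^esub>" if "x \<in> carrier B" for x
    by (subst G(3)) (simp add: that)
  have f_surj: "\<exists>u\<in>carrier B. f u = g" if "g \<in> carrier G" for g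
  proof -
    have "g \<in> f ` carrier B" using G(2) that by (simp add: epi_def)
    then obtain u where "u \<in> carrier B" "g = f u" by (rule imageE)
    then show ?thesis by (intro bexI[of _ u]) simp_all
  qed
  have f_eqD: "\<exists>z\<in>M. u = v \<otimes> z" if "f u = f v" "u \<in> carrier B" "v \<in> carrier B" for u v
  proof
    show "inv v \<otimes> u \<in> M" using that by (subst memM) simp_all
    show "u = v \<otimes> (inv v \<otimes> u)" using that(2,3) by (simp add: mult_inv_mult)
  qed
  have a1_cong: "a1 u h = a1 v h" if uv: "f u = f v" "u \<in> carrier B" "v \<in> carrier B" and h: "h \<in> H" for u v h
  proof -
    obtain z where z: "z \<in> M" "u = v \<otimes> z" using f_eqD[OF uv] by blast
    then show ?thesis using a1_a1[of v z h] M_central[OF z(1), of h] uv h M.mem_carrier by (simp add: a1_def)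
  qed
  have a2_cong: "a2 u h = a2 v h" if uv: "f u = f v" "u \<in> carrier B" "v \<in> carrier B" and h: "h \<in> H" for u v h
  proof -
    obtain z where z: "z \<in> M" "u = v \<otimes> z" using f_eqD[OF uv] by blast
    have "a2 z h = h" using M_central[OF z(1), of "\<phi> h"] \<phi>_mem[OF h] \<psi>\<phi>[OF h] by (simp add: a2_def)
    then show ?thesis using a2_a2[of v z h] z uv h M.mem_carrier by simp
  qed
  obtain A a where A: "A \<in> C" "comm_group A" "a \<in> carrier A" "a \<noteq> \<one>\<^bsub>A\<^esub>"
    using ex_nontrivial_comm_group .
  interpret A: comm_group A using A(2) .
  obtain lev where lev: "lev \<in> hom E A" "\<And>b. b \<in> carrier B \<Longrightarrow> lev (\<iota> b) = \<one>\<^bsub>A\<^esub>" "lev t = a"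
    using ex_exponent_hom[OF A.group_axioms A(3)] by blast
  interpret lev: group_hom E A lev
    using lev(1) by (simp add: group_hom_def group_hom_axioms_def E.group_axioms A.group_axioms)
  have lev_base: "lev (e \<cdot> \<iota> b) = lev e" if "e \<in> carrier E" "b \<in> carrier B" for e b
    using that by (simp add: lev(2))
  have lev_t: "lev (e \<cdot> t) = lev e \<otimes>\<^bsub>A\<^esub> a" if "e \<in> carrier E" for e
    using that by (simp add: lev(3))
  define T0 where "T0 = {x \<in> carrier E. lev x = \<one>\<^bsub>A\<^esub>}"
  have T0: "T0 \<in> kernels E"
    by (rule kernelsI_hom[OF E.group_axioms in_class_member[OF A(1)] lev(1) T0_def])
  have f_HK: "f x = \<one>\<^bsub>G\<^esub>" if "x \<in> H \<or> x \<in> K" for x using that M(2,3) memM HB KB by blast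
  have cocycles: "\<exists>\<mu>. cocycle G \<mu> \<and>
      (\<forall>x\<in>carrier E. \<forall>b\<in>carrier B. \<mu> x (\<iota> b) = (if lev x = c then f b else \<one>\<^bsub>G\<^esub>)) \<and>
      (\<forall>x\<in>carrier E. \<mu> x t = \<one>\<^bsub>G\<^esub>)" for c
  proof -
    obtain \<mu> where "cocycle G \<mu>" "\<And>x b. x \<in> carrier E \<Longrightarrow> b \<in> carrier B \<Longrightarrow> \<mu> x (\<iota> b) = (if lev x = c then f b else \<one>\<^bsub>G\<^esub>)"
      "\<And>x. x \<in> carrier E \<Longrightarrow> \<mu> x t = \<one>\<^bsub>G\<^esub>"
      by (rule ex_cocycle[OF G.group_axioms, where \<beta> = "\<lambda>x b. if lev x = c then f b else \<one>\<^bsub>G\<^esub>" and \<sigma> = "\<lambda>_. \<one>\<^bsub>G\<^esub>"])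
        (use f_HK \<phi>_mem lev_base in auto)
    then show ?thesis by blast
  qed
  have cocycle_kernels: "\<exists>T\<in>kernels E. T \<subseteq> {y \<in> T0. \<mu> \<one>\<^sub>E y = \<one>\<^bsub>G\<^esub>} \<and>
      (\<forall>y\<in>T. \<forall>x\<in>carrier E. \<mu> \<one>\<^sub>E (y \<cdot> x) = \<mu> \<one>\<^sub>E x)"
    if \<mu>: "cocycle G \<mu> \<and>
      (\<forall>x\<in>carrier E. \<forall>b\<in>carrier B. \<mu> x (\<iota> b) = (if lev x = c then f b else \<one>\<^bsub>G\<^esub>)) \<and>
      (\<forall>x\<in>carrier E. \<mu> x t = \<one>\<^bsub>G\<^esub>)" for \<mu> c
  proof -
    have inv: "\<mu> (y \<cdot> x) (\<iota> b) = \<mu> x (\<iota> b)" "\<mu> (y \<cdot> x) t = \<mu> x t"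
      if "y \<in> T0" "x \<in> carrier E" "b \<in> carrier B" for x y b
      using that \<mu> by (simp_all add: T0_def)
    obtain T where T: "T \<in> kernels E" "T \<subseteq> {y \<in> T0. \<mu> \<one>\<^sub>E y = \<one>\<^bsub>G\<^esub>}"
      using cocycle_kernel[OF in_class_member[OF G(1)] _ T0, of \<mu>] \<mu> inv by blast
    have "\<mu> \<one>\<^sub>E (y \<cdot> x) = \<mu> \<one>\<^sub>E x" if y: "y \<in> T" and x: "x \<in> carrier E" for y x
    proof -
      have y': "y \<in> T0" "y \<in> carrier E" "\<mu> \<one>\<^sub>E y = \<one>\<^bsub>G\<^esub>" using T(2) y by (auto simp: T0_def)
      have "\<mu> (y \<cdot> \<one>\<^sub>E) x = \<mu> \<one>\<^sub>E x"
        by (rule cocycle_invariant[OF G.group_axioms _ y'(2)]) (use \<mu> inv y' x in \<open>auto simp: T0_def\<close>)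
      then show ?thesis
        using \<mu> y' x cocycle_closed[of G \<mu> "\<one>\<^sub>E" x] cocycle_mult[of G \<mu> "\<one>\<^sub>E" y x] by simp
    qed
    then show ?thesis using T by blast
  qed
  obtain \<mu>1 where \<mu>1: "cocycle G \<mu>1 \<and>
      (\<forall>x\<in>carrier E. \<forall>b\<in>carrier B. \<mu>1 x (\<iota> b) = (if lev x = \<one>\<^bsub>A\<^esub> then f b else \<one>\<^bsub>G\<^esub>)) \<and>
      (\<forall>x\<in>carrier E. \<mu>1 x t = \<one>\<^bsub>G\<^esub>)" using cocycles by blast
  obtain \<mu>2 where \<mu>2: "cocycle G \<mu>2 \<and>
      (\<forall>x\<in>carrier E. \<forall>b\<in>carrier B. \<mu>2 x (\<iota> b) = (if lev x = a then f b else \<one>\<^bsub>G\<^esub>)) \<and>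
      (\<forall>x\<in>carrier E. \<mu>2 x t = \<one>\<^bsub>G\<^esub>)" using cocycles by blast
  have c1: "cocycle G \<mu>1" and c2: "cocycle G \<mu>2" using \<mu>1 \<mu>2 by blast+
  obtain T1 where T1: "T1 \<in> kernels E" "T1 \<subseteq> T0"
      "\<And>y x. y \<in> T1 \<Longrightarrow> x \<in> carrier E \<Longrightarrow> \<mu>1 \<one>\<^sub>E (y \<cdot> x) = \<mu>1 \<one>\<^sub>E x"
    using cocycle_kernels[OF \<mu>1] by blast
  obtain T2 where T2: "T2 \<in> kernels E"
      "\<And>y x. y \<in> T2 \<Longrightarrow> x \<in> carrier E \<Longrightarrow> \<mu>2 \<one>\<^sub>E (y \<cdot> x) = \<mu>2 \<one>\<^sub>E x"
    using cocycle_kernels[OF \<mu>2] by blast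
  obtain T3 where T3: "T3 \<in> kernels E" "\<forall>b\<in>carrier B. \<iota> b \<in> T3 \<longleftrightarrow> b \<in> M"
    using kernel_containing_associated_subgroups[OF Mk M(2,3)] by blast
  define Y where "Y = T1 \<inter> T2 \<inter> T3"
  have Y: "Y \<in> kernels E" unfolding Y_def
    by (intro kernels_Int[OF small_E] T1(1) T2(1) T3(1))
  define N where "N = {b \<in> carrier B. \<iota> b \<in> Y}"
  have NM: "n \<in> M" if "n \<in> N" for n using that T3(2) by (auto simp: N_def Y_def)
  have NB: "n \<in> carrier B" if "n \<in> N" for n using that by (simp add: N_def)
  have "\<exists>u. \<forall>e\<in>carrier E. u e \<in> carrier B \<and> f (u e) = \<mu>1 \<one>\<^sub>E e"
    using f_surj cocycle_closed[OF c1 E.one_closed] by (intro bchoice) blast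
  then obtain u where u: "\<And>e. e \<in> carrier E \<Longrightarrow> u e \<in> carrier B \<and> f (u e) = \<mu>1 \<one>\<^sub>E e" by blast
  have "\<exists>v. \<forall>e\<in>carrier E. v e \<in> carrier B \<and> f (v e) = \<mu>2 \<one>\<^sub>E e"
    using f_surj cocycle_closed[OF c2 E.one_closed] by (intro bchoice) blast
  then obtain v where v: "\<And>e. e \<in> carrier E \<Longrightarrow> v e \<in> carrier B \<and> f (v e) = \<mu>2 \<one>\<^sub>E e" by blast
  \<comment> \<open>Here \<open>u e\<close> and \<open>v e\<close> are preimages in \<open>B\<close> of the values of the two cocycles.\<close>
  define \<alpha> where "\<alpha> e h = a1 (u e) (a2 (v e) h)" for e h
  have \<alpha>_closed: "\<alpha> e h \<in> H" if "e \<in> carrier E" "h \<in> H" for e h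
    using a1_closed a2_closed u v that by (simp add: \<alpha>_def)
  have \<alpha>_mult: "\<alpha> e (h \<otimes> h') = \<alpha> e h \<otimes> \<alpha> e h'" if "e \<in> carrier E" "h \<in> H" "h' \<in> H" for e h h'
    using hom_mult[OF a2_hom, of "v e" h h'] hom_mult[OF a1_hom, of "u e" "a2 (v e) h" "a2 (v e) h'"]
      u[OF that(1)] v[OF that(1)] that a2_closed by (simp add: \<alpha>_def)
  have \<alpha>_one: "h = \<one>" if e: "e \<in> carrier E" and h: "h \<in> H" and eq: "\<alpha> e h = \<one>" for e h
  proof -
    have uv: "u e \<in> carrier B" "v e \<in> carrier B" using u v e by blast+
    have "a2 (v e) h = \<one>"
      using conj_one[OF _ uv(1) HB[OF a2_closed[OF uv(2) h]]] eq by (simp add: \<alpha>_def a1_def)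
    then have "v e \<otimes> \<phi> h \<otimes> inv (v e) = \<one>" using \<psi>_one a2_K[OF uv(2) h] by (simp add: a2_def)
    then have "\<phi> h = \<one>" using conj_one uv(2) \<phi>_carrier[OF h] by blast
    then have "\<phi> h \<in> K" "h = \<psi> \<one>" using \<psi>\<phi>[OF h] \<phi>_mem[OF h] by simp_all
    moreover have "\<psi> \<one> = \<one>"
      using \<psi>_mult[of \<one> \<one>] HB[OF \<psi>(1)[of \<one>]] by simp
    ultimately show ?thesis by simp
  qed
  have \<alpha>_t: "\<alpha> (e \<cdot> t) h = \<alpha> e h" if e: "e \<in> carrier E" and h: "h \<in> H" for e h
  proof -
    have "\<mu>1 \<one>\<^sub>E (e \<cdot> t) = \<mu>1 \<one>\<^sub>E e" "\<mu>2 \<one>\<^sub>E (e \<cdot> t) = \<mu>2 \<one>\<^sub>E e"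
      using \<mu>1 \<mu>2 e cocycle_closed[OF c1, of "\<one>\<^sub>E" e] cocycle_closed[OF c2, of "\<one>\<^sub>E" e] by (simp_all add: cocycle_mult[OF c1] cocycle_mult[OF c2])
    then have "f (u (e \<cdot> t)) = f (u e)" "f (v (e \<cdot> t)) = f (v e)" using u v e by simp_all
    then show ?thesis
      using a1_cong[of "u (e \<cdot> t)" "u e"] a2_cong[of "v (e \<cdot> t)" "v e" h] u v e h a2_closed
      by (simp add: \<alpha>_def)
  qed
  have \<alpha>_Y: "\<alpha> (y \<cdot> e) h = \<alpha> e h" if y: "y \<in> Y" and e: "e \<in> carrier E" and h: "h \<in> H" for y e h
  proof -
    have yE: "y \<in> carrier E" using y T1(2) by (auto simp: Y_def T0_def)
    have "f (u (y \<cdot> e)) = f (u e)" "f (v (y \<cdot> e)) = f (v e)"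
      using u v e yE T1(3)[of y e] T2(2)[of y e] y by (simp_all add: Y_def)
    then show ?thesis
      using a1_cong[of "u (y \<cdot> e)" "u e"] a2_cong[of "v (y \<cdot> e)" "v e" h] u v e yE h a2_closed
      by (simp add: \<alpha>_def)
  qed
  have \<alpha>_base1: "\<alpha> (e \<cdot> \<iota> b) h = \<alpha> e (a1 b h)"
    if e: "e \<in> carrier E" "lev e = \<one>\<^bsub>A\<^esub>" and b: "b \<in> carrier B" and h: "h \<in> H" for e b h
  proof -
    have eb: "e \<cdot> \<iota> b \<in> carrier E" using e b by simp
    have "\<mu>1 \<one>\<^sub>E (e \<cdot> \<iota> b) = \<mu>1 \<one>\<^sub>E e \<otimes>\<^bsub>G\<^esub> f b" "\<mu>2 \<one>\<^sub>E (e \<cdot> \<iota> b) = \<mu>2 \<one>\<^sub>E e"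
      using \<mu>1 \<mu>2 e b A(4) cocycle_closed[OF c1, of "\<one>\<^sub>E" e] cocycle_closed[OF c2, of "\<one>\<^sub>E" e] by (simp_all add: cocycle_mult[OF c1] cocycle_mult[OF c2])
    then have "f (u (e \<cdot> \<iota> b)) = f (u e \<otimes> b)" "f (v (e \<cdot> \<iota> b)) = f (v e)"
      using u[OF e(1)] v[OF e(1)] u[OF eb] v[OF eb] b by simp_all
    then have "\<alpha> (e \<cdot> \<iota> b) h = a1 (u e \<otimes> b) (a2 (v e) h)"
      using a1_cong[of "u (e \<cdot> \<iota> b)" "u e \<otimes> b"] a2_cong[of "v (e \<cdot> \<iota> b)" "v e" h]
        u[OF e(1)] v[OF e(1)] u[OF eb] v[OF eb] b h a2_closed by (simp add: \<alpha>_def)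
    also have "\<dots> = \<alpha> e (a1 b h)"
      using a1_a1 a12 u[OF e(1)] v[OF e(1)] b h a1_closed a2_closed by (simp add: \<alpha>_def)
    finally show ?thesis .
  qed
  have \<alpha>_base2: "\<alpha> (e \<cdot> \<iota> b) h = \<alpha> e (a2 b h)"
    if e: "e \<in> carrier E" "lev e = a" and b: "b \<in> carrier B" and h: "h \<in> H" for e b h
  proof -
    have eb: "e \<cdot> \<iota> b \<in> carrier E" using e b by simp
    have "\<mu>2 \<one>\<^sub>E (e \<cdot> \<iota> b) = \<mu>2 \<one>\<^sub>E e \<otimes>\<^bsub>G\<^esub> f b" "\<mu>1 \<one>\<^sub>E (e \<cdot> \<iota> b) = \<mu>1 \<one>\<^sub>E e"
      using \<mu>1 \<mu>2 e b A(4) cocycle_closed[OF c1, of "\<one>\<^sub>E" e] cocycle_closed[OF c2, of "\<one>\<^sub>E" e] by (simp_all add: cocycle_mult[OF c1] cocycle_mult[OF c2])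
    then have "f (v (e \<cdot> \<iota> b)) = f (v e \<otimes> b)" "f (u (e \<cdot> \<iota> b)) = f (u e)"
      using u[OF e(1)] v[OF e(1)] u[OF eb] v[OF eb] b by simp_all
    then have "\<alpha> (e \<cdot> \<iota> b) h = a1 (u e) (a2 (v e \<otimes> b) h)"
      using a1_cong[of "u (e \<cdot> \<iota> b)" "u e"] a2_cong[of "v (e \<cdot> \<iota> b)" "v e \<otimes> b" h]
        u[OF e(1)] v[OF e(1)] u[OF eb] v[OF eb] b h a2_closed by (simp add: \<alpha>_def)
    also have "\<dots> = \<alpha> e (a2 b h)"
      using a2_a2 v[OF e(1)] b h by (simp add: \<alpha>_def)
    finally show ?thesis .
  qed
  define \<theta> where "\<theta> e n = (if lev e = \<one>\<^bsub>A\<^esub> then \<alpha> e (p1 n) else if lev e = a then \<alpha> e (\<psi> (p2 n)) else \<one>)" for e n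
  have pN: "p1 n \<in> H" "p2 n \<in> K" if "n \<in> N" for n using p[OF NM[OF that]] by blast+
  have p_N: "p1 (n \<otimes> n') = p1 n \<otimes> p1 n'" "p2 (n \<otimes> n') = p2 n \<otimes> p2 n'" if "n \<in> N" "n' \<in> N" for n n'
    using p_mult[OF NM[OF that(1)] NM[OF that(2)]] by blast+
  have p_H: "p1 h = h \<and> p2 h = \<one>" if "h \<in> H" for h
    using p_unique[OF that nK.one_closed] HB[OF that] by simp
  have p_K: "p1 k = \<one> \<and> p2 k = k" if "k \<in> K" for k
    using p_unique[OF nH.one_closed that] KB[OF that] by simp
  have \<alpha>1: "\<alpha> e \<one> = \<one>" if "e \<in> carrier E" for e
    using \<alpha>_mult[OF that nH.one_closed nH.one_closed] HB[OF \<alpha>_closed[OF that nH.one_closed]] by simp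
  have \<psi>1: "\<psi> \<one> = \<one>" using \<psi>_mult[of \<one> \<one>] HB[OF \<psi>(1)[of \<one>]] by simp
  have "\<exists>T\<in>kernels E. T \<subseteq> Y \<and> (\<forall>n\<in>N. \<iota> n \<in> T \<longrightarrow> \<theta> \<one>\<^sub>E n = \<one>\<^bsub>?B H\<^esub>)"
  proof (rule extend_vertex_homs[OF BH.comm_group_axioms in_class_subgroup[OF cB subgroup_H] Y N_def])
    fix e assume e: "e \<in> carrier E"
    show "\<theta> e \<in> hom (?B N) (?B H)"
      by (rule homI)
        (use pN p_N \<psi>(1) \<psi>_mult \<alpha>_closed[OF e] \<alpha>_mult[OF e] in \<open>auto simp: \<theta>_def\<close>)
  next
    fix e b n assume *: "e \<in> carrier E" "b \<in> carrier B" "n \<in> N"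
    have "a2 b (\<psi> (p2 n)) = \<psi> (p2 (b \<otimes> n \<otimes> inv b))" "a1 b (p1 n) = p1 (b \<otimes> n \<otimes> inv b)"
      using p_conj[OF NM[OF *(3)] *(2)] \<psi>(2)[OF pN(2)[OF *(3)]] by (simp_all add: a1_def a2_def)
    then show "\<theta> (e \<cdot> \<iota> b) n = \<theta> e (b \<otimes> n \<otimes> inv b)"
      unfolding \<theta>_def lev_base[OF *(1,2)]
      using * \<alpha>_base1[OF *(1) _ *(2) pN(1)[OF *(3)]] \<alpha>_base2[OF *(1) _ *(2) \<psi>(1)[OF pN(2)[OF *(3)]]]
      by simp
  next
    fix e h assume *: "e \<in> carrier E" "h \<in> H" "h \<in> N"
    have et: "e \<cdot> t \<in> carrier E" using * by simp
    have le: "lev e \<in> carrier A" using * by simp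
    have "lev (e \<cdot> t) = a \<longleftrightarrow> lev e = \<one>\<^bsub>A\<^esub>"
      unfolding lev_t[OF *(1)] using le A(3) by simp
    moreover have "lev (e \<cdot> t) = \<one>\<^bsub>A\<^esub> \<Longrightarrow> lev e \<noteq> \<one>\<^bsub>A\<^esub>"
      using lev_t[OF *(1)] A(3,4) by auto
    ultimately show "\<theta> (e \<cdot> t) (\<phi> h) = \<theta> e h"
      unfolding \<theta>_def using p_K[OF \<phi>_mem[OF *(2)]] p_H[OF *(2)] \<psi>\<phi>[OF *(2)] \<alpha>_t[OF *(1,2)] \<alpha>1[OF et] \<alpha>1[OF *(1)] \<psi>1 A(4)
      by (simp split: if_split)
  next
    fix y e n assume *: "y \<in> Y" "e \<in> carrier E" "n \<in> N"
    have "lev y = \<one>\<^bsub>A\<^esub>" "y \<in> carrier E" using *(1) T1(2) by (auto simp: Y_def T0_def)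
    then show "\<theta> (y \<cdot> e) n = \<theta> e n"
      using * \<alpha>_Y[OF *(1,2)] pN[OF *(3)] \<psi>(1) by (simp add: \<theta>_def)
  qed
  then obtain T where T: "T \<in> kernels E" "T \<subseteq> Y" "\<And>n. n \<in> N \<Longrightarrow> \<iota> n \<in> T \<Longrightarrow> \<theta> \<one>\<^sub>E n = \<one>" by auto
  interpret T: normal T E using kernelsD(1)[OF T(1)] .
  have T_p1: "p1 n = \<one>" if n: "n \<in> carrier B" "\<iota> n \<in> T" for n
  proof -
    have nN: "n \<in> N" using n T(2) by (auto simp: N_def)
    then show ?thesis using T(3)[OF nN n(2)] \<alpha>_one[OF E.one_closed pN(1)[OF nN]] by (simp add: \<theta>_def)
  qed
  \<comment> \<open>So far \<open>x \<in> T \<inter> HK\<close> implies \<open>p1 x = 1\<close>.  Conjugation by \<open>t\<close> takes the remaining part, in \<open>K\<close>, to \<open>H\<close>.\<close>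
  have "x = \<one>" if x: "x \<in> M" "\<iota> x \<in> T" for x
  proof -
    have xB: "x \<in> carrier B" using x by simp
    have "x = p1 x \<otimes> p2 x" using p[OF x(1)] by blast
    also have "\<dots> = p2 x" using T_p1[OF xB x(2)] KB[OF p12(2)[OF x(1)]] by simp
    finally have "p2 x = x" ..
    then have xK: "x \<in> K" using p12(2)[OF x(1)] by simp
    define h where "h = \<psi> x"
    have h: "h \<in> H" "x = \<phi> h" "h \<in> carrier B" using \<psi>[OF xK] HB by (simp_all add: h_def)
    have "t \<cdot> \<iota> x \<cdot> inv\<^sub>E t = \<iota> h"
      using t_swap[OF h(1)] h by (simp add: E.m_assoc flip: t_swap[OF h(1)])
    then have "\<iota> h \<in> T" using T.inv_op_closed2[OF t_closed x(2)] by simp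
    then have "h = \<one>" using T_p1[OF h(3)] p_H[OF h(1)] by simp
    then show ?thesis using \<psi>_one[OF xK] h_def by simp
  qed
  then show ?thesis using T(1) M_def by blast
qed

end

section \<open>The action on the intersection of the associated subgroups\<close>

lemma carrier_AutoGroup: "carrier (AutoGroup G) = auto G"
  by (simp add: AutoGroup_def)

lemma AutoGroup_mult:
  "\<alpha> \<in> auto G \<Longrightarrow> \<beta> \<in> auto G \<Longrightarrow> \<alpha> \<otimes>\<^bsub>AutoGroup G\<^esub> \<beta> = compose (carrier G) \<alpha> \<beta>"
  by (simp add: AutoGroup_def BijGroup_def auto_def)

lemma AutoGroup_one: "\<one>\<^bsub>AutoGroup G\<^esub> = (\<lambda>x\<in>carrier G. x)"
  by (simp add: AutoGroup_def BijGroup_def)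

lemma auto_closed: "\<alpha> \<in> auto G \<Longrightarrow> x \<in> carrier G \<Longrightarrow> \<alpha> x \<in> carrier G"
  by (auto simp: auto_def hom_def)

lemma AutoGroup_mult_apply:
  "\<alpha> \<in> auto G \<Longrightarrow> \<beta> \<in> auto G \<Longrightarrow> x \<in> carrier G \<Longrightarrow> (\<alpha> \<otimes>\<^bsub>AutoGroup G\<^esub> \<beta>) x = \<alpha> (\<beta> x)"
  by (simp add: AutoGroup_mult compose_def)

lemma auto_eqI:
  "\<alpha> \<in> auto G \<Longrightarrow> \<beta> \<in> auto G \<Longrightarrow> (\<And>x. x \<in> carrier G \<Longrightarrow> \<alpha> x = \<beta> x) \<Longrightarrow> \<alpha> = \<beta>"
  by (auto simp: auto_def Bij_def intro: extensionalityI)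

lemma (in group) comm_AutoGroup_of_finite_locally_cyclic:
  assumes "subgroup M G" "finite M" "locally_cyclic_in G M"
  shows "comm_group (AutoGroup (G\<lparr>carrier := M\<rparr>))"
proof -
  let ?M = "G\<lparr>carrier := M\<rparr>"
  interpret M: group ?M using assms(1) by (rule subgroup.subgroup_is_group) (rule group_axioms)
  interpret \<Gamma>: group "AutoGroup ?M" by (rule M.AutoGroup)
  show ?thesis
  proof (rule \<Gamma>.group_comm_groupI)
    fix \<alpha> \<beta> assume "\<alpha> \<in> carrier (AutoGroup ?M)" "\<beta> \<in> carrier (AutoGroup ?M)"
    then have ab: "\<alpha> \<in> auto ?M" "\<beta> \<in> auto ?M" by (simp_all add: carrier_AutoGroup)
    then have h: "\<alpha> \<in> hom ?M ?M" "\<beta> \<in> hom ?M ?M" by (simp_all add: auto_def)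
    show "\<alpha> \<otimes>\<^bsub>AutoGroup ?M\<^esub> \<beta> = \<beta> \<otimes>\<^bsub>AutoGroup ?M\<^esub> \<alpha>"
      using endomorphisms_of_finite_locally_cyclic_commute[OF assms h]
      by (simp add: AutoGroup_mult ab compose_def cong: restrict_cong)
  qed
qed

locale hnn_normal = hnn +
  assumes normal_H: "H \<lhd> B" and normal_K: "K \<lhd> B" and \<phi>_Int: "\<phi> ` (H \<inter> K) = H \<inter> K"
begin

abbreviation L where "L \<equiv> H \<inter> K"

abbreviation \<Gamma> where "\<Gamma> \<equiv> AutoGroup (B\<lparr>carrier := L\<rparr>)"

lemma normal_L: "L \<lhd> B"
  by (rule normal_subgroup_intersect[OF normal_H normal_K])

lemma subgroup_L: "subgroup L B"
  using normal_imp_subgroup[OF normal_L] .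

lemma group_L: "group (B\<lparr>carrier := L\<rparr>)"
  using subgroup.subgroup_is_group[OF subgroup_L group_axioms] .

lemma group_\<Gamma>: "group \<Gamma>"
  using group.AutoGroup[OF group_L] .

lemma \<phi>_L: "x \<in> L \<Longrightarrow> \<phi> x \<in> L"
  using \<phi>_Int by blast

lemma restrict_\<phi>_auto: "restrict \<phi> L \<in> auto (B\<lparr>carrier := L\<rparr>)"
proof -
  have "bij_betw \<phi> L L"
    using \<phi>_inj \<phi>_Int by (auto simp: bij_betw_def intro: inj_on_subset)
  then have "bij_betw (restrict \<phi> L) L L" by (subst bij_betw_cong[of L _ \<phi>]) auto
  moreover have "restrict \<phi> L \<in> hom (B\<lparr>carrier := L\<rparr>) (B\<lparr>carrier := L\<rparr>)"
    by (rule homI) (use \<phi>_L \<phi>_mult subgroup.m_closed[OF subgroup_L] in auto)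
  ultimately show ?thesis by (simp add: auto_def Bij_def)
qed

lemma conj_auto:
  assumes "b \<in> carrier B"
  shows "(\<lambda>x\<in>L. b \<otimes> x \<otimes> inv b) \<in> auto (B\<lparr>carrier := L\<rparr>)"
proof -
  interpret L: normal L B by (rule normal_L)
  have LB: "x \<in> carrier B" if "x \<in> L" for x using that L.subset by blast
  have c: "b \<otimes> x \<otimes> inv b \<in> L" if "x \<in> L" "b \<in> carrier B" for x b using L.inv_op_closed2[OF that(2,1)] .
  have "bij_betw (\<lambda>x\<in>L. b \<otimes> x \<otimes> inv b) L L"
    by (rule bij_betwI[where g = "\<lambda>x. inv b \<otimes> x \<otimes> inv (inv b)"])
      (use c[OF _ assms] c[OF _ inv_closed[OF assms]] LB assms in \<open>auto simp: m_assoc mult_inv_mult\<close>)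
  moreover have "(\<lambda>x\<in>L. b \<otimes> x \<otimes> inv b) \<in> hom (B\<lparr>carrier := L\<rparr>) (B\<lparr>carrier := L\<rparr>)"
  proof (rule homI)
    fix x y assume "x \<in> carrier (B\<lparr>carrier := L\<rparr>)" "y \<in> carrier (B\<lparr>carrier := L\<rparr>)"
    then have xy: "x \<in> L" "y \<in> L" by simp_all
    then show "(\<lambda>x\<in>L. b \<otimes> x \<otimes> inv b) (x \<otimes>\<^bsub>B\<lparr>carrier := L\<rparr>\<^esub> y) =
        (\<lambda>x\<in>L. b \<otimes> x \<otimes> inv b) x \<otimes>\<^bsub>B\<lparr>carrier := L\<rparr>\<^esub> (\<lambda>x\<in>L. b \<otimes> x \<otimes> inv b) y"
      using LB[OF xy(1)] LB[OF xy(2)] L.m_closed[OF xy] assms by (simp add: m_assoc mult_inv_mult)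
  qed (use c assms in simp)
  ultimately show ?thesis by (simp add: auto_def Bij_def)
qed

text \<open>
  Since \<open>L\<phi> = L\<close>, the subgroup \<open>L\<close> is normal in \<open>E\<close>.  The action of \<open>E\<close> on it by conjugation is obtained from the universal
  property.  As automorphisms are composed from right to left, \<open>P e\<close> is \<open>x \<mapsto> e x e\<^sup>-\<^sup>1\<close>, and \<open>t\<close> acts as the
  inverse of \<open>\<phi>\<close>.
\<close>

lemma ex_conjugation_action:
  obtains P where "P \<in> hom E \<Gamma>"
    "\<And>b. b \<in> carrier B \<Longrightarrow> P (\<iota> b) = (\<lambda>x\<in>L. b \<otimes> x \<otimes> inv b)"
    "P t = inv\<^bsub>\<Gamma>\<^esub> (restrict \<phi> L)"
    "\<And>e x. e \<in> carrier E \<Longrightarrow> x \<in> L \<Longrightarrow> P e x \<in> L"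
    "\<And>e x. e \<in> carrier E \<Longrightarrow> x \<in> L \<Longrightarrow> e \<cdot> \<iota> x = \<iota> (P e x) \<cdot> e"
proof -
  interpret L: normal L B by (rule normal_L)
  interpret \<Gamma>: group \<Gamma> by (rule group_\<Gamma>)
  have LB: "x \<in> carrier B" if "x \<in> L" for x using that L.subset by blast
  define f where "f b = (\<lambda>x\<in>L. b \<otimes> x \<otimes> inv b)" for b
  define \<rho> where "\<rho> = restrict \<phi> L"
  define \<tau> where "\<tau> = inv\<^bsub>\<Gamma>\<^esub> \<rho>"
  have f_auto: "f b \<in> auto (B\<lparr>carrier := L\<rparr>)" if "b \<in> carrier B" for b
    using conj_auto[OF that] by (simp add: f_def)
  have \<rho>_auto: "\<rho> \<in> auto (B\<lparr>carrier := L\<rparr>)" using restrict_\<phi>_auto by (simp add: \<rho>_def)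
  then have \<rho>: "\<rho> \<in> carrier \<Gamma>" by (simp add: carrier_AutoGroup)
  then have \<tau>: "\<tau> \<in> carrier \<Gamma>" by (simp add: \<tau>_def)
  then have \<tau>_auto: "\<tau> \<in> auto (B\<lparr>carrier := L\<rparr>)" by (simp add: carrier_AutoGroup)
  have \<phi>\<tau>: "\<tau> x \<in> L" "\<phi> (\<tau> x) = x" if x: "x \<in> L" for x
  proof -
    show "\<tau> x \<in> L" using auto_closed[OF \<tau>_auto, of x] x by simp
    then have "\<phi> (\<tau> x) = (\<rho> \<otimes>\<^bsub>\<Gamma>\<^esub> \<tau>) x"
      using AutoGroup_mult_apply[OF \<rho>_auto \<tau>_auto, of x] x by (simp add: \<rho>_def)
    also have "\<rho> \<otimes>\<^bsub>\<Gamma>\<^esub> \<tau> = \<one>\<^bsub>\<Gamma>\<^esub>" using \<rho> by (simp add: \<tau>_def)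
    finally show "\<phi> (\<tau> x) = x" using x by (simp add: AutoGroup_one)
  qed
  have f: "f \<in> hom B \<Gamma>"
  proof (rule homI)
    fix a b assume ab: "a \<in> carrier B" "b \<in> carrier B"
    show "f (a \<otimes> b) = f a \<otimes>\<^bsub>\<Gamma>\<^esub> f b"
    proof (rule auto_eqI[OF f_auto])
      show "f a \<otimes>\<^bsub>\<Gamma>\<^esub> f b \<in> auto (B\<lparr>carrier := L\<rparr>)"
        using \<Gamma>.m_closed[of "f a" "f b"] f_auto ab by (simp add: carrier_AutoGroup)
      fix x assume "x \<in> carrier (B\<lparr>carrier := L\<rparr>)"
      then have x: "x \<in> L" by simp
      have "b \<otimes> x \<otimes> inv b \<in> L" using L.inv_op_closed2[OF ab(2) x] .
      then show "f (a \<otimes> b) x = (f a \<otimes>\<^bsub>\<Gamma>\<^esub> f b) x"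
        using AutoGroup_mult_apply[OF f_auto[OF ab(1)] f_auto[OF ab(2)], of x] x ab LB[OF x]
        by (simp add: f_def m_assoc inv_mult_group)
    qed (use ab in simp)
  qed (use f_auto in \<open>simp add: carrier_AutoGroup\<close>)
  have rel: "f h \<otimes>\<^bsub>\<Gamma>\<^esub> \<tau> = \<tau> \<otimes>\<^bsub>\<Gamma>\<^esub> f (\<phi> h)" if h: "h \<in> H" for h
  proof -
    have hB: "h \<in> carrier B" "\<phi> h \<in> carrier B" using h H_subset \<phi>_carrier by auto
    have fc: "f h \<in> carrier \<Gamma>" "f (\<phi> h) \<in> carrier \<Gamma>" using f_auto hB by (simp_all add: carrier_AutoGroup)
    have "\<rho> \<otimes>\<^bsub>\<Gamma>\<^esub> f h = f (\<phi> h) \<otimes>\<^bsub>\<Gamma>\<^esub> \<rho>"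
    proof (rule auto_eqI)
      show "\<rho> \<otimes>\<^bsub>\<Gamma>\<^esub> f h \<in> auto (B\<lparr>carrier := L\<rparr>)" "f (\<phi> h) \<otimes>\<^bsub>\<Gamma>\<^esub> \<rho> \<in> auto (B\<lparr>carrier := L\<rparr>)"
        using \<Gamma>.m_closed \<rho> fc by (simp_all flip: carrier_AutoGroup)
      fix x assume "x \<in> carrier (B\<lparr>carrier := L\<rparr>)"
      then have x: "x \<in> L" "x \<in> H" by simp_all
      have "inv h \<in> H" "h \<otimes> x \<in> H" using h x subgroup_H by (simp_all add: subgroup.m_closed subgroup.m_inv_closed)
      then have "\<phi> (h \<otimes> x \<otimes> inv h) \<otimes> \<phi> h = \<phi> (h \<otimes> x)"
        using h x hB(1) LB[OF x(1)] subgroup.m_closed[OF subgroup_H] by (simp add: m_assoc flip: \<phi>_mult)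
      then have "\<phi> (h \<otimes> x \<otimes> inv h) \<otimes> \<phi> h = \<phi> h \<otimes> \<phi> x" using \<phi>_mult[OF h x(2)] by simp
      moreover have c: "h \<otimes> x \<otimes> inv h \<in> L" using L.inv_op_closed2[OF hB(1) x(1)] .
      ultimately have "\<phi> (h \<otimes> x \<otimes> inv h) = \<phi> h \<otimes> \<phi> x \<otimes> inv (\<phi> h)"
        using hB LB[OF \<phi>_L[OF c]] LB[OF \<phi>_L[OF x(1)]] by (metis inv_solve_right m_closed)
      then show "(\<rho> \<otimes>\<^bsub>\<Gamma>\<^esub> f h) x = (f (\<phi> h) \<otimes>\<^bsub>\<Gamma>\<^esub> \<rho>) x"
        using AutoGroup_mult_apply[OF \<rho>_auto f_auto[OF hB(1)], of x]
          AutoGroup_mult_apply[OF f_auto[OF hB(2)] \<rho>_auto, of x] x(1) c \<phi>_L[OF x(1)]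
        by (simp add: f_def \<rho>_def)
    qed
    then have "\<tau> \<otimes>\<^bsub>\<Gamma>\<^esub> (\<rho> \<otimes>\<^bsub>\<Gamma>\<^esub> f h) \<otimes>\<^bsub>\<Gamma>\<^esub> \<tau> = \<tau> \<otimes>\<^bsub>\<Gamma>\<^esub> (f (\<phi> h) \<otimes>\<^bsub>\<Gamma>\<^esub> \<rho>) \<otimes>\<^bsub>\<Gamma>\<^esub> \<tau>" by simp
    then show ?thesis
      using \<rho> fc by (simp add: \<tau>_def \<Gamma>.m_assoc \<Gamma>.mult_inv_mult)
  qed
  obtain P where P: "P \<in> hom E \<Gamma>" "\<And>b. b \<in> carrier B \<Longrightarrow> P (\<iota> b) = f b" "P t = \<tau>"
    using universal_property[OF group_\<Gamma> f \<tau> rel] by blast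
  interpret P: group_hom E \<Gamma> P
    using P(1) by (simp add: group_hom_def group_hom_axioms_def E.group_axioms \<Gamma>.group_axioms)
  have P_auto: "P e \<in> auto (B\<lparr>carrier := L\<rparr>)" if "e \<in> carrier E" for e
    using P.hom_closed[OF that] by (simp add: carrier_AutoGroup)
  have P_closed: "P e x \<in> L" if "e \<in> carrier E" "x \<in> L" for e x
    using auto_closed[OF P_auto[OF that(1)], of x] that(2) by simp
  have P_mult: "P (d \<cdot> e) x = P d (P e x)" if "d \<in> carrier E" "e \<in> carrier E" "x \<in> L" for d e x
    using AutoGroup_mult_apply[OF P_auto[OF that(1)] P_auto[OF that(2)], of x] that by simp
  have P_swap: "e \<cdot> \<iota> x = \<iota> (P e x) \<cdot> e" if "e \<in> carrier E" "x \<in> L" for e x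
    using that
  proof (induction e rule: E_induct)
    case one
    then show ?case using LB by (simp add: AutoGroup_one)
  next
    case (base b e)
    have y: "P e x \<in> L" "P e x \<in> carrier B" using P_closed[OF base(2,4)] LB by blast+
    have "\<iota> b \<cdot> e \<cdot> \<iota> x = \<iota> b \<cdot> (\<iota> (P e x) \<cdot> e)"
      using base LB[OF base(4)] by (simp add: E.m_assoc)
    also have "\<dots> = \<iota> (b \<otimes> P e x \<otimes> inv b) \<cdot> (\<iota> b \<cdot> e)"
      using base(1,2) y by (simp add: E.m_assoc E.mult_inv_mult)
    also have "b \<otimes> P e x \<otimes> inv b = P (\<iota> b \<cdot> e) x"
      using P_mult[OF \<iota>_closed[OF base(1)] base(2,4)] y(1) by (simp add: P(2)[OF base(1)] f_def)
    finally show ?case .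
  next
    case (stable e)
    have y: "P e x \<in> L" "P e x \<in> carrier B" using P_closed[OF stable(1,3)] LB by blast+
    have ty: "\<tau> (P e x) \<in> L" "\<phi> (\<tau> (P e x)) = P e x" using \<phi>\<tau>[OF y(1)] by blast+
    have "t \<cdot> e \<cdot> \<iota> x = t \<cdot> \<iota> (P e x) \<cdot> e"
      using stable LB[OF stable(3)] y by (simp add: E.m_assoc)
    also have "t \<cdot> \<iota> (P e x) = \<iota> (\<tau> (P e x)) \<cdot> t"
      using t_swap[of "\<tau> (P e x)"] ty by simp
    also have "\<tau> (P e x) = P (t \<cdot> e) x"
      using P_mult[OF t_closed stable(1,3)] by (simp add: P(3))
    finally show ?case
      using stable(1) P_closed[OF E.m_closed[OF t_closed stable(1)] stable(3)] LB by (simp add: E.m_assoc)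
  next
    case (stable_inv e)
    have y: "P e x \<in> L" "P e x \<in> H" "P e x \<in> carrier B" "\<phi> (P e x) \<in> carrier B"
      using P_closed[OF stable_inv(1,3)] LB \<phi>_carrier by blast+
    have "inv\<^sub>E t \<cdot> e \<cdot> \<iota> x = inv\<^sub>E t \<cdot> \<iota> (P e x) \<cdot> (t \<cdot> (inv\<^sub>E t \<cdot> e))"
      using stable_inv LB[OF stable_inv(3)] y by (simp add: E.m_assoc E.mult_inv_mult)
    also have "\<dots> = \<iota> (\<phi> (P e x)) \<cdot> (inv\<^sub>E t \<cdot> e)"
    proof -
      have "inv\<^sub>E t \<cdot> \<iota> (P e x) \<cdot> (t \<cdot> (inv\<^sub>E t \<cdot> e))
          = inv\<^sub>E t \<cdot> \<iota> (P e x) \<cdot> t \<cdot> (inv\<^sub>E t \<cdot> e)"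
        by (rule E.m_assoc[symmetric]) (use y(3) stable_inv(1) in simp_all)
      then show ?thesis using t_conj[OF y(2)] by simp
    qed
    also have "\<phi> (P e x) = P (inv\<^sub>E t \<cdot> e) x"
    proof -
      have "P (inv\<^sub>E t) = \<rho>" using \<rho> by (simp add: P(3) \<tau>_def)
      then show ?thesis
        using P_mult[OF E.inv_closed[OF t_closed] stable_inv(1,3)] y(1) by (simp add: \<rho>_def)
    qed
    finally show ?case .
  qed
  show thesis
    by (rule that[OF P(1) _ _ P_closed P_swap]) (simp_all add: P(2,3) f_def \<tau>_def \<rho>_def restrict_def)
qed

lemma restrict_\<phi>_pow: "restrict \<phi> L [^]\<^bsub>\<Gamma>\<^esub> (n::nat) = restrict (\<phi> ^^ n) L"
proof (induction n)
  case 0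
  then show ?case by (simp add: AutoGroup_one)
next
  case (Suc n)
  interpret \<Gamma>: group \<Gamma> by (rule group_\<Gamma>)
  have \<rho>: "restrict \<phi> L \<in> carrier \<Gamma>" using restrict_\<phi>_auto by (simp add: carrier_AutoGroup)
  have "restrict (\<phi> ^^ n) L \<in> auto (B\<lparr>carrier := L\<rparr>)"
    using \<Gamma>.nat_pow_closed[OF \<rho>, of n] unfolding Suc carrier_AutoGroup .
  then have "restrict (\<phi> ^^ n) L \<otimes>\<^bsub>\<Gamma>\<^esub> restrict \<phi> L = compose L (restrict (\<phi> ^^ n) L) (restrict \<phi> L)"
    using AutoGroup_mult[OF _ restrict_\<phi>_auto, of "restrict (\<phi> ^^ n) L"] by simp
  also have "\<dots> = restrict (\<phi> ^^ Suc n) L"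
    unfolding compose_def
  proof (rule restrict_ext)
    fix x assume "x \<in> L"
    then have "\<phi> x \<in> L" "x \<in> L" using \<phi>_L by blast+
    then show "restrict (\<phi> ^^ n) L (restrict \<phi> L x) = (\<phi> ^^ Suc n) x"
      by (simp add: funpow_swap1)
  qed
  finally show ?case unfolding Group.nat_pow_Suc Suc .
qed

end

section \<open>A quotient in the class in which the base group survives\<close>

locale hnn_normal_in_class = hnn_normal B H K \<phi> + hnn_in_class B H K \<phi> C
  for B :: "('a, 'b) monoid_scheme" (structure) and H K \<phi> and C :: "'u monoid set"
begin

text \<open>
  The group \<open>Z\<close> with the element \<open>z\<close> expresses that the cyclic group generated by \<open>\<phi>\<close> on \<open>L\<close> is a quotient of the
  one generated by \<open>z\<close>, in a form that is inherited by quotients of \<open>B\<close>.  Let \<open>T\<close> be the kernel of the homomorphism \<open>E \<rightarrow> Z\<close> with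
  \<open>t \<mapsto> z\<close> that is trivial on \<open>B\<close>.  The automorphism group of \<open>L\<close> is abelian, so an element of \<open>T\<close> acts on \<open>L\<close> like an
  element of \<open>B\<close> times a trivial power of \<open>\<phi>\<close>.  Thus the image of \<open>T\<close> is contained in that of \<open>B\<close>, which is in the
  class, and the Gruenberg condition applies to the action of \<open>T\<close>.
\<close>

lemma ex_centralizing_kernel:
  assumes cB: "in_class C B" and fin: "finite L" and lc: "locally_cyclic_in B L"
    and Z: "in_class C Z" "z \<in> carrier Z"
    and order: "\<And>n::nat. z [^]\<^bsub>Z\<^esub> n = \<one>\<^bsub>Z\<^esub> \<Longrightarrow> \<forall>x\<in>L. (\<phi> ^^ n) x = x"
  shows "\<exists>Y\<in>kernels E. \<forall>y\<in>Y. \<forall>x\<in>L. y \<cdot> \<iota> x = \<iota> x \<cdot> y"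
proof -
  interpret Z: group Z using in_class_group[OF Z(1)] .
  interpret \<Gamma>: comm_group \<Gamma> using comm_AutoGroup_of_finite_locally_cyclic[OF subgroup_L fin lc] .
  obtain P where P: "P \<in> hom E \<Gamma>" "P t = inv\<^bsub>\<Gamma>\<^esub> (restrict \<phi> L)"
      "\<And>e x. e \<in> carrier E \<Longrightarrow> x \<in> L \<Longrightarrow> e \<cdot> \<iota> x = \<iota> (P e x) \<cdot> e"
    by (rule ex_conjugation_action) (rule that; assumption)
  interpret P: group_hom E \<Gamma> P
    using P(1) by (simp add: group_hom_def group_hom_axioms_def E.group_axioms \<Gamma>.group_axioms)
  obtain F where F: "F \<in> hom E Z" "\<And>b. b \<in> carrier B \<Longrightarrow> F (\<iota> b) = \<one>\<^bsub>Z\<^esub>" "F t = z"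
    using ex_exponent_hom[OF Z.group_axioms Z(2)] by blast
  interpret F: group_hom E Z F
    using F(1) by (simp add: group_hom_def group_hom_axioms_def E.group_axioms Z.group_axioms)
  define T where "T = {e \<in> carrier E. F e = \<one>\<^bsub>Z\<^esub>}"
  have T: "T \<in> kernels E" by (rule kernelsI_hom[OF E.group_axioms Z(1) F(1) T_def])
  have P_t_pow: "P t [^]\<^bsub>\<Gamma>\<^esub> n = \<one>\<^bsub>\<Gamma>\<^esub>" if n: "z [^]\<^bsub>Z\<^esub> n = \<one>\<^bsub>Z\<^esub>" for n :: int
  proof -
    have \<rho>: "restrict \<phi> L \<in> carrier \<Gamma>" using restrict_\<phi>_auto by (simp add: carrier_AutoGroup)
    have *: "restrict \<phi> L [^]\<^bsub>\<Gamma>\<^esub> m = \<one>\<^bsub>\<Gamma>\<^esub>" if "z [^]\<^bsub>Z\<^esub> m = \<one>\<^bsub>Z\<^esub>" for m :: nat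
      using order[OF that] by (simp add: restrict_\<phi>_pow AutoGroup_one cong: restrict_cong)
    have "restrict \<phi> L [^]\<^bsub>\<Gamma>\<^esub> n = \<one>\<^bsub>\<Gamma>\<^esub>"
    proof (cases "n \<ge> 0")
      case True
      then obtain m where "n = int m" using nonneg_int_cases by blast
      then show ?thesis using * n by (simp add: int_pow_int)
    next
      case False
      then obtain m where m: "n = - int m" using nonpos_int_cases by (metis linorder_le_cases)
      then have "z [^]\<^bsub>Z\<^esub> m = \<one>\<^bsub>Z\<^esub>" using n Z(2) Z.int_pow_neg_int by simp
      then show ?thesis using * m \<rho> \<Gamma>.int_pow_neg_int by simp
    qed
    then show ?thesis using \<rho> by (simp add: P(2) \<Gamma>.int_pow_inv)
  qed
  have form: "\<exists>b\<in>carrier B. \<exists>n::int. P e = P (\<iota> b) \<otimes>\<^bsub>\<Gamma>\<^esub> P t [^]\<^bsub>\<Gamma>\<^esub> n \<and> F e = z [^]\<^bsub>Z\<^esub> n"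
    if "e \<in> carrier E" for e
    using that
  proof (induction rule: E_induct)
    case one
    show ?case by (intro bexI[of _ \<one>] exI[of _ 0]) simp_all
  next
    case (base a e)
    then obtain b n where bn: "b \<in> carrier B" "P e = P (\<iota> b) \<otimes>\<^bsub>\<Gamma>\<^esub> P t [^]\<^bsub>\<Gamma>\<^esub> (n::int)" "F e = z [^]\<^bsub>Z\<^esub> n" by blast
    then show ?case using base(1,2) Z(2) F(2)
      by (intro bexI[of _ "a \<otimes> b"] exI[of _ n]) (simp_all add: \<Gamma>.m_assoc)
  next
    case (stable e)
    then obtain b n where bn: "b \<in> carrier B" "P e = P (\<iota> b) \<otimes>\<^bsub>\<Gamma>\<^esub> P t [^]\<^bsub>\<Gamma>\<^esub> (n::int)" "F e = z [^]\<^bsub>Z\<^esub> n" by blast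
    have "P (t \<cdot> e) = P (\<iota> b) \<otimes>\<^bsub>\<Gamma>\<^esub> P t [^]\<^bsub>\<Gamma>\<^esub> (1 + n)"
      using bn(1,2) stable(1) by (simp add: \<Gamma>.int_pow_mult \<Gamma>.m_lcomm)
    moreover have "F (t \<cdot> e) = z [^]\<^bsub>Z\<^esub> (1 + n)"
      using bn(3) stable(1) Z(2) F(3) by (simp add: Z.int_pow_mult)
    ultimately show ?case using bn(1) by blast
  next
    case (stable_inv e)
    then obtain b n where bn: "b \<in> carrier B" "P e = P (\<iota> b) \<otimes>\<^bsub>\<Gamma>\<^esub> P t [^]\<^bsub>\<Gamma>\<^esub> (n::int)" "F e = z [^]\<^bsub>Z\<^esub> n" by blast
    have "P (inv\<^sub>E t) = P t [^]\<^bsub>\<Gamma>\<^esub> (-1 :: int)"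
      using \<Gamma>.int_pow_neg[of "P t" 1] by (simp del: \<Gamma>.int_pow_neg)
    then have "P (inv\<^sub>E t \<cdot> e) = P t [^]\<^bsub>\<Gamma>\<^esub> (-1 :: int) \<otimes>\<^bsub>\<Gamma>\<^esub> (P (\<iota> b) \<otimes>\<^bsub>\<Gamma>\<^esub> P t [^]\<^bsub>\<Gamma>\<^esub> n)"
      using P.hom_mult[of "inv\<^sub>E t" e] stable_inv(1) bn(2) by simp
    also have "\<dots> = P (\<iota> b) \<otimes>\<^bsub>\<Gamma>\<^esub> (P t [^]\<^bsub>\<Gamma>\<^esub> (-1 :: int) \<otimes>\<^bsub>\<Gamma>\<^esub> P t [^]\<^bsub>\<Gamma>\<^esub> n)"
      using bn(1) by (intro \<Gamma>.m_lcomm) simp_all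
    also have "\<dots> = P (\<iota> b) \<otimes>\<^bsub>\<Gamma>\<^esub> P t [^]\<^bsub>\<Gamma>\<^esub> (-1 + n)"
      by (subst \<Gamma>.int_pow_mult[symmetric]) simp_all
    finally have "P (inv\<^sub>E t \<cdot> e) = P (\<iota> b) \<otimes>\<^bsub>\<Gamma>\<^esub> P t [^]\<^bsub>\<Gamma>\<^esub> (-1 + n)" .
    moreover have "F (inv\<^sub>E t \<cdot> e) = z [^]\<^bsub>Z\<^esub> (-1 + n)"
      using bn(3) stable_inv(1) Z(2) F(3) Z.int_pow_neg[of z 1] by (subst Z.int_pow_mult) simp_all
    ultimately show ?case using bn(1) by blast
  qed
  have PT: "P e \<in> P ` \<iota> ` carrier B" if "e \<in> T" for e
  proof -
    have e: "e \<in> carrier E" "F e = \<one>\<^bsub>Z\<^esub>" using that by (simp_all add: T_def)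
    obtain b n where bn: "b \<in> carrier B" "P e = P (\<iota> b) \<otimes>\<^bsub>\<Gamma>\<^esub> P t [^]\<^bsub>\<Gamma>\<^esub> (n::int)" "F e = z [^]\<^bsub>Z\<^esub> n"
      using form[OF e(1)] by blast
    then show ?thesis using P_t_pow[of n] e(2) by simp
  qed
  let ?A = "\<Gamma>\<lparr>carrier := P ` \<iota> ` carrier B\<rparr>"
  have "P \<circ> \<iota> \<in> hom B \<Gamma>" using Group.hom_compose[OF \<iota>_hom P(1)] .
  then interpret P\<iota>: group_hom B \<Gamma> "P \<circ> \<iota>"
    by (simp add: group_hom_def group_hom_axioms_def group_axioms \<Gamma>.group_axioms)
  have gA: "group ?A"
    using subgroup.subgroup_is_group[OF P\<iota>.img_is_subgroup \<Gamma>.group_axioms] by (simp add: image_comp)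
  have "P \<circ> \<iota> \<in> epi B ?A"
    unfolding epi_def by (auto simp: hom_def P\<iota>.hom_mult)
  then have cA: "in_class C ?A" using in_class_epi[OF cB gA] by blast
  have "P \<in> hom (E\<lparr>carrier := T\<rparr>) ?A"
    by (rule homI) (use PT in \<open>auto simp: T_def\<close>)
  then obtain Y where Y: "Y \<in> kernels E" "Y \<subseteq> {e \<in> T. P e = \<one>\<^bsub>?A\<^esub>}"
    using gruenberg[OF small_E T cA] by blast
  have "y \<cdot> \<iota> x = \<iota> x \<cdot> y" if "y \<in> Y" "x \<in> L" for x y
  proof -
    have "y \<in> carrier E" "P y = \<one>\<^bsub>\<Gamma>\<^esub>" using Y(2) that(1) by (auto simp: T_def)
    then show ?thesis using P(3)[of y x] that(2) by (simp add: AutoGroup_one)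
  qed
  then show ?thesis using Y(1) by blast
qed

text \<open>
  If \<open>Y\<close> centralizes \<open>L\<close> and \<open>Y \<inter> B \<subseteq> L\<close>, then the inclusions of the conjugates of \<open>Y \<inter> B\<close> into \<open>L\<close> extend to a homomorphism
  from \<open>Y\<close> to \<open>L\<close>.
\<close>

lemma kernel_avoiding_base_over_L:
  assumes cB: "in_class C B" and lc: "locally_cyclic_in B L"
    and T: "T \<in> kernels E" "\<And>b. b \<in> carrier B \<Longrightarrow> \<iota> b \<in> T \<Longrightarrow> b \<in> L"
    and Y: "Y \<in> kernels E" "\<And>y x. y \<in> Y \<Longrightarrow> x \<in> L \<Longrightarrow> y \<cdot> \<iota> x = \<iota> x \<cdot> y"
  shows "\<exists>S\<in>kernels E. \<forall>b\<in>carrier B. \<iota> b \<in> S \<longrightarrow> b = \<one>"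
proof -
  interpret L: normal L B by (rule normal_L)
  have LB: "x \<in> carrier B" if "x \<in> L" for x using that L.subset by blast
  have L_comm: "x \<otimes> y = y \<otimes> x" if "x \<in> L" "y \<in> L" for x y
    using locally_cyclic_in_commute[OF lc L.subset that] .
  obtain P where P: "\<And>e x. e \<in> carrier E \<Longrightarrow> x \<in> L \<Longrightarrow> P e x \<in> L"
      "\<And>e x. e \<in> carrier E \<Longrightarrow> x \<in> L \<Longrightarrow> e \<cdot> \<iota> x = \<iota> (P e x) \<cdot> e"
    by (rule ex_conjugation_action) (rule that; assumption)
  have P_conj: "e \<cdot> \<iota> x \<cdot> inv\<^sub>E e = \<iota> (P e x)" if "e \<in> carrier E" "x \<in> L" for e x
    using P(2)[OF that] that LB[OF P(1)[OF that]] by (simp add: E.m_assoc)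
  have sub: "subgroup (\<iota> ` L) E" using \<iota>.subgroup_img_is_subgroup[OF subgroup_L] .
  let ?A = "E\<lparr>carrier := \<iota> ` L\<rparr>"
  interpret A: group ?A using subgroup.subgroup_is_group[OF sub E.group_axioms] .
  have cA: "comm_group ?A"
    by (rule A.group_comm_groupI) (use L_comm LB in \<open>auto simp flip: \<iota>.hom_mult\<close>)
  have "\<iota> \<in> epi (B\<lparr>carrier := L\<rparr>) ?A"
    using LB by (auto simp: epi_def hom_def)
  then have inA: "in_class C ?A" using in_class_epi[OF in_class_subgroup[OF cB subgroup_L] A.group_axioms] by blast
  define W where "W = T \<inter> Y"
  have W: "W \<in> kernels E" unfolding W_def by (rule kernels_Int[OF small_E T(1) Y(1)])
  have WE: "w \<in> carrier E" if "w \<in> W" for w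
    using that kernelsD(1)[OF W] normal_imp_subgroup subgroup.subset by blast
  define N where "N = {b \<in> carrier B. \<iota> b \<in> W}"
  have NL: "n \<in> L" if "n \<in> N" for n
  proof (rule T(2))
    show "n \<in> carrier B" using that by (simp add: N_def)
    show "\<iota> n \<in> T" using that by (simp add: N_def W_def)
  qed
  define \<theta> where "\<theta> e n = e \<cdot> \<iota> n \<cdot> inv\<^sub>E e" for e n
  have "\<exists>S\<in>kernels E. S \<subseteq> W \<and> (\<forall>n\<in>N. \<iota> n \<in> S \<longrightarrow> \<theta> \<one>\<^sub>E n = \<one>\<^bsub>?A\<^esub>)"
  proof (rule extend_vertex_homs[OF cA inA W N_def])
    fix e assume e: "e \<in> carrier E"
    show "\<theta> e \<in> hom (B\<lparr>carrier := N\<rparr>) ?A"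
    proof (rule homI)
      fix x assume "x \<in> carrier (B\<lparr>carrier := N\<rparr>)"
      then show "\<theta> e x \<in> carrier ?A" using P_conj[OF e NL] P(1)[OF e NL] by (simp add: \<theta>_def)
    next
      fix x y assume "x \<in> carrier (B\<lparr>carrier := N\<rparr>)" "y \<in> carrier (B\<lparr>carrier := N\<rparr>)"
      then have "x \<in> carrier B" "y \<in> carrier B" using LB NL by auto
      then show "\<theta> e (x \<otimes>\<^bsub>B\<lparr>carrier := N\<rparr>\<^esub> y) = \<theta> e x \<otimes>\<^bsub>?A\<^esub> \<theta> e y"
        using e by (simp add: \<theta>_def E.m_assoc E.mult_inv_mult)
    qed
  next
    fix e b n assume "e \<in> carrier E" "b \<in> carrier B" "n \<in> N"
    then show "\<theta> (e \<cdot> \<iota> b) n = \<theta> e (b \<otimes> n \<otimes> inv b)"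
      using LB[OF NL] by (simp add: \<theta>_def E.m_assoc E.inv_mult_group)
  next
    fix e h assume *: "e \<in> carrier E" "h \<in> H" "h \<in> N"
    have hB: "h \<in> carrier B" "\<phi> h \<in> carrier B" using * H_subset \<phi>_carrier by auto
    have "\<theta> (e \<cdot> t) (\<phi> h) = e \<cdot> (t \<cdot> \<iota> (\<phi> h)) \<cdot> inv\<^sub>E t \<cdot> inv\<^sub>E e"
      using * hB by (simp add: \<theta>_def E.m_assoc E.inv_mult_group)
    also have "t \<cdot> \<iota> (\<phi> h) = \<iota> h \<cdot> t" using t_swap[OF *(2)] ..
    finally show "\<theta> (e \<cdot> t) (\<phi> h) = \<theta> e h"
      using *(1) hB by (simp add: \<theta>_def E.m_assoc E.mult_inv_mult)
  next
    fix y e n assume *: "y \<in> W" "e \<in> carrier E" "n \<in> N"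
    have yE: "y \<in> carrier E" using WE[OF *(1)] .
    have PL: "P e n \<in> L" using P(1)[OF *(2) NL[OF *(3)]] .
    have "\<theta> (y \<cdot> e) n = y \<cdot> (e \<cdot> \<iota> n \<cdot> inv\<^sub>E e) \<cdot> inv\<^sub>E y"
      using * yE LB[OF NL[OF *(3)]] by (simp add: \<theta>_def E.m_assoc E.inv_mult_group)
    also have "\<dots> = y \<cdot> \<iota> (P e n) \<cdot> inv\<^sub>E y" using P_conj[OF *(2) NL[OF *(3)]] by simp
    also have "y \<cdot> \<iota> (P e n) = \<iota> (P e n) \<cdot> y" using Y(2) *(1) PL by (simp add: W_def)
    also have "\<iota> (P e n) \<cdot> y \<cdot> inv\<^sub>E y = \<iota> (P e n)" using yE LB[OF PL] by (simp add: E.m_assoc)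
    finally show "\<theta> (y \<cdot> e) n = \<theta> e n" using P_conj[OF *(2) NL[OF *(3)]] by (simp add: \<theta>_def)
  qed
  then obtain S where S: "S \<in> kernels E" "S \<subseteq> W" "\<And>n. n \<in> N \<Longrightarrow> \<iota> n \<in> S \<Longrightarrow> \<theta> \<one>\<^sub>E n = \<one>\<^sub>E" by auto
  have "b = \<one>" if b: "b \<in> carrier B" "\<iota> b \<in> S" for b
  proof -
    have "\<theta> \<one>\<^sub>E b = \<one>\<^sub>E" using S(3)[of b] S(2) b by (auto simp: N_def)
    then have "\<iota> b = \<iota> \<one>" using b(1) by (simp add: \<theta>_def)
    then show ?thesis by (rule inj_onD[OF \<iota>_inj _ b(1) one_closed])
  qed
  then show ?thesis using S(1) by blast
qed

text \<open>
  The elements of \<open>B\<close> outside \<open>HK\<close> are separated by \<open>B/HK\<close>, those of \<open>HK\<close> outside \<open>L\<close> in the HNN-extension of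
  \<open>B/L\<close>, where the associated subgroups intersect trivially, and those of \<open>L\<close> by \<open>kernel_avoiding_base_over_L\<close>.
\<close>

lemma kernel_avoiding_base:
  assumes cB: "in_class C B" and fin: "finite H" and lc: "locally_cyclic_in B H"
    and Z: "in_class C Z" "z \<in> carrier Z"
    and order: "\<And>n::nat. z [^]\<^bsub>Z\<^esub> n = \<one>\<^bsub>Z\<^esub> \<Longrightarrow> \<forall>x\<in>L. (\<phi> ^^ n) x = x"
  shows "\<exists>T\<in>kernels E. \<forall>b\<in>carrier B. \<iota> b \<in> T \<longrightarrow> b = \<one>"
proof -
  interpret L: normal L B by (rule normal_L)
  have lcL: "locally_cyclic_in B L" using locally_cyclic_in_subset[OF lc] by simp
  have finL: "finite L" using fin by simp
  have HB: "h \<in> carrier B" if "h \<in> H" for h using that H_subset by blast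
  have KB: "k \<in> carrier B" if "k \<in> K" for k using that K_subset by blast
  define M where "M = H <#> K"
  have M: "M \<lhd> B" "H \<subseteq> M" "K \<subseteq> M" using normal_HK[OF normal_H normal_K] by (simp_all add: M_def)
  have Mk: "M \<in> kernels B"
    by (rule kernels_upward[OF trivial_in_kernels[OF cB] _ M(1)])
      (use subgroup.one_closed[OF normal_imp_subgroup[OF M(1)]] in simp)
  obtain T1 where T1: "T1 \<in> kernels E" "\<forall>b\<in>carrier B. \<iota> b \<in> T1 \<longleftrightarrow> b \<in> M"
    using kernel_containing_associated_subgroups[OF Mk M(2,3)] by blast
  have compat: "\<phi> ` (L \<inter> H) = L \<inter> K" using \<phi>_Int by (simp add: Int_ac)
  interpret Q: hnn_in_class "B Mod L" "(#>) L ` H" "(#>) L ` K" "quotient_iso L" C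
    using hnn_in_class_quotient[OF normal_L compat] .
  interpret q: group_hom B "B Mod L" "(#>) L"
    using L.r_coset_hom_Mod by (simp add: group_hom_def group_hom_axioms_def group_axioms Q.group_axioms)
  have cQ: "in_class C (B Mod L)"
    using kernelsD(2)[OF kernels_upward[OF trivial_in_kernels[OF cB] _ normal_L]] L.one_closed by simp
  have q_surj: "(#>) L ` carrier B = carrier (B Mod L)" by (simp add: carrier_FactGroup)
  have nQ: "(#>) L ` H \<lhd> B Mod L" "(#>) L ` K \<lhd> B Mod L"
    using normal.surj_hom_normal_subgroup[OF normal_H q.group_hom_axioms q_surj]
      normal.surj_hom_normal_subgroup[OF normal_K q.group_hom_axioms q_surj] by simp_all
  have lcQ: "locally_cyclic_in (B Mod L) ((#>) L ` H)" using q.locally_cyclic_in_image[OF lc H_subset] .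
  have trivQ: "(#>) L ` H \<inter> (#>) L ` K = {\<one>\<^bsub>B Mod L\<^esub>}"
  proof -
    have same: "L #> h = L" if "h \<in> H" "k \<in> K" "L #> h = L #> k" for h k
    proof -
      have "h \<otimes> inv k \<in> L" using coset_eq_iff[OF normal_L HB[OF that(1)] KB[OF that(2)]] that(3) by simp
      then have "h \<otimes> inv k \<otimes> k \<in> K" using that(2) subgroup.m_closed[OF subgroup_K] by simp
      then have "h \<in> K" using that HB KB by (simp add: m_assoc)
      then show ?thesis using L.coset_eq_iff_mem[of h] that(1) HB by simp
    qed
    have "L #> \<one> = L" using L.coset_eq_iff_mem[of \<one>] L.one_closed by simp
    then have "L \<in> (#>) L ` H" "L \<in> (#>) L ` K"
      using subgroup.one_closed[OF subgroup_H] subgroup.one_closed[OF subgroup_K] by (metis imageI)+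
    then show ?thesis
    proof (intro equalityI subsetI)
      fix X assume "X \<in> (#>) L ` H \<inter> (#>) L ` K"
      then obtain h k where "h \<in> H" "k \<in> K" "X = L #> h" "X = L #> k" by (elim IntE imageE)
      then show "X \<in> {\<one>\<^bsub>B Mod L\<^esub>}" using same[of h k] by simp
    qed simp
  qed
  obtain T' where T': "T' \<in> kernels Q.E"
      "\<And>X. X \<in> (#>) L ` H <#>\<^bsub>B Mod L\<^esub> (#>) L ` K \<Longrightarrow> Q.\<iota> X \<in> T' \<Longrightarrow> X = \<one>\<^bsub>B Mod L\<^esub>"
    using Q.kernel_separating_associated_subgroups[OF cQ nQ finite_imageI[OF fin] lcQ trivQ] by blast
  obtain T2 where T2: "T2 \<in> kernels E" "\<And>b. b \<in> carrier B \<Longrightarrow> \<iota> b \<in> T2 \<longleftrightarrow> Q.\<iota> (L #> b) \<in> T'"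
    using kernels_pullback_quotient[OF normal_L compat T'(1)] by blast
  have over_L: "b \<in> L" if b: "b \<in> carrier B" "\<iota> b \<in> T1 \<inter> T2" for b
  proof -
    have "b \<in> M" using T1(2) b by blast
    then obtain h k where hk: "h \<in> H" "k \<in> K" "b = h \<otimes> k" by (auto simp: M_def set_mult_def)
    have "L #> b = (L #> h) \<otimes>\<^bsub>B Mod L\<^esub> (L #> k)" using hk HB KB q.hom_mult[of h k] by simp
    then have "L #> b \<in> (#>) L ` H <#>\<^bsub>B Mod L\<^esub> (#>) L ` K" using hk unfolding set_mult_def by blast
    moreover have "Q.\<iota> (L #> b) \<in> T'" using T2(2)[OF b(1)] b(2) by blast
    ultimately have "L #> b = L" using T'(2) by simp
    then show ?thesis using L.coset_eq_iff_mem[OF b(1)] by simp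
  qed
  obtain Y where Y: "Y \<in> kernels E" "\<And>y x. y \<in> Y \<Longrightarrow> x \<in> L \<Longrightarrow> y \<cdot> \<iota> x = \<iota> x \<cdot> y"
    using ex_centralizing_kernel[OF cB finL lcL Z order] by blast
  show ?thesis
    using kernel_avoiding_base_over_L[OF cB lcL kernels_Int[OF small_E T1(1) T2(1)] over_L Y] .
qed

end

context hnn_normal_in_class
begin

section \<open>Sufficient conditions\<close>

text \<open>
  The lemma \<open>kernel_avoiding_base\<close> is applied to the HNN-extension of \<open>B/N\<close>.  Its associated subgroups are finite by local
  cyclicity, and the condition on \<open>N \<inter> HK\<close> ensures that they intersect in the image of \<open>L\<close>.
\<close>

lemma kernel_over_compatible:
  assumes N: "N \<in> kernels B" and compat: "\<phi> ` (N \<inter> H) = N \<inter> K"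
    and split: "N \<inter> (H <#> K) \<subseteq> (N \<inter> H) <#> (N \<inter> K)" and lc: "locally_cyclic_in B H"
    and Z: "in_class C Z" "z \<in> carrier Z"
    and order: "\<And>n::nat. z [^]\<^bsub>Z\<^esub> n = \<one>\<^bsub>Z\<^esub> \<Longrightarrow> \<forall>x\<in>L. (\<phi> ^^ n) x = x"
  shows "\<exists>T\<in>kernels E. \<forall>b\<in>carrier B. \<iota> b \<in> T \<longleftrightarrow> b \<in> N"
proof -
  have nN: "N \<lhd> B" using kernelsD(1)[OF N] .
  interpret N: normal N B by (rule nN)
  have HB: "h \<in> carrier B" if "h \<in> H" for h using that H_subset by blast
  have KB: "k \<in> carrier B" if "k \<in> K" for k using that K_subset by blast
  let ?q = "(#>) N"
  interpret Q: hnn_in_class "B Mod N" "?q ` H" "?q ` K" "quotient_iso N" C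
    using hnn_in_class_quotient[OF nN compat] .
  interpret q: group_hom B "B Mod N" ?q
    using N.r_coset_hom_Mod by (simp add: group_hom_def group_hom_axioms_def group_axioms Q.group_axioms)
  have q_surj: "?q ` carrier B = carrier (B Mod N)" by (simp add: carrier_FactGroup)
  have nQ: "?q ` H \<lhd> B Mod N" "?q ` K \<lhd> B Mod N"
    using normal.surj_hom_normal_subgroup[OF normal_H q.group_hom_axioms q_surj]
      normal.surj_hom_normal_subgroup[OF normal_K q.group_hom_axioms q_surj] by simp_all
  have int: "?q ` H \<inter> ?q ` K = ?q ` L"
  proof
    show "?q ` H \<inter> ?q ` K \<subseteq> ?q ` L"
    proof
      fix X assume "X \<in> ?q ` H \<inter> ?q ` K"
      then obtain h k where hk: "h \<in> H" "k \<in> K" "X = N #> h" "N #> h = N #> k" by auto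
      have "h \<otimes> inv k \<in> N" using coset_eq_iff[OF nN HB[OF hk(1)] KB[OF hk(2)]] hk(4) by simp
      moreover have "h \<otimes> inv k \<in> H <#> K"
        unfolding set_mult_def using hk(1) subgroup.m_inv_closed[OF subgroup_K hk(2)] by blast
      ultimately have "h \<otimes> inv k \<in> (N \<inter> H) <#> (N \<inter> K)" using split by blast
      then obtain n m where nm: "n \<in> N" "n \<in> H" "m \<in> N" "m \<in> K" "h \<otimes> inv k = n \<otimes> m"
        by (auto simp: set_mult_def)
      have "inv n \<otimes> h = inv n \<otimes> (h \<otimes> inv k) \<otimes> k" using hk nm(2) HB KB by (simp add: m_assoc)
      also have "\<dots> = m \<otimes> k" unfolding nm(5) using hk nm HB KB by (simp add: m_assoc mult_inv_mult)
      finally have eq: "inv n \<otimes> h = m \<otimes> k" .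
      have "inv n \<otimes> h \<in> H" using nm(2) hk(1) subgroup_H by (simp add: subgroup.m_closed subgroup.m_inv_closed)
      moreover have "m \<otimes> k \<in> K" using nm(4) hk(2) subgroup_K by (simp add: subgroup.m_closed)
      ultimately have l: "inv n \<otimes> h \<in> L" using eq by simp
      have "inv n \<otimes> h \<otimes> inv h \<in> N" using nm(1,2) hk(1) HB by (simp add: m_assoc)
      then have "N #> (inv n \<otimes> h) = N #> h"
        using nm(2) hk(1) HB by (intro coset_eq_iff[OF nN, THEN iffD2]) simp_all
      then show "X \<in> ?q ` L" using l hk(3) by (metis imageI)
    qed
  qed auto
  have qi: "quotient_iso N (N #> x) = N #> \<phi> x" if "x \<in> L" for x
    using quotient_iso_coset[OF nN compat] that by blast
  have qi_L: "quotient_iso N ` ?q ` L = ?q ` \<phi> ` L"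
    unfolding image_image by (rule image_cong) (use qi in auto)
  have QL: "quotient_iso N ` (?q ` H \<inter> ?q ` K) = ?q ` H \<inter> ?q ` K"
    unfolding int qi_L \<phi>_Int ..
  interpret Q: hnn_normal_in_class "B Mod N" "?q ` H" "?q ` K" "quotient_iso N" C
    using Q.hnn_in_class_axioms Q.hnn_axioms nQ QL
    by (simp add: hnn_normal_in_class_def hnn_normal_def hnn_normal_axioms_def)
  have cQ: "in_class C (B Mod N)" using kernelsD(2)[OF N] .
  have "?q \<in> hom (B\<lparr>carrier := H\<rparr>) (B Mod N)"
    using hom_restrict_carrier[OF N.r_coset_hom_Mod H_subset] .
  then have finQ: "finite (?q ` H)" using finite_image_of_locally_cyclic[OF group_axioms subgroup_H lc cQ] by blast
  have lcQ: "locally_cyclic_in (B Mod N) (?q ` H)" using q.locally_cyclic_in_image[OF lc H_subset] .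
  have pow_L: "(\<phi> ^^ n) x \<in> L \<and> (quotient_iso N ^^ n) (N #> x) = N #> (\<phi> ^^ n) x" if "x \<in> L" for x n
    using that
  proof (induction n)
    case (Suc n)
    then have "(\<phi> ^^ n) x \<in> L" "(quotient_iso N ^^ n) (N #> x) = N #> (\<phi> ^^ n) x" by blast+
    then show ?case using \<phi>_L[of "(\<phi> ^^ n) x"] qi[of "(\<phi> ^^ n) x"] by (simp only: funpow.simps o_apply)
  qed simp
  have orderQ: "\<forall>X\<in>?q ` H \<inter> ?q ` K. (quotient_iso N ^^ n) X = X" if "z [^]\<^bsub>Z\<^esub> n = \<one>\<^bsub>Z\<^esub>" for n :: nat
    unfolding int using pow_L order[OF that] by auto
  obtain T where T: "T \<in> kernels Q.E" "\<forall>X\<in>carrier (B Mod N). Q.\<iota> X \<in> T \<longrightarrow> X = \<one>\<^bsub>B Mod N\<^esub>"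
    using Q.kernel_avoiding_base[OF cQ finQ lcQ Z orderQ] by blast
  interpret T: normal T Q.E using kernelsD(1)[OF T(1)] .
  obtain T' where T': "T' \<in> kernels E" "\<And>b. b \<in> carrier B \<Longrightarrow> \<iota> b \<in> T' \<longleftrightarrow> Q.\<iota> (N #> b) \<in> T"
    using kernels_pullback_quotient[OF nN compat T(1)] by blast
  have "\<iota> b \<in> T' \<longleftrightarrow> b \<in> N" if b: "b \<in> carrier B" for b
  proof -
    have "N #> b \<in> carrier (B Mod N)" using b by simp
    then have "Q.\<iota> (N #> b) \<in> T \<longleftrightarrow> N #> b = \<one>\<^bsub>B Mod N\<^esub>"
      using T(2) T.one_closed Q.\<iota>.hom_one by metis
    then show ?thesis using T'(2)[OF b] N.coset_eq_iff_mem[OF b] by simp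
  qed
  then show ?thesis using T'(1) by blast
qed

text \<open>
  Only finitely many elements of \<open>B\<close> have to be kept outside \<open>H\<close> or \<open>K\<close> for a given word to stay reduced.
\<close>

lemma residually_E_if_cofinal:
  assumes lc: "locally_cyclic_in B H"
    and Z: "in_class C Z" "z \<in> carrier Z"
    and order: "\<And>n::nat. z [^]\<^bsub>Z\<^esub> n = \<one>\<^bsub>Z\<^esub> \<Longrightarrow> \<forall>x\<in>L. (\<phi> ^^ n) x = x"
    and res: "residually C B" "residually C (B Mod H)" "residually C (B Mod K)"
    and cofinal: "\<And>M. M \<in> kernels B \<Longrightarrow> \<exists>N\<in>kernels B. N \<subseteq> M \<and> \<phi> ` (N \<inter> H) = N \<inter> K \<and>
        N \<inter> (H <#> K) \<subseteq> (N \<inter> H) <#> (N \<inter> K)"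
  shows "residually C E"
  unfolding residually_iff
proof (intro conjI ballI impI)
  show "group E" by (rule E.group_axioms)
  have over: "\<exists>T\<in>kernels E. \<forall>b\<in>carrier B. \<iota> b \<in> T \<longrightarrow> b \<in> M" if M: "M \<in> kernels B" for M
  proof -
    obtain N where N: "N \<in> kernels B" "N \<subseteq> M" "\<phi> ` (N \<inter> H) = N \<inter> K"
        "N \<inter> (H <#> K) \<subseteq> (N \<inter> H) <#> (N \<inter> K)"
      using cofinal[OF M] by blast
    have "\<exists>T\<in>kernels E. \<forall>b\<in>carrier B. \<iota> b \<in> T \<longleftrightarrow> b \<in> N"
      by (rule kernel_over_compatible[OF N(1,3,4) lc Z]) (rule order)
    then obtain T where T: "T \<in> kernels E" "\<forall>b\<in>carrier B. \<iota> b \<in> T \<longleftrightarrow> b \<in> N" by (elim bexE)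
    show ?thesis by (rule bexI[OF _ T(1)]) (use T(2) N(2) in blast)
  qed
  fix e assume e: "e \<in> carrier E" "e \<noteq> \<one>\<^sub>E"
  obtain b xs where bxs: "b \<in> carrier B" "snd ` set xs \<subseteq> carrier B" "e = \<iota> b \<cdot> val xs"
      "successively (no_pinch H K) xs"
    using reduced_representation[OF e(1)] .
  show "\<exists>T\<in>kernels E. e \<notin> T"
  proof (cases "xs = []")
    case True
    then have eb: "e = \<iota> b" "b \<noteq> \<one>" using bxs e(2) by auto
    then obtain M where M: "M \<in> kernels B" "b \<notin> M" using res(1) bxs(1) unfolding residually_iff by blast
    then show ?thesis using over[OF M(1)] eb bxs(1) by blast
  next
    case False
    define P where "P M c \<longleftrightarrow> (\<forall>S\<in>{H, K}. c \<notin> S \<longrightarrow> (\<forall>s\<in>S. c \<otimes> inv s \<notin> M))" for M c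
    have "\<exists>M\<in>kernels B. \<forall>c\<in>snd ` set xs. P M c"
    proof (rule kernels_finite_choice[OF small group_axioms])
      fix c assume "c \<in> snd ` set xs"
      then have c: "c \<in> carrier B" using bxs(2) by blast
      have sep: "\<exists>M\<in>kernels B. c \<notin> S \<longrightarrow> (\<forall>s\<in>S. c \<otimes> inv s \<notin> M)"
        if S: "S \<lhd> B" "residually C (B Mod S)" for S
      proof (cases "c \<in> S")
        case False
        then obtain M where M: "M \<in> kernels B" "S \<subseteq> M" "c \<notin> M"
          using residually_Mod_separates[OF S c] by blast
        interpret M: normal M B using kernelsD(1)[OF M(1)] .
        have "c \<otimes> inv s \<notin> M" if "s \<in> S" for s
        proof
          assume "c \<otimes> inv s \<in> M"
          then have "c \<otimes> inv s \<otimes> s \<in> M" using that M(2) M.m_closed by blast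
          moreover have "s \<in> carrier B" using that M(2) M.subset by blast
          ultimately show False using c M(3) by (simp add: m_assoc)
        qed
        then show ?thesis using M(1) by blast
      qed (use carrier_in_kernels[OF group_axioms] in blast)
      obtain M1 where M1: "M1 \<in> kernels B" "c \<notin> H \<longrightarrow> (\<forall>s\<in>H. c \<otimes> inv s \<notin> M1)"
        using sep[OF normal_H res(2)] by blast
      obtain M2 where M2: "M2 \<in> kernels B" "c \<notin> K \<longrightarrow> (\<forall>s\<in>K. c \<otimes> inv s \<notin> M2)"
        using sep[OF normal_K res(3)] by blast
      show "\<exists>M\<in>kernels B. P M c"
        using kernels_Int[OF small M1(1) M2(1)]
        by (rule bexI[rotated]) (use M1(2) M2(2) in \<open>auto simp: P_def\<close>)
    qed (auto simp: P_def)
    then obtain M where M: "M \<in> kernels B" "\<And>c. c \<in> snd ` set xs \<Longrightarrow> P M c" by blast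
    obtain T where T: "T \<in> kernels E" "\<And>c. c \<in> carrier B \<Longrightarrow> \<iota> c \<in> T \<Longrightarrow> c \<in> M"
      using over[OF M(1)] by blast
    interpret T: normal T E using kernelsD(1)[OF T(1)] .
    have red: "c \<in> S" if c: "c \<in> snd ` set xs" "\<iota> c \<in> base_translate T S" and S: "S = H \<or> S = K" for c S
    proof (rule ccontr)
      assume "c \<notin> S"
      obtain y s where ys: "y \<in> T" "s \<in> S" "\<iota> c = y \<cdot> \<iota> s" using c(2) by (auto simp: in_base_translate_iff)
      have cB: "c \<in> carrier B" and sB: "s \<in> carrier B" using c(1) bxs(2) ys(2) S H_subset K_subset by auto
      have "\<iota> (c \<otimes> inv s) = y" using ys cB sB T.mem_carrier[OF ys(1)] by (simp add: E.m_assoc)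
      then have "c \<otimes> inv s \<in> M" using T(2)[of "c \<otimes> inv s"] ys(1) cB sB by simp
      then show False using M(2)[OF c(1)] \<open>c \<notin> S\<close> S ys(2) by (auto simp: P_def)
    qed
    have "reduced_mod T xs"
      unfolding reduced_mod_def
    proof (rule successively_mono[OF bxs(4)])
      fix x y assume *: "x \<in> set xs" "y \<in> set xs" "no_pinch H K x y"
      then show "no_pinch {b. \<iota> b \<in> base_translate T H} {b. \<iota> b \<in> base_translate T K} x y"
        using red[of "snd x" H] red[of "snd x" K] by (auto simp: no_pinch_def)
    qed
    then obtain M' where M': "M' \<in> kernels E" "val xs \<notin> base_translate M' (carrier B)"
      using separate_reduced_word_in_class[OF T(1) False bxs(2)] by blast
    interpret M': normal M' E using kernelsD(1)[OF M'(1)] .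
    have "e \<notin> M'"
    proof
      assume "e \<in> M'"
      then have "inv\<^sub>E \<iota> b \<cdot> e \<cdot> \<iota> b \<in> M'" using M'.inv_op_closed1 bxs(1) by simp
      then have "inv\<^sub>E \<iota> b \<cdot> e \<cdot> \<iota> b \<cdot> \<iota> (inv b) \<in> base_translate M' (carrier B)"
        using bxs(1) by (intro base_translateI) simp_all
      moreover have "inv\<^sub>E \<iota> b \<cdot> e \<cdot> \<iota> b \<cdot> \<iota> (inv b) = val xs"
        using bxs(1,3) val_closed[OF bxs(2)] by (simp add: E.m_assoc E.mult_inv_mult)
      ultimately show False using M'(2) by simp
    qed
    then show ?thesis using M'(1) by blast
  qed
qed

lemma residually_base_if_residually_E:
  assumes "residually C E" shows "residually C B"
  unfolding residually_iff
proof (intro conjI ballI impI)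
  show "group B" by (rule group_axioms)
  fix b assume b: "b \<in> carrier B" "b \<noteq> \<one>"
  have "\<iota> b \<noteq> \<one>\<^sub>E" using b inj_onD[OF \<iota>_inj _ b(1) one_closed] by auto
  then have "\<exists>T\<in>kernels E. \<iota> b \<notin> T" using assms b(1) by (simp add: residually_iff)
  then obtain T where T: "T \<in> kernels E" "\<iota> b \<notin> T" by (elim bexE)
  show "\<exists>M\<in>kernels B. b \<notin> M"
    using kernels_vimage[OF group_axioms T(1) \<iota>_hom] by (rule bexI[rotated]) (use T(2) in simp)
qed

lemma small_subset: "S \<subseteq> carrier B \<Longrightarrow> carrier (B\<lparr>carrier := S\<rparr>) \<lesssim> (UNIV :: 'u set)"
  using lepoll_trans[OF subset_imp_lepoll small] by simp

lemma kernels_restrict: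
  assumes "M \<in> kernels B" "subgroup S B" shows "{s \<in> S. s \<in> M} \<in> kernels (B\<lparr>carrier := S\<rparr>)"
proof -
  have "(\<lambda>x. x) \<in> hom (B\<lparr>carrier := S\<rparr>) B"
    using subgroup.subset[OF assms(2)] by (auto simp: hom_def)
  from kernels_vimage[OF subgroup.subgroup_is_group[OF assms(2) group_axioms] assms(1) this]
  show ?thesis by simp
qed

lemma finite_cosets_of_associated_subgroups:
  assumes "finite (carrier (B\<lparr>carrier := H\<rparr> Mod L))"
  shows "finite ((#>) K ` H)" "finite ((#>) H ` K)"
proof -
  have "carrier (B\<lparr>carrier := H\<rparr> Mod L) = (#>) L ` H"
    by (simp add: carrier_FactGroup r_coset_def)
  then have fin: "finite ((#>) L ` H)" using assms by simp
  have HB: "h \<in> carrier B" if "h \<in> H" for h using that H_subset by blast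
  show "finite ((#>) K ` H)"
  proof (rule finite_image_factor[OF fin])
    fix x y assume xy: "x \<in> H" "y \<in> H" "L #> x = L #> y"
    then have "x \<otimes> inv y \<in> L" using coset_eq_iff[OF normal_L HB HB] by blast
    then show "K #> x = K #> y" using coset_eq_iff[OF normal_K HB[OF xy(1)] HB[OF xy(2)]] by blast
  qed
  have "finite ((\<lambda>h. H #> \<phi> h) ` H)"
  proof (rule finite_image_factor[OF fin])
    fix x y assume xy: "x \<in> H" "y \<in> H" "L #> x = L #> y"
    then have "x \<otimes> inv y \<in> L" using coset_eq_iff[OF normal_L HB HB] by blast
    then have "\<phi> x \<otimes> inv (\<phi> y) \<in> H" using \<phi>_L[of "x \<otimes> inv y"] \<phi>_div[OF xy(1,2)] by simp
    then show "H #> \<phi> x = H #> \<phi> y"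
      using coset_eq_iff[OF normal_H \<phi>_carrier[OF xy(1)] \<phi>_carrier[OF xy(2)]] by blast
  qed
  then show "finite ((#>) H ` K)" by (simp add: image_image \<phi>_image[symmetric])
qed

text \<open>
  As \<open>HK/K\<close> and \<open>HK/H\<close> are finite, there is \<open>N \<in> \<C>\<^sup>*(B)\<close> with \<open>N \<inter> HK \<subseteq> L\<close>.  Then \<open>N \<inter> H\<close>, \<open>N \<inter> K\<close> and \<open>N \<inter> HK\<close>
  coincide with \<open>N \<inter> L\<close>, which is \<open>\<phi>\<close>-invariant because it consists of the \<open>n\<close>-th powers in \<open>L\<close> for some \<open>n\<close>.
\<close>

lemma cofinal_if_finite_index:
  assumes lc: "locally_cyclic_in B H" and fin: "finite (carrier (B\<lparr>carrier := H\<rparr> Mod L))"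
    and res: "residually C (B Mod H)" "residually C (B Mod K)" and M: "M \<in> kernels B"
  shows "\<exists>N\<in>kernels B. N \<subseteq> M \<and> \<phi> ` (N \<inter> H) = N \<inter> K \<and> N \<inter> (H <#> K) \<subseteq> (N \<inter> H) <#> (N \<inter> K)"
proof -
  have HB: "h \<in> carrier B" if "h \<in> H" for h using that H_subset by blast
  have KB: "k \<in> carrier B" if "k \<in> K" for k using that K_subset by blast
  obtain N1 where N1: "N1 \<in> kernels B" "K \<subseteq> N1" "N1 \<inter> H \<subseteq> K"
    using residually_Mod_separates_finite[OF small normal_K res(2) H_subset finite_cosets_of_associated_subgroups(1)[OF fin]] by blast
  obtain N2 where N2: "N2 \<in> kernels B" "H \<subseteq> N2" "N2 \<inter> K \<subseteq> H"
    using residually_Mod_separates_finite[OF small normal_H res(1) K_subset finite_cosets_of_associated_subgroups(2)[OF fin]] by blast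
  interpret N1: normal N1 B using kernelsD(1)[OF N1(1)] .
  interpret N2: normal N2 B using kernelsD(1)[OF N2(1)] .
  define N where "N = M \<inter> (N1 \<inter> N2)"
  have N: "N \<in> kernels B" unfolding N_def by (intro kernels_Int[OF small] M N1(1) N2(1))
  interpret N: normal N B using kernelsD(1)[OF N] .
  have NL: "x \<in> L" if x: "x \<in> N" "x \<in> H <#> K" for x
  proof -
    obtain h k where hk: "h \<in> H" "k \<in> K" "x = h \<otimes> k" using x(2) by (auto simp: set_mult_def)
    have x12: "x \<in> N1" "x \<in> N2" using x(1) by (auto simp: N_def)
    have "x \<otimes> inv k \<in> N1" using x12 hk(2) N1(2) by (intro N1.m_closed N1.m_inv_closed) auto
    then have "h \<in> N1" using hk HB KB by (simp add: m_assoc)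
    then have hK: "h \<in> K" using N1(3) hk(1) by blast
    have "inv h \<otimes> x \<in> N2" using x12 hk(1) N2(2) by (intro N2.m_closed N2.m_inv_closed) auto
    then have "k \<in> N2" using hk HB KB by (simp add: mult_inv_mult)
    then have kH: "k \<in> H" using N2(3) hk(2) by blast
    show ?thesis
      using hk hK kH subgroup.m_closed[OF subgroup_H hk(1) kH] subgroup.m_closed[OF subgroup_K hK hk(2)] by simp
  qed
  note sub = normal_HK[OF normal_H normal_K]
  have NH: "N \<inter> H = N \<inter> L" and NK: "N \<inter> K = N \<inter> L" using NL sub(2,3) by blast+
  have "{l \<in> L. l \<in> N} \<in> kernels (B\<lparr>carrier := L\<rparr>)" by (rule kernels_restrict[OF N subgroup_L])
  then obtain n :: nat where n: "{l \<in> L. l \<in> N} = (\<lambda>l. l [^] n) ` L"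
    using kernel_of_locally_cyclic_is_power[OF group_axioms subgroup_L locally_cyclic_in_subset[OF lc]] by blast
  have "N \<inter> L = (\<lambda>l. l [^] n) ` L" using n by blast
  moreover have "\<phi> ` (\<lambda>l. l [^] n) ` L = (\<lambda>l. l [^] n) ` \<phi> ` L"
    unfolding image_image by (rule image_cong) (auto simp: \<phi>_pow)
  ultimately have \<phi>NL: "\<phi> ` (N \<inter> L) = N \<inter> L" by (simp add: \<phi>_Int)
  have "N \<inter> (H <#> K) \<subseteq> (N \<inter> H) <#> (N \<inter> K)"
  proof
    fix x assume "x \<in> N \<inter> (H <#> K)"
    then have x: "x \<in> N \<inter> H" "x \<in> carrier B" using NL HB by auto
    have "\<one> \<in> N \<inter> K" using subgroup.one_closed[OF subgroup_K] by simp
    then have "x \<otimes> \<one> \<in> (N \<inter> H) <#> (N \<inter> K)" by (rule set_multI[OF x(1)])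
    then show "x \<in> (N \<inter> H) <#> (N \<inter> K)" using x(2) by simp
  qed
  moreover have "\<phi> ` (N \<inter> H) = N \<inter> K" unfolding NH NK by (rule \<phi>NL)
  moreover have "N \<subseteq> M" by (simp add: N_def)
  ultimately show ?thesis using N by (intro bexI[OF _ N]) simp
qed

lemma power_image_normal:
  assumes "A \<lhd> B" "subgroup ((\<lambda>a. a [^] (n::nat)) ` A) B"
  shows "(\<lambda>a. a [^] n) ` A \<lhd> B"
proof (rule normal_invI[OF assms(2)])
  interpret A: normal A B by fact
  fix x s assume x: "x \<in> carrier B" and "s \<in> (\<lambda>a. a [^] n) ` A"
  then obtain a where a: "a \<in> A" "s = a [^] n" by blast
  have aB: "a \<in> carrier B" using a(1) by simp
  have "x \<otimes> a [^] n \<otimes> inv x = (x \<otimes> a \<otimes> inv x) [^] n" for n :: nat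
  proof (induction n)
    case 0
    then show ?case using x by simp
  next
    case (Suc n)
    have "(x \<otimes> a \<otimes> inv x) [^] Suc n = (x \<otimes> a [^] n \<otimes> inv x) \<otimes> (x \<otimes> a \<otimes> inv x)" using Suc by simp
    also have "\<dots> = x \<otimes> a [^] Suc n \<otimes> inv x" using x aB by (simp add: m_assoc mult_inv_mult)
    finally show ?case ..
  qed
  then show "x \<otimes> s \<otimes> inv x \<in> (\<lambda>a. a [^] n) ` A" using a A.inv_op_closed2[OF x a(1)] by simp
qed

text \<open>
  After shrinking \<open>M\<close> to \<open>M'\<close> with \<open>M' \<inter> L = 1\<close>, the set \<open>S\<close> of all \<open>h \<in> M' \<inter> H\<close> with \<open>h\<phi> \<in> M'\<close> is in \<open>\<C>\<^sup>*(H)\<close>, hence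
  consists of powers, and \<open>S\<close> and \<open>R = S\<phi>\<close> are normal in \<open>B\<close>.  Quasi-regularity provides \<open>N1\<close> with
  \<open>N1 \<inter> HK \<subseteq> S R\<close>, and \<open>N = S R (N1 \<inter> M')\<close> satisfies \<open>N \<inter> HK = S R\<close>.  Since \<open>S R \<inter> L\<close> is trivial, this
  implies \<open>N \<inter> H = S\<close> and \<open>N \<inter> K = R\<close>.
\<close>

lemma cofinal_if_quasi_regular:
  assumes lc: "locally_cyclic_in B H" and fin: "finite L" and res: "residually C B"
    and qr: "quasi_regular C B (H <#> K)" and M: "M \<in> kernels B"
  shows "\<exists>N\<in>kernels B. N \<subseteq> M \<and> \<phi> ` (N \<inter> H) = N \<inter> K \<and> N \<inter> (H <#> K) \<subseteq> (N \<inter> H) <#> (N \<inter> K)"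
proof -
  have HB: "h \<in> carrier B" if "h \<in> H" for h using that H_subset by blast
  have KB: "k \<in> carrier B" if "k \<in> K" for k using that K_subset by blast
  have LB: "L \<subseteq> carrier B" using H_subset by blast
  obtain N0 where N0: "N0 \<in> kernels B" "N0 \<inter> L \<subseteq> {\<one>}"
    using residually_separates_finite[OF small res fin LB] by blast
  define M' where "M' = M \<inter> N0"
  have M': "M' \<in> kernels B" unfolding M'_def by (rule kernels_Int[OF small M N0(1)])
  interpret M': normal M' B using kernelsD(1)[OF M'] .
  have M'L: "x = \<one>" if "x \<in> M'" "x \<in> H" "x \<in> K" for x using that N0(2) by (auto simp: M'_def)
  define S where "S = {h \<in> H. h \<in> M'} \<inter> {h \<in> H. \<phi> h \<in> M'}"
  define R where "R = \<phi> ` S"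
  have gH: "group (B\<lparr>carrier := H\<rparr>)" and gK: "group (B\<lparr>carrier := K\<rparr>)"
    using subgroup.subgroup_is_group[OF _ group_axioms] subgroup_H subgroup_K by blast+
  have "\<phi> \<in> hom (B\<lparr>carrier := H\<rparr>) B"
    by (rule homI) (use \<phi>_carrier \<phi>_mult in simp_all)
  from kernels_vimage[OF gH M' this] kernels_restrict[OF M' subgroup_H]
  have S: "S \<in> kernels (B\<lparr>carrier := H\<rparr>)"
    unfolding S_def by (intro kernels_Int[OF small_subset[OF H_subset]]) simp_all
  define \<psi> where "\<psi> = inv_into H \<phi>"
  have \<psi>: "\<psi> k \<in> H" "\<phi> (\<psi> k) = k" if "k \<in> K" for k
    using that \<phi>_image unfolding \<psi>_def by (auto simp: f_inv_into_f inv_into_into)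
  have \<psi>\<phi>: "\<psi> (\<phi> h) = h" if "h \<in> H" for h using that \<phi>_inj by (simp add: \<psi>_def)
  have "\<psi> \<in> hom (B\<lparr>carrier := K\<rparr>) (B\<lparr>carrier := H\<rparr>)"
    using group.iso_set_sym[OF gH iso] by (simp add: \<psi>_def iso_imp_homomorphism)
  from kernels_vimage[OF gK S this]
  have "{k \<in> K. \<psi> k \<in> S} \<in> kernels (B\<lparr>carrier := K\<rparr>)" by simp
  moreover have "{k \<in> K. \<psi> k \<in> S} = R"
    unfolding R_def
  proof (intro equalityI subsetI)
    fix k assume "k \<in> {k \<in> K. \<psi> k \<in> S}"
    then have "k = \<phi> (\<psi> k)" "\<psi> k \<in> S" using \<psi>(2) by auto
    then show "k \<in> \<phi> ` S" by (rule image_eqI)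
  next
    fix k assume "k \<in> \<phi> ` S"
    then obtain h where "h \<in> S" "k = \<phi> h" by blast
    moreover from this have "h \<in> H" by (simp add: S_def)
    ultimately show "k \<in> {k \<in> K. \<psi> k \<in> S}" using \<psi>\<phi> \<phi>_mem by simp
  qed
  ultimately have R: "R \<in> kernels (B\<lparr>carrier := K\<rparr>)" by simp
  have sS: "subgroup S B"
    using incl_subgroup[OF subgroup_H normal_imp_subgroup[OF kernelsD(1)[OF S]]] .
  have sR: "subgroup R B"
    using incl_subgroup[OF subgroup_K normal_imp_subgroup[OF kernelsD(1)[OF R]]] .
  obtain n :: nat where n: "S = (\<lambda>h. h [^] n) ` H"
    using kernel_of_locally_cyclic_is_power[OF group_axioms subgroup_H lc S] by blast
  have nS: "S \<lhd> B" using power_image_normal[OF normal_H, of n] sS n by simp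
  have "R = (\<lambda>k. k [^] n) ` K"
    unfolding R_def n \<phi>_image[symmetric] image_image by (rule image_cong) (auto simp: \<phi>_pow)
  then have nR: "R \<lhd> B" using power_image_normal[OF normal_K, of n] sR by simp
  have SM: "s \<in> M'" "s \<in> H" if "s \<in> S" for s using that by (simp_all add: S_def)
  have RM: "r \<in> M'" "r \<in> K" if "r \<in> R" for r using that \<phi>_mem by (auto simp: R_def S_def)
  define M0 where "M0 = S <#> R"
  have M0: "M0 \<in> kernels (B\<lparr>carrier := H <#> K\<rparr>)"
    unfolding M0_def by (rule kernels_set_mult[OF group_axioms small normal_H normal_K nS nR S R])
  have nM0: "M0 \<lhd> B" unfolding M0_def by (rule normal_subgroup_set_mult_closed[OF nS nR])
  interpret M0: normal M0 B by (rule nM0)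
  have M0M: "x \<in> M'" if x: "x \<in> M0" for x
  proof -
    obtain s r where "s \<in> S" "r \<in> R" "x = s \<otimes> r" using x by (auto simp: M0_def set_mult_def)
    then show ?thesis using SM RM by simp
  qed
  obtain N1 where N1: "N1 \<in> kernels B" "N1 \<inter> (H <#> K) \<subseteq> M0"
    using qr M0 unfolding quasi_regular_def by blast
  have N1M: "N1 \<inter> M' \<in> kernels B" by (rule kernels_Int[OF small N1(1) M'])
  define N where "N = M0 <#> (N1 \<inter> M')"
  note nN1M = kernelsD(1)[OF N1M]
  have nN: "N \<lhd> B" unfolding N_def by (rule normal_subgroup_set_mult_closed[OF nM0 nN1M])
  note inc = subset_set_mult[OF M0.subgroup_axioms normal_imp_subgroup[OF nN1M], folded N_def]
  have N: "N \<in> kernels B" by (rule kernels_upward[OF N1M inc(2) nN])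
  have NM: "x \<in> M'" if x: "x \<in> N" for x
  proof -
    obtain m y where "m \<in> M0" "y \<in> N1 \<inter> M'" "x = m \<otimes> y" using x by (auto simp: N_def set_mult_def)
    then show ?thesis using M0M by simp
  qed
  interpret HK: normal "H <#> K" B using normal_HK(1)[OF normal_H normal_K] .
  have M0_HK: "M0 \<subseteq> H <#> K"
    unfolding M0_def by (rule mono_set_mult) (use SM RM in blast)+
  have N_HK: "x \<in> M0" if x: "x \<in> N" "x \<in> H <#> K" for x
  proof -
    obtain m y where my: "m \<in> M0" "y \<in> N1 \<inter> M'" "x = m \<otimes> y" using x(1) by (auto simp: N_def set_mult_def)
    have yB: "y \<in> carrier B" using my(2) by auto
    have "inv m \<otimes> x \<in> H <#> K" using my(1) M0_HK x(2) by (intro HK.m_closed HK.m_inv_closed) auto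
    then have "y \<in> H <#> K" using my yB by (simp add: mult_inv_mult)
    then have "y \<in> M0" using my(2) N1(2) by blast
    then show ?thesis using my by simp
  qed
  have M0_S: "x \<in> S" if x: "x \<in> M0" "x \<in> H" for x
  proof -
    obtain s r where sr: "s \<in> S" "r \<in> R" "x = s \<otimes> r" using x(1) by (auto simp: M0_def set_mult_def)
    have "inv s \<otimes> x \<in> H" using SM(2)[OF sr(1)] x(2) subgroup_H by (simp add: subgroup.m_closed subgroup.m_inv_closed)
    then have "r \<in> H" using sr SM(2)[OF sr(1)] RM(2)[OF sr(2)] HB KB by (simp add: mult_inv_mult)
    then have "r = \<one>" using M'L RM[OF sr(2)] by blast
    then show ?thesis using sr HB[OF SM(2)[OF sr(1)]] by simp
  qed
  have M0_R: "x \<in> R" if x: "x \<in> M0" "x \<in> K" for x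
  proof -
    obtain s r where sr: "s \<in> S" "r \<in> R" "x = s \<otimes> r" using x(1) by (auto simp: M0_def set_mult_def)
    have "x \<otimes> inv r \<in> K" using RM(2)[OF sr(2)] x(2) subgroup_K by (simp add: subgroup.m_closed subgroup.m_inv_closed)
    then have "s \<in> K" using sr SM(2)[OF sr(1)] RM(2)[OF sr(2)] HB KB by (simp add: m_assoc)
    then have "s = \<one>" using M'L SM[OF sr(1)] by blast
    then show ?thesis using sr KB[OF RM(2)[OF sr(2)]] by simp
  qed
  note sub = normal_HK[OF normal_H normal_K]
  note incM0 = subset_set_mult[OF sS sR, folded M0_def]
  have NH: "N \<inter> H = S"
  proof
    show "N \<inter> H \<subseteq> S" using N_HK M0_S sub(2) by blast
    show "S \<subseteq> N \<inter> H" using incM0(1) inc(1) SM(2) by blast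
  qed
  have NK: "N \<inter> K = R"
  proof
    show "N \<inter> K \<subseteq> R" using N_HK M0_R sub(3) by blast
    show "R \<subseteq> N \<inter> K" using incM0(2) inc(1) RM(2) by blast
  qed
  have "N \<inter> (H <#> K) \<subseteq> (N \<inter> H) <#> (N \<inter> K)" unfolding NH NK M0_def[symmetric] using N_HK by blast
  moreover have "N \<subseteq> M" using NM by (auto simp: M'_def)
  moreover have "\<phi> ` (N \<inter> H) = N \<inter> K" unfolding NH NK R_def ..
  ultimately show ?thesis by (intro bexI[OF _ N]) simp
qed

section \<open>Necessary conditions\<close>

text \<open>
  Both associated subgroups are treated at once: for \<open>s = False\<close> the lemma concerns \<open>U = H\<close> and \<open>x = t\<^sup>-\<^sup>1 b t\<close>, for
  \<open>s = True\<close> it concerns \<open>U = K\<close> and \<open>x = t b t\<^sup>-\<^sup>1\<close>.  The word \<open>xs\<close> represents the commutator of \<open>x\<close> and its conjugate by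
  \<open>c\<close>.  It is reduced, so some kernel \<open>T\<close> of \<open>E\<close> avoids it.  If \<open>b\<close> were in \<open>U\<close> modulo \<open>T\<close>, then \<open>x\<close> and its
  conjugate would be in \<open>V\<close> modulo \<open>T\<close> and would commute.
\<close>

lemma residual_separates_associated_subgroup:
  fixes s :: bool
  defines "U \<equiv> if s then K else H" and "V \<equiv> if s then H else K"
  assumes lc: "locally_cyclic_in B H" and res: "residually C E"
    and b: "b \<in> carrier B" "b \<notin> U" and c: "c \<in> carrier B" "c \<notin> V"
  shows "\<exists>M\<in>kernels B. U \<subseteq> M \<and> b \<notin> M"
proof -
  have UV: "U \<lhd> B" "V \<lhd> B" "U \<subseteq> carrier B" "V \<subseteq> carrier B" "subgroup U B" "subgroup V B"
    using normal_H normal_K H_subset K_subset subgroup_H subgroup_K by (auto simp: U_def V_def)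
  interpret U: normal U B by fact
  interpret V: normal V B by fact
  have V_comm: "x \<otimes> y = y \<otimes> x" if "x \<in> V" "y \<in> V" for x y
    using locally_cyclic_in_commute[OF lc H_subset, of x y]
      comm_image_of_locally_cyclic[OF subgroup_H lc iso_imp_homomorphism[OF iso] \<phi>_image, of x y] that
    by (auto simp: V_def split: if_splits)
  have turn: "\<exists>v\<in>V. letter s \<cdot> \<iota> u \<cdot> letter (\<not> s) = \<iota> v" if u: "u \<in> U" for u
  proof (cases s)
    case True
    then obtain h where h: "h \<in> H" "u = \<phi> h" using u \<phi>_image by (auto simp: U_def)
    have "t \<cdot> \<iota> u \<cdot> inv\<^sub>E t = \<iota> h \<cdot> t \<cdot> inv\<^sub>E t" using t_swap[OF h(1)] h(2) by simp
    also have "\<dots> = \<iota> h" using h(1) H_subset by (auto simp: E.m_assoc)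
    finally show ?thesis using True h(1) by (auto simp: letter_def V_def)
  next
    case False
    then show ?thesis using u t_conj[of u] \<phi>_mem[of u] by (auto simp: letter_def U_def V_def)
  qed
  have letter_inv: "inv\<^sub>E letter r = letter (\<not> r)" for r by (simp add: letter_def)
  define xs where "xs = [(s, b), (\<not> s, inv c), (s, b), (\<not> s, c), (s, inv b), (\<not> s, inv c), (s, inv b), (\<not> s, c)]"
  have inv_notin: "inv b \<notin> U" "inv c \<notin> V"
    using b c U.m_inv_closed[of "inv b"] V.m_inv_closed[of "inv c"] by auto
  have xsB: "snd ` set xs \<subseteq> carrier B" using b c by (simp add: xs_def)
  have "successively (no_pinch H K) xs"
    using b(2) c(2) inv_notin by (cases s) (simp_all add: xs_def no_pinch_def U_def V_def)
  then have "val xs \<notin> \<iota> ` carrier B" using britton[OF _ xsB] by (simp add: xs_def)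
  then have "val xs \<noteq> \<one>\<^sub>E" using \<iota>.hom_one one_closed by (metis imageI)
  then have "\<exists>T\<in>kernels E. val xs \<notin> T" using res val_closed[OF xsB] by (simp add: residually_iff)
  then obtain T where T: "T \<in> kernels E" "val xs \<notin> T" by (elim bexE)
  obtain G p where G: "G \<in> C" "p \<in> epi E G" "T = {x \<in> carrier E. p x = \<one>\<^bsub>G\<^esub>}" using kernelsE[OF T(1)] .
  interpret G: group G using member_group[OF G(1)] .
  interpret p: group_hom E G p
    using G(2) by (simp add: group_hom_def group_hom_axioms_def E.group_axioms G.group_axioms epi_def)
  define M where "M = {x \<in> carrier B. \<iota> x \<in> T}"
  have M: "M \<in> kernels B" unfolding M_def by (rule kernels_vimage[OF group_axioms T(1) \<iota>_hom])
  note nM = kernelsD(1)[OF M]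
  note inc = subset_set_mult[OF normal_imp_subgroup[OF nM] UV(5)]
  have MU: "M <#> U \<in> kernels B"
    by (rule kernels_upward[OF M inc(1) normal_subgroup_set_mult_closed[OF nM UV(1)]])
  have "b \<notin> M <#> U"
  proof
    assume "b \<in> M <#> U"
    then obtain m u where mu: "m \<in> M" "u \<in> U" "b = m \<otimes> u" by (auto simp: set_mult_def)
    have uB: "u \<in> carrier B" using mu(2) by simp
    have m: "m \<in> carrier B" "p (\<iota> m) = \<one>\<^bsub>G\<^esub>" using mu(1) G(3) by (simp_all add: M_def)
    have pb: "p (\<iota> b) = p (\<iota> u)" using mu(3) m uB by simp
    obtain v where v: "v \<in> V" "letter s \<cdot> \<iota> u \<cdot> letter (\<not> s) = \<iota> v" using turn[OF mu(2)] by blast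
    have vB: "v \<in> carrier B" using v(1) by simp
    define X where "X = letter s \<cdot> \<iota> b \<cdot> letter (\<not> s)"
    have X: "X \<in> carrier E" using b by (simp add: X_def)
    have pX: "p X = p (\<iota> v)"
      unfolding X_def v(2)[symmetric] using b(1) uB pb by simp
    have invX: "inv\<^sub>E X = letter s \<cdot> \<iota> (inv b) \<cdot> letter (\<not> s)"
      using b(1) letter_inv[of s] letter_inv[of "\<not> s"] by (simp add: X_def E.inv_mult_group E.m_assoc)
    define d where "d = inv c \<otimes> v \<otimes> c"
    have d: "d \<in> V" "d \<in> carrier B" "inv d = inv c \<otimes> inv v \<otimes> c"
      using V.inv_op_closed1[OF c(1) v(1)] c(1) vB by (simp_all add: d_def inv_mult_group m_assoc)
    have "val xs = X \<cdot> (\<iota> (inv c) \<cdot> X \<cdot> \<iota> c) \<cdot> inv\<^sub>E X \<cdot> (\<iota> (inv c) \<cdot> inv\<^sub>E X \<cdot> \<iota> c)"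
      unfolding invX unfolding X_def using b(1) c(1) by (simp add: xs_def E.m_assoc del: \<iota>.hom_inv)
    then have "p (val xs) = p (\<iota> (v \<otimes> d \<otimes> inv v \<otimes> inv d))"
      using X b(1) c(1) vB pX by (simp add: d(3) d_def G.inv_mult_group G.m_assoc)
    also have "v \<otimes> d \<otimes> inv v \<otimes> inv d = \<one>"
      using V_comm[OF v(1) d(1)] vB d(2) by (simp add: m_assoc mult_inv_mult)
    finally have "val xs \<in> T" using G(3) val_closed[OF xsB] by simp
    then show False using T(2) by contradiction
  qed
  then show ?thesis using MU inc(2) by (intro bexI[OF _ MU]) simp
qed

text \<open>
  The auxiliary element \<open>c\<close> exists unless the other associated subgroup is all of \<open>B\<close>; by \<open>L\<phi> = L\<close> both
  are then equal to \<open>B\<close>, and there is nothing to separate.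
\<close>

lemma residually_Mod_if_residually_E:
  assumes lc: "locally_cyclic_in B H" and res: "residually C E"
  shows "residually C (B Mod H)" "residually C (B Mod K)"
proof -
  have all: "H = carrier B" if "K = carrier B"
  proof -
    have "H \<inter> K = H" using that H_subset by blast
    then show ?thesis using \<phi>_Int \<phi>_image that by simp
  qed
  have all': "K = carrier B" if "H = carrier B"
  proof -
    have "H \<inter> K = K" using that K_subset by blast
    then have "\<phi> ` K = \<phi> ` H" using \<phi>_Int \<phi>_image by simp
    then show ?thesis using that \<phi>_inj K_subset inj_on_image_eq_iff[of \<phi> H K H] by simp
  qed
  show "residually C (B Mod H)"
  proof (rule residually_ModI[OF normal_H])
    fix x assume x: "x \<in> carrier B" "x \<notin> H"
    then obtain c where "c \<in> carrier B" "c \<notin> K" using all K_subset by blast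
    then show "\<exists>T\<in>kernels B. H \<subseteq> T \<and> x \<notin> T"
      using residual_separates_associated_subgroup[OF lc res, of x False c] x by simp
  qed
  show "residually C (B Mod K)"
  proof (rule residually_ModI[OF normal_K])
    fix x assume x: "x \<in> carrier B" "x \<notin> K"
    then obtain c where "c \<in> carrier B" "c \<notin> H" using all' H_subset by blast
    then show "\<exists>T\<in>kernels B. K \<subseteq> T \<and> x \<notin> T"
      using residual_separates_associated_subgroup[OF lc res, of x True c] x by simp
  qed
qed

text \<open>
  A kernel of \<open>E\<close> that meets the normal subgroup \<open>L\<close> trivially centralizes it.  Hence the group of automorphisms of \<open>L\<close>
  induced by \<open>E\<close> is in the class, and with it the subgroup generated by \<open>\<phi>\<close>.
\<close>

lemma restricted_aut_group_in_class:
  assumes fin: "finite L" and res: "residually C E"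
  shows "in_class C (restricted_aut_group B L \<phi>)"
proof -
  interpret \<Gamma>: group \<Gamma> by (rule group_\<Gamma>)
  have LB: "x \<in> carrier B" if "x \<in> L" for x using that H_subset by blast
  obtain P where P: "P \<in> hom E \<Gamma>" "P t = inv\<^bsub>\<Gamma>\<^esub> (restrict \<phi> L)"
      "\<And>e x. e \<in> carrier E \<Longrightarrow> x \<in> L \<Longrightarrow> P e x \<in> L"
      "\<And>e x. e \<in> carrier E \<Longrightarrow> x \<in> L \<Longrightarrow> e \<cdot> \<iota> x = \<iota> (P e x) \<cdot> e"
    by (rule ex_conjugation_action) (rule that; assumption)
  interpret P: group_hom E \<Gamma> P
    using P(1) by (simp add: group_hom_def group_hom_axioms_def E.group_axioms \<Gamma>.group_axioms)
  have "\<iota> ` L \<subseteq> carrier E" using LB by auto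
  then obtain T where T: "T \<in> kernels E" "T \<inter> \<iota> ` L \<subseteq> {\<one>\<^sub>E}"
    using residually_separates_finite[OF small_E res finite_imageI[OF fin]] by blast
  interpret T: normal T E using kernelsD(1)[OF T(1)] .
  have trivial: "P y = \<one>\<^bsub>\<Gamma>\<^esub>" if y: "y \<in> T" for y
  proof (rule auto_eqI)
    have yE: "y \<in> carrier E" using T.mem_carrier[OF y] .
    show "P y \<in> auto (B\<lparr>carrier := L\<rparr>)" using P.hom_closed[OF yE] by (simp add: carrier_AutoGroup)
    show "\<one>\<^bsub>\<Gamma>\<^esub> \<in> auto (B\<lparr>carrier := L\<rparr>)" using \<Gamma>.one_closed unfolding carrier_AutoGroup .
    fix x assume "x \<in> carrier (B\<lparr>carrier := L\<rparr>)"
    then have x: "x \<in> L" by simp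
    have PxL: "P y x \<in> L" using P(3)[OF yE x] .
    have "\<iota> (P y x \<otimes> inv x) = y \<cdot> \<iota> x \<cdot> inv\<^sub>E y \<cdot> inv\<^sub>E \<iota> x"
      unfolding P(4)[OF yE x] using yE LB[OF x] LB[OF PxL] by (simp add: E.m_assoc)
    also have "\<dots> = y \<cdot> (\<iota> x \<cdot> inv\<^sub>E y \<cdot> inv\<^sub>E \<iota> x)" using yE LB[OF x] by (simp add: E.m_assoc)
    also have "\<dots> \<in> T" using y T.inv_op_closed2[OF \<iota>_closed[OF LB[OF x]] T.m_inv_closed[OF y]] by simp
    finally have "\<iota> (P y x \<otimes> inv x) \<in> T" .
    moreover have "P y x \<otimes> inv x \<in> L"
      by (rule subgroup.m_closed[OF subgroup_L PxL subgroup.m_inv_closed[OF subgroup_L x]])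
    ultimately have "\<iota> (P y x \<otimes> inv x) = \<one>\<^sub>E" using T(2) by blast
    then have "P y x \<otimes> inv x = \<one>"
      using inj_onD[OF \<iota>_inj, of "P y x \<otimes> inv x" \<one>] LB[OF x] LB[OF PxL] by simp
    then have "P y x = x" using LB[OF x] LB[OF PxL] by (metis inv_closed inv_equality inv_inv)
    then show "P y x = \<one>\<^bsub>\<Gamma>\<^esub> x" using x by (simp add: AutoGroup_one)
  qed
  let ?A = "\<Gamma>\<lparr>carrier := P ` carrier E\<rparr>"
  have sub: "subgroup (P ` carrier E) \<Gamma>" by (rule P.img_is_subgroup)
  have gA: "group ?A" using subgroup.subgroup_is_group[OF sub \<Gamma>.group_axioms] .
  have "P \<in> epi E ?A" unfolding epi_def using P(1) by (auto simp: hom_def)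
  then have cA: "in_class C ?A"
    using in_class_epi_kernel[OF T(1) gA, of P] trivial by simp
  have "restrict \<phi> L = P (inv\<^sub>E t)"
    using restrict_\<phi>_auto by (simp add: P(2) carrier_AutoGroup)
  then have "restrict \<phi> L \<in> P ` carrier E" by (rule image_eqI) simp
  then have gen: "generate \<Gamma> {restrict \<phi> L} \<subseteq> P ` carrier E"
    using \<Gamma>.generate_subgroup_incl[OF _ sub] by simp
  have "subgroup (generate \<Gamma> {restrict \<phi> L}) \<Gamma>"
    by (rule \<Gamma>.generate_is_subgroup) (simp add: carrier_AutoGroup restrict_\<phi>_auto)
  then have "subgroup (generate \<Gamma> {restrict \<phi> L}) ?A"
    using \<Gamma>.subgroup_incl[OF _ sub gen] by simp
  from in_class_subgroup[OF cA this]
  show ?thesis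
    using restrict_\<phi>_auto by (simp add: restricted_aut_group_def subgroup_generated_def carrier_AutoGroup)
qed

lemma restricted_aut_group_order:
  assumes "restrict \<phi> L [^]\<^bsub>restricted_aut_group B L \<phi>\<^esub> (n::nat) = \<one>\<^bsub>restricted_aut_group B L \<phi>\<^esub>" "x \<in> L"
  shows "(\<phi> ^^ n) x = x"
proof -
  interpret \<Gamma>: group \<Gamma> by (rule group_\<Gamma>)
  have "\<one>\<^bsub>restricted_aut_group B L \<phi>\<^esub> = \<one>\<^bsub>\<Gamma>\<^esub>"
    by (simp add: restricted_aut_group_def subgroup_generated_def)
  moreover have "restrict \<phi> L [^]\<^bsub>restricted_aut_group B L \<phi>\<^esub> n = restrict (\<phi> ^^ n) L"
    unfolding restricted_aut_group_def subgroup_generated_def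
    by (simp only: \<Gamma>.nat_pow_consistent[symmetric] restrict_\<phi>_pow)
  ultimately have "restrict (\<phi> ^^ n) L = \<one>\<^bsub>\<Gamma>\<^esub>" using assms(1) by (simp only:)
  then have "restrict (\<phi> ^^ n) L x = \<one>\<^bsub>\<Gamma>\<^esub> x" by simp
  then show ?thesis using assms(2) by (simp add: AutoGroup_one)
qed

end

section \<open>HNN-extensions with locally cyclic associated subgroups\<close>

theorem theorem6:
  fixes B :: "('a, 'b) monoid_scheme"
    and H K L :: "'a set"
    and \<phi> :: "'a \<Rightarrow> 'a"
    and C :: "'u monoid set"
  assumes "group B"
    and "H \<lhd> B" and "K \<lhd> B"
    and "\<phi> \<in> iso (B\<lparr>carrier := H\<rparr>) (B\<lparr>carrier := K\<rparr>)"
    and "L = H \<inter> K" and "\<phi> ` L = L"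
    (* the universe 'u has room for copies of B and of the HNN-extension *)
    and "infinite (UNIV :: 'u set)" and "carrier B \<lesssim> (UNIV :: 'u set)"
    and "root_class C"
    and "\<forall>G\<in>C. periodic_group G"
    and "quotient_closed C"
    and "locally_cyclic_group (B\<lparr>carrier := H\<rparr>)"
    and "locally_cyclic_group (B\<lparr>carrier := K\<rparr>)"
  shows
    "(residually C (B Mod H) \<and> residually C (B Mod K) \<longrightarrow>
        (finite (carrier (B\<lparr>carrier := H\<rparr> Mod L)) \<longleftrightarrow> in_class C (B\<lparr>carrier := H\<rparr> Mod L))) \<and>
     (residually C B \<longrightarrow>
        (finite L \<longleftrightarrow> (\<exists>G\<in>C. \<exists>f\<in>epi B G. inj_on f L))) \<and>
     (finite (carrier (B\<lparr>carrier := H\<rparr> Mod L)) \<and>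
      in_class C (restricted_aut_group B L \<phi>) \<and>
      quasi_regular C B L \<longrightarrow>
        (residually C (hnn_extension B H \<phi>) \<longleftrightarrow>
           residually C B \<and> residually C (B Mod H) \<and> residually C (B Mod K))) \<and>
     (finite L \<and> quasi_regular C B (H <#>\<^bsub>B\<^esub> K) \<longrightarrow>
        (residually C (hnn_extension B H \<phi>) \<longleftrightarrow>
           residually C B \<and> residually C (B Mod H) \<and> residually C (B Mod K) \<and>
           in_class C (restricted_aut_group B L \<phi>)))"
proof -
  interpret G: group B by fact
  have L: "L = H \<inter> K" by fact
  interpret hnn_normal_in_class B H K \<phi> C
    using assms
    by (simp add: hnn_normal_in_class_def hnn_normal_def hnn_normal_axioms_def hnn_in_class_def
        hnn_in_class_axioms_def hnn_def hnn_axioms_def root_class_of_periodic_groups_def normal_imp_subgroup)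
  have E: "hnn_extension B H \<phi> = E" by (simp add: E_def)
  have lc: "locally_cyclic_in B H" using G.locally_cyclic_inI[OF subgroup_H assms(12)] .
  have sL: "subgroup L B" and nL: "L \<lhd> B" using subgroup_L normal_L by (simp_all add: L)
  have LB: "L \<subseteq> carrier B" using sL by (rule subgroup.subset)
  have lcL: "locally_cyclic_in B L" using locally_cyclic_in_subset[OF lc] by (simp add: L)
  have nLH: "L \<lhd> B\<lparr>carrier := H\<rparr>"
    using G.normal_restrict_supergroup[OF subgroup_H nL] by (simp add: L)
  have part1: "finite (carrier (B\<lparr>carrier := H\<rparr> Mod L)) \<longleftrightarrow> in_class C (B\<lparr>carrier := H\<rparr> Mod L)"
    if res: "residually C (B Mod H)" "residually C (B Mod K)"
  proof
    assume "finite (carrier (B\<lparr>carrier := H\<rparr> Mod L))"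
    then have "finite ((#>\<^bsub>B\<^esub>) K ` H)" using finite_cosets_of_associated_subgroups(1) by (simp add: L)
    then obtain N where N: "N \<in> kernels B" "K \<subseteq> N" "N \<inter> H \<subseteq> K"
      using residually_Mod_separates_finite[OF small normal_K res(2) H_subset] by blast
    have "{h \<in> H. h \<in> N} = L" using N(2,3) by (auto simp: L)
    then have "L \<in> kernels (B\<lparr>carrier := H\<rparr>)" using kernels_restrict[OF N(1) subgroup_H] by simp
    then show "in_class C (B\<lparr>carrier := H\<rparr> Mod L)" by (rule kernelsD(2))
  next
    assume cl: "in_class C (B\<lparr>carrier := H\<rparr> Mod L)"
    show "finite (carrier (B\<lparr>carrier := H\<rparr> Mod L))"
      using finite_image_of_locally_cyclic[OF assms(1) subgroup_H lc cl normal.r_coset_hom_Mod[OF nLH]]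
      by (simp add: carrier_FactGroup)
  qed
  have part2: "finite L \<longleftrightarrow> (\<exists>G\<in>C. \<exists>f\<in>epi B G. inj_on f L)" if res: "residually C B"
  proof
    assume "finite L"
    then obtain T where T: "T \<in> kernels B" "T \<inter> L \<subseteq> {\<one>\<^bsub>B\<^esub>}"
      using residually_separates_finite[OF small res _ LB] by blast
    obtain G f where G: "G \<in> C" "f \<in> epi B G" "T = {x \<in> carrier B. f x = \<one>\<^bsub>G\<^esub>}" using kernelsE[OF T(1)] .
    interpret f: group_hom B G f
      using G member_group assms(1) by (simp add: group_hom_def group_hom_axioms_def epi_def)
    have "inj_on f L"
    proof (rule inj_onI)
      fix x y assume xy: "x \<in> L" "y \<in> L" "f x = f y"
      have xyB: "x \<in> carrier B" "y \<in> carrier B" using xy LB by auto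
      have "x \<otimes>\<^bsub>B\<^esub> inv\<^bsub>B\<^esub> y \<in> L" using xy sL by (simp add: subgroup.m_closed subgroup.m_inv_closed)
      moreover have "x \<otimes>\<^bsub>B\<^esub> inv\<^bsub>B\<^esub> y \<in> T" using xy xyB by (simp add: G(3))
      ultimately have "x \<otimes>\<^bsub>B\<^esub> inv\<^bsub>B\<^esub> y = \<one>\<^bsub>B\<^esub>" using T(2) by blast
      then show "x = y" using xyB by (metis G.inv_closed G.inv_equality G.inv_inv)
    qed
    then show "\<exists>G\<in>C. \<exists>f\<in>epi B G. inj_on f L" using G by blast
  next
    assume "\<exists>G\<in>C. \<exists>f\<in>epi B G. inj_on f L"
    then obtain G f where G: "G \<in> C" "f \<in> epi B G" "inj_on f L" by blast
    have "f \<in> hom (B\<lparr>carrier := L\<rparr>) G" using G(2) hom_restrict_carrier[of f B G, OF _ LB] by (simp add: epi_def)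
    then have "finite (f ` L)"
      using finite_image_of_locally_cyclic[OF assms(1) sL lcL in_class_member[OF G(1)]] by blast
    then show "finite L" using G(3) by (rule finite_imageD)
  qed
  have sufficient: "residually C E"
    if cl: "in_class C (restricted_aut_group B L \<phi>)"
      and res: "residually C B" "residually C (B Mod H)" "residually C (B Mod K)"
      and cofinal: "\<And>M. M \<in> kernels B \<Longrightarrow> \<exists>N\<in>kernels B. N \<subseteq> M \<and> \<phi> ` (N \<inter> H) = N \<inter> K \<and>
        N \<inter> (H <#>\<^bsub>B\<^esub> K) \<subseteq> (N \<inter> H) <#>\<^bsub>B\<^esub> (N \<inter> K)"
  proof (rule residually_E_if_cofinal[OF lc _ _ _ res cofinal])
    show "in_class C (restricted_aut_group B (H \<inter> K) \<phi>)" using cl by (simp add: L)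
    show "restrict \<phi> (H \<inter> K) \<in> carrier (restricted_aut_group B (H \<inter> K) \<phi>)"
      using restrict_\<phi>_auto
      by (simp add: restricted_aut_group_def subgroup_generated_def carrier_AutoGroup generate.incl)
    show "\<forall>x\<in>H \<inter> K. (\<phi> ^^ n) x = x"
      if "restrict \<phi> (H \<inter> K) [^]\<^bsub>restricted_aut_group B (H \<inter> K) \<phi>\<^esub> n = \<one>\<^bsub>restricted_aut_group B (H \<inter> K) \<phi>\<^esub>" for n :: nat
      using restricted_aut_group_order[OF that] by blast
  qed
  note necessary = residually_base_if_residually_E residually_Mod_if_residually_E[OF lc]
  have part3: "residually C E \<longleftrightarrow> residually C B \<and> residually C (B Mod H) \<and> residually C (B Mod K)"
    if fin: "finite (carrier (B\<lparr>carrier := H\<rparr> Mod L))" and cl: "in_class C (restricted_aut_group B L \<phi>)"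
    using necessary sufficient[OF cl] cofinal_if_finite_index[OF lc] fin by (metis L)
  have part4: "residually C E \<longleftrightarrow> residually C B \<and> residually C (B Mod H) \<and> residually C (B Mod K) \<and>
      in_class C (restricted_aut_group B L \<phi>)"
    if fin: "finite L" and qr: "quasi_regular C B (H <#>\<^bsub>B\<^esub> K)"
    using necessary sufficient cofinal_if_quasi_regular[OF lc _ _ qr] restricted_aut_group_in_class fin by (metis L)
  show ?thesis unfolding E using part1 part2 part3 part4 by blast
qed

end
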